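(* Let $(A,b)\in\mathcal B$ (setting $\mathcal B$), let $\gamma:=\frac{\mathrm{tr}(A)}{|A|^2+|b|^2}$, $\tilde A:=\gamma A$, $\tilde b:=\gamma b$, let $r\in L^2_{\mathrm{per}}(Y)$ be the unique solution in $L^2_{\mathrm{per}}(Y)$ to $-D^2:(Ar)+\nabla\cdot(br)=0$ in $Y$, $r$ $Y$-periodic, $\int_Y r=1$, and suppose that the centering condition $\int_Y r\,b=0$ holds. Let $B_1:H^2_{\mathrm{per},0}(Y)\times H^2_{\mathrm{per},0}(Y)\to\mathbb{R}$ and $B_2:H^1_{\mathrm{per},0}(Y;\mathbb{R}^n)\times H^1_{\mathrm{per},0}(Y;\mathbb{R}^n)\to\mathbb{R}$ be given by $$B_1(\varphi_1,\varphi_2):=\int_Y\Delta\varphi_1\left(\tilde A:D^2\varphi_2+\tilde b\cdot\nabla\varphi_2\right),$$ $$B_2(v,w):=\int_Y(\nabla\cdot v)(\tilde A:Dw+\tilde b\cdot w)+\frac12\int_Y(Dv-(Dv)^{\mathrm T}):(Dw-(Dw)^{\mathrm T}).$$ Let $j\in\{1,\dots,n\}$. Then the following assertions hold. (i) There exists a unique $\chi_j\in H^2_{\mathrm{per},0}(Y)$ such that $B_1(\varphi,\chi_j)=-\int_Y\tilde b_j\Delta\varphi$ for all $\varphi\in H^2_{\mathrm{per},0}(Y)$. Further, $\chi_j$ is the unique solution in $H^2_{\mathrm{per},0}(Y)$ to $$-A:D^2\chi_j-b\cdot\nabla\chi_j=b_j\ \text{ in }Y,\qquad\chi_j\text{ is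 }Y\text{-periodic},\qquad\int_Y\chi_j=0.$$ (ii) The function $\xi_j:=\nabla\chi_j$ is the unique element $\xi_j\in H^1_{\mathrm{per},0}(Y;\mathbb{R}^n)$ that satisfies $B_2(w,\xi_j)=-\int_Y\tilde b_j\nabla\cdot w$ for all $w\in H^1_{\mathrm{per},0}(Y;\mathbb{R}^n)$. Further, for any closed linear subspace $P_h$ of $H^1_{\mathrm{per},0}(Y;\mathbb{R}^n)$ there exists a unique $\xi_{j,h}\in P_h$ such that $B_2(w_h,\xi_{j,h})=-\int_Y\tilde b_j\nabla\cdot w_h$ for all $w_h\in P_h$, and $$\|\nabla\chi_j-\xi_{j,h}\|_{H^1(Y;\mathbb{R}^n)}\le C\inf_{w_h\in P_h}\|D(\nabla\chi_j-w_h)\|_{L^2(Y;\mathbb{R}^{n\times n})}$$ for some constant $C=C(\lambda,\Lambda,\delta,n)>0$.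
   Context: $Y:=(0,1)^n\subset\mathbb{R}^n$. The subscript "per" denotes spaces of $Y$-periodic functions on $\mathbb{R}^n$ with the indicated (local) regularity; the additional subscript $0$ means that (each component of) the function has mean zero over $Y$. $|A|:=\sqrt{A:A}$ is the Frobenius norm, $|b|$ the Euclidean norm, $M:N=\sum_{ij}M_{ij}N_{ij}$, and $Dw$ is the Jacobian of $w$. Setting $\mathcal B$: $(A,b)\in\mathcal B$ means that $A\in L^\infty_{\mathrm{per}}(Y;\mathbb{R}^{n\times n}_{\mathrm{sym}})$, $b\in L^\infty_{\mathrm{per}}(Y;\mathbb{R}^n)$; $A$ is uniformly elliptic, i.e. there are $\lambda,\Lambda>0$ with $\lambda I_n\le A\le\Lambda I_n$ a.e. in $\mathbb{R}^n$; and the Cordes-type condition holds: there exists $\delta\in\left(\frac{n}{n+\pi^2},1\right]$ such that $\frac{|A|^2+|b|^2}{(\mathrm{tr}(A))^2}\le\frac{1}{n-1+\delta}$ a.e. in $\mathbb{R}^n$. The constants $\lambda,\Lambda,\delta$ in the claim are these. $D^2:(Au):=\sum_{i,j}\partial^2_{ij}(a_{ij}u)$. The solution $r\in L^2_{\mathrm{per}}(Y)$ is understood in the very weak sense: $\int_Y r\,(A:D^2\varphi+b\cdot\nabla\varphi)=0$ for all $\varphi\in H^2_{\mathrm{per}}(Y)$; its existence and uniqueness is established in the paper. The equation for $\chi_j\in H^2_{\mathrm{per},0}(Y)$ is understood a.e. *)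

theory Defs
  imports "HOL-Analysis.Analysis"
begin

text \<open>
  Elements of Lebesgue and Sobolev spaces are represented by functions on the whole space, and all
  the spaces below are closed under modification on null sets.  Accordingly, uniqueness always
  means uniqueness up to equality almost everywhere.  On matrices of type \<^typ>\<open>real^'n^'n\<close> the
  library's norm and inner product are the Frobenius ones: \<open>M \<bullet> N\<close> is the sum of
  \<open>M $ i $ j * N $ i $ j\<close> over all \<open>i\<close>, \<open>j\<close>.
\<close>

definition unit_cell :: "(real^'n) set" where
  "unit_cell = {x. \<forall>i. 0 < x $ i \<and> x $ i < 1}"

abbreviation int_cell :: "(real^'n \<Rightarrow> 'a::{banach, second_countable_topology}) \<Rightarrow> 'a" where
  "int_cell f \<equiv> set_lebesgue_integral lebesgue unit_cell f"

definition periodic :: "(real^'n \<Rightarrow> 'a) \<Rightarrow> bool" where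
  "periodic f \<longleftrightarrow> (\<forall>i. AE x in lebesgue. f (x + axis i 1) = f x)"

definition unique_ae :: "(real^'n \<Rightarrow> 'a) set \<Rightarrow> ((real^'n \<Rightarrow> 'a) \<Rightarrow> bool) \<Rightarrow> (real^'n \<Rightarrow> 'a) \<Rightarrow> bool" where
  "unique_ae S P u \<longleftrightarrow> u \<in> S \<and> P u \<and> (\<forall>v\<in>S. P v \<longrightarrow> (AE x in lebesgue. v x = u x))"


section \<open>Weak derivatives\<close>

definition partial_deriv :: "'n \<Rightarrow> (real^'n \<Rightarrow> real) \<Rightarrow> real^'n \<Rightarrow> real" where
  "partial_deriv i f x = frechet_derivative f (at x) (axis i 1)"

primrec C_k :: "nat \<Rightarrow> (real^'n \<Rightarrow> real) \<Rightarrow> bool" where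
  "C_k 0 f \<longleftrightarrow> continuous_on UNIV f"
| "C_k (Suc k) f \<longleftrightarrow> (\<forall>x. f differentiable (at x)) \<and> (\<forall>i. C_k k (partial_deriv i f))"

definition test_functions :: "(real^'n \<Rightarrow> real) set" where
  "test_functions = {f. (\<forall>k. C_k k f) \<and> compact (closure {x. f x \<noteq> 0})}"

definition L1_loc :: "(real^'n \<Rightarrow> real) set" where
  "L1_loc = {f. \<forall>K. compact K \<longrightarrow> set_integrable lebesgue K f}"

definition L2_loc :: "(real^'n \<Rightarrow> real) set" where
  "L2_loc = {f \<in> borel_measurable lebesgue.
     \<forall>K. compact K \<longrightarrow> set_integrable lebesgue K (\<lambda>x. (f x)\<^sup>2)}"

definition has_weak_partial :: "'n \<Rightarrow> (real^'n \<Rightarrow> real) \<Rightarrow> (real^'n \<Rightarrow> real) \<Rightarrow> bool" where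
  "has_weak_partial i f g \<longleftrightarrow> f \<in> L1_loc \<and> g \<in> L1_loc \<and>
     (\<forall>\<phi>\<in>test_functions.
        (LINT x|lebesgue. f x * partial_deriv i \<phi> x) = - (LINT x|lebesgue. g x * \<phi> x))"

text \<open>
  Weak derivatives are determined only almost everywhere; a representative is chosen, depending
  only on the class of \<open>f\<close>.  It is meaningful only if a weak derivative exists.
\<close>

definition weak_partial :: "'n \<Rightarrow> (real^'n \<Rightarrow> real) \<Rightarrow> real^'n \<Rightarrow> real" where
  "weak_partial i f = (SOME g. has_weak_partial i f g)"

definition grad :: "(real^'n \<Rightarrow> real) \<Rightarrow> real^'n \<Rightarrow> real^'n" where
  "grad f x = (\<chi> i. weak_partial i f x)"

definition hessian :: "(real^'n \<Rightarrow> real) \<Rightarrow> real^'n \<Rightarrow> real^'n^'n" where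
  "hessian f x = (\<chi> i j. weak_partial i (weak_partial j f) x)"

definition laplacian :: "(real^'n \<Rightarrow> real) \<Rightarrow> real^'n \<Rightarrow> real" where
  "laplacian f x = (\<Sum>i\<in>UNIV. weak_partial i (weak_partial i f) x)"

definition weak_jacobian :: "(real^'n \<Rightarrow> real^'n) \<Rightarrow> real^'n \<Rightarrow> real^'n^'n" where
  "weak_jacobian w x = (\<chi> i j. weak_partial j (\<lambda>y. w y $ i) x)"

definition divergence :: "(real^'n \<Rightarrow> real^'n) \<Rightarrow> real^'n \<Rightarrow> real" where
  "divergence w x = (\<Sum>i\<in>UNIV. weak_partial i (\<lambda>y. w y $ i) x)"


section \<open>Periodic function spaces\<close>

primrec H_loc :: "nat \<Rightarrow> (real^'n \<Rightarrow> real) set" where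
  "H_loc 0 = L2_loc"
| "H_loc (Suc k) = {f \<in> L2_loc. \<forall>i. \<exists>g \<in> H_loc k. has_weak_partial i f g}"

definition L2_per :: "(real^'n \<Rightarrow> real) set" where
  "L2_per = {f \<in> L2_loc. periodic f}"

definition H_per :: "nat \<Rightarrow> (real^'n \<Rightarrow> real) set" where
  "H_per k = {f \<in> H_loc k. periodic f}"

definition H_per0 :: "nat \<Rightarrow> (real^'n \<Rightarrow> real) set" where
  "H_per0 k = {f \<in> H_per k. int_cell f = 0}"

definition H1_per0_vec :: "(real^'n \<Rightarrow> real^'n) set" where
  "H1_per0_vec = {w. \<forall>i. (\<lambda>x. w x $ i) \<in> H_per0 1}"

definition Linf_per :: "(real^'n \<Rightarrow> 'a::euclidean_space) set" where
  "Linf_per = {f \<in> borel_measurable lebesgue. periodic f \<and> (\<exists>C. AE x in lebesgue. norm (f x) \<le> C)}"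

definition L2_norm_cell :: "(real^'n \<Rightarrow> 'a::euclidean_space) \<Rightarrow> real" where
  "L2_norm_cell f = sqrt (int_cell (\<lambda>x. (norm (f x))\<^sup>2))"

definition H1_norm_cell :: "(real^'n \<Rightarrow> real^'n) \<Rightarrow> real" where
  "H1_norm_cell w = sqrt ((L2_norm_cell w)\<^sup>2 + (L2_norm_cell (weak_jacobian w))\<^sup>2)"

definition closed_subspace_H1_per0 :: "(real^'n \<Rightarrow> real^'n) set \<Rightarrow> bool" where
  "closed_subspace_H1_per0 P \<longleftrightarrow>
     P \<subseteq> H1_per0_vec \<and>
     (\<lambda>x. 0) \<in> P \<and>
     (\<forall>u\<in>P. \<forall>v\<in>P. (\<lambda>x. u x + v x) \<in> P) \<and>
     (\<forall>c. \<forall>u\<in>P. (\<lambda>x. c *\<^sub>R u x) \<in> P) \<and>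
     (\<forall>u v. (\<forall>k::nat. u k \<in> P) \<longrightarrow> v \<in> H1_per0_vec \<longrightarrow>
        (\<lambda>k. H1_norm_cell (\<lambda>x. u k x - v x)) \<longlonglongrightarrow> 0 \<longrightarrow> v \<in> P)"


section \<open>The coefficients and the bilinear forms\<close>

definition setting_B ::
  "real \<Rightarrow> real \<Rightarrow> real \<Rightarrow> (real^'n \<Rightarrow> real^'n^'n) \<Rightarrow> (real^'n \<Rightarrow> real^'n) \<Rightarrow> bool" where
  "setting_B lam Lam \<delta> A b \<longleftrightarrow>
     A \<in> Linf_per \<and> b \<in> Linf_per \<and>
     (AE x in lebesgue. transpose (A x) = A x) \<and>
     0 < lam \<and> 0 < Lam \<and>
     (AE x in lebesgue. \<forall>v. lam * (v \<bullet> v) \<le> v \<bullet> (A x *v v) \<and> v \<bullet> (A x *v v) \<le> Lam * (v \<bullet> v)) \<and>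
     real CARD('n) / (real CARD('n) + pi\<^sup>2) < \<delta> \<and> \<delta> \<le> 1 \<and>
     (AE x in lebesgue. ((norm (A x))\<^sup>2 + (norm (b x))\<^sup>2) / (trace (A x))\<^sup>2
        \<le> 1 / (real CARD('n) - 1 + \<delta>))"

definition gam :: "(real^'n \<Rightarrow> real^'n^'n) \<Rightarrow> (real^'n \<Rightarrow> real^'n) \<Rightarrow> real^'n \<Rightarrow> real" where
  "gam A b x = trace (A x) / ((norm (A x))\<^sup>2 + (norm (b x))\<^sup>2)"

definition A_tilde :: "(real^'n \<Rightarrow> real^'n^'n) \<Rightarrow> (real^'n \<Rightarrow> real^'n) \<Rightarrow> real^'n \<Rightarrow> real^'n^'n" where
  "A_tilde A b x = gam A b x *\<^sub>R A x"

definition b_tilde :: "(real^'n \<Rightarrow> real^'n^'n) \<Rightarrow> (real^'n \<Rightarrow> real^'n) \<Rightarrow> real^'n \<Rightarrow> real^'n" where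
  "b_tilde A b x = gam A b x *\<^sub>R b x"

text \<open>
  Very weak formulation of \<open>- D\<^sup>2 : (A r) + div (b r) = 0\<close>, together with the normalization.
\<close>

definition invariant_density ::
  "(real^'n \<Rightarrow> real^'n^'n) \<Rightarrow> (real^'n \<Rightarrow> real^'n) \<Rightarrow> (real^'n \<Rightarrow> real) \<Rightarrow> bool" where
  "invariant_density A b r \<longleftrightarrow>
     r \<in> L2_per \<and>
     (\<forall>\<phi> \<in> H_per 2. int_cell (\<lambda>x. r x * (A x \<bullet> hessian \<phi> x + b x \<bullet> grad \<phi> x)) = 0) \<and>
     int_cell r = 1"

definition B1 :: "(real^'n \<Rightarrow> real^'n^'n) \<Rightarrow> (real^'n \<Rightarrow> real^'n) \<Rightarrow>
    (real^'n \<Rightarrow> real) \<Rightarrow> (real^'n \<Rightarrow> real) \<Rightarrow> real" where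
  "B1 A b \<phi>1 \<phi>2 =
     int_cell (\<lambda>x. laplacian \<phi>1 x * (A_tilde A b x \<bullet> hessian \<phi>2 x + b_tilde A b x \<bullet> grad \<phi>2 x))"

definition B2 :: "(real^'n \<Rightarrow> real^'n^'n) \<Rightarrow> (real^'n \<Rightarrow> real^'n) \<Rightarrow>
    (real^'n \<Rightarrow> real^'n) \<Rightarrow> (real^'n \<Rightarrow> real^'n) \<Rightarrow> real" where
  "B2 A b v w =
     int_cell (\<lambda>x. divergence v x * (A_tilde A b x \<bullet> weak_jacobian w x + b_tilde A b x \<bullet> w x)) +
     1/2 * int_cell (\<lambda>x. (weak_jacobian v x - transpose (weak_jacobian v x)) \<bullet>
                          (weak_jacobian w x - transpose (weak_jacobian w x)))"

end

theory Submission
  imports Defs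
begin

text \<open>
  On periodic mean-zero vector fields, Fourier series give
  \<open>\<integral> Dv : Dw = \<integral> (div v) (div w) + 1/2 \<integral> curl v : curl w\<close> and the Poincare inequality with constant
  \<open>1 / (4 pi\<^sup>2)\<close>. Hence \<open>B2 v w\<close> differs from \<open>\<integral> Dv : Dw\<close> only by \<open>\<integral> (div v) R\<close> with
  \<open>R = (A_tilde - I) : Dw + b_tilde \<bullet> w\<close>, and the Cordes condition bounds the norm of \<open>R\<close> by a factor
  \<open>q = sqrt ((1 - \<delta>) (1 + 1 / (4 pi\<^sup>2))) < 1\<close> times that of \<open>Dw\<close>. So the variational problem is uniquely
  solvable on every closed subspace, and Cea's argument gives the quasi-optimality.
  Solving on the subspace of gradients yields \<open>\<chi>\<close> with \<open>A_tilde : D\<^sup>2\<chi> + b_tilde \<bullet> \<nabla>\<chi> = - b_tilde\<^sub>j\<close> up to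
  a constant, because only constants are orthogonal to all Laplacians. Testing with \<open>r / gam\<close>, whose
  integral is nonzero, the centering condition forces the constant to vanish.
\<close>

section \<open>Square integrable functions\<close>

text \<open>The bound on \<open>\<delta>\<close> in \<open>setting_B\<close> is exactly what (1 -
  \<delta>) (1 + n / pi^2) < 1 needs, n / pi^2 being the Poincare constant of a convex domain of
  diameter sqrt n. Periodicity improves that constant, so \<open>q < 1\<close> holds with room to
  spare. As \<open>q\<close> depends on \<open>\<delta>\<close> alone, the constant of the estimate
  can be fixed before \<open>A\<close>, \<open>b\<close>, \<open>r\<close> and \<open>j\<close>.
  Since \<open>B2\<close> is not symmetric, Riesz representation alone does not solve the
  variational problem; closeness to the Dirichlet inner product turns it into a fixed point problem
  for a contraction. \<open>B1\<close> needs no analysis of its own: curls of gradients vanish, so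
  on gradients it coincides with \<open>B2\<close>. Functions are not identified when they agree
  almost everywhere, and chosen weak derivatives are linear only up to null sets; hence the abstract
  spaces carry semi-inner products, and many identities are moved through integrals. The bulk of the
  work is analysis on the torus: carrying integration by parts from compactly supported test
  functions to periodic ones, and completeness of the trigonometric system in several
  variables.\<close>

definition sq_integrable :: "'a measure \<Rightarrow> ('a \<Rightarrow> real) \<Rightarrow> bool" where
  "sq_integrable M f \<longleftrightarrow> f \<in> borel_measurable M \<and> integrable M (\<lambda>x. (f x)\<^sup>2)"

lemma sq_integrable_measurable: "sq_integrable M f \<Longrightarrow> f \<in> borel_measurable M"
  by (simp add: sq_integrable_def)

lemma sq_integrable_square: "sq_integrable M f \<Longrightarrow> integrable M (\<lambda>x. (f x)\<^sup>2)"
  by (simp add: sq_integrable_def)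

lemma sq_integrable_mult:
  assumes "sq_integrable M f" "sq_integrable M g"
  shows "integrable M (\<lambda>x. f x * g x)"
proof (rule Bochner_Integration.integrable_bound)
  show "integrable M (\<lambda>x. (f x)\<^sup>2 + (g x)\<^sup>2)"
    using assms by (auto simp: sq_integrable_def)
  show "(\<lambda>x. f x * g x) \<in> borel_measurable M"
    using assms by (auto simp: sq_integrable_def)
  have "\<bar>a * b\<bar> \<le> a\<^sup>2 + b\<^sup>2" for a b :: real
  proof -
    have "0 \<le> \<bar>a\<bar> * \<bar>b\<bar>" by simp
    then show ?thesis
      using sum_squares_bound[of "\<bar>a\<bar>" "\<bar>b\<bar>"] unfolding abs_mult mult.assoc power2_abs by linarith
  qed
  then show "AE x in M. norm (f x * g x) \<le> norm ((f x)\<^sup>2 + (g x)\<^sup>2)"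
    by (intro AE_I2) (simp add: order_trans[OF _ abs_ge_self])
qed

lemma sq_integrable_add:
  assumes "sq_integrable M f" "sq_integrable M g"
  shows "sq_integrable M (\<lambda>x. f x + g x)"
  using assms sq_integrable_mult[OF assms]
  by (auto simp: sq_integrable_def power2_sum mult.assoc)

lemma sq_integrable_cmult: "sq_integrable M f \<Longrightarrow> sq_integrable M (\<lambda>x. c * f x)"
  by (auto simp: sq_integrable_def power_mult_distrib)

lemma sq_integrable_minus: "sq_integrable M f \<Longrightarrow> sq_integrable M (\<lambda>x. - f x)"
  using sq_integrable_cmult[of M f "-1"] by simp

lemma sq_integrable_diff:
  "sq_integrable M f \<Longrightarrow> sq_integrable M g \<Longrightarrow> sq_integrable M (\<lambda>x. f x - g x)"
  using sq_integrable_add[of M f "\<lambda>x. - g x"] sq_integrable_minus[of M g] by simp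

lemma sq_integrable_zero: "sq_integrable M (\<lambda>x. 0)"
  by (simp add: sq_integrable_def)

lemma sq_integrable_sum:
  "(\<And>i. i \<in> I \<Longrightarrow> sq_integrable M (f i)) \<Longrightarrow> sq_integrable M (\<lambda>x. \<Sum>i\<in>I. f i x)"
  by (induction I rule: infinite_finite_induct) (auto intro: sq_integrable_zero sq_integrable_add)

lemma sq_integrable_bound:
  assumes "sq_integrable M g" "f \<in> borel_measurable M" "AE x in M. \<bar>f x\<bar> \<le> C * \<bar>g x\<bar>"
  shows "sq_integrable M f"
  unfolding sq_integrable_def
proof
  show "integrable M (\<lambda>x. (f x)\<^sup>2)"
  proof (rule Bochner_Integration.integrable_bound)
    show "integrable M (\<lambda>x. (C * g x)\<^sup>2)"
      using sq_integrable_square[OF sq_integrable_cmult[OF assms(1)]] .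
    show "(\<lambda>x. (f x)\<^sup>2) \<in> borel_measurable M" using assms(2) by simp
    show "AE x in M. norm ((f x)\<^sup>2) \<le> norm ((C * g x)\<^sup>2)"
      using assms(3)
    proof eventually_elim
      case (elim x)
      then have "\<bar>f x\<bar> \<le> \<bar>C * g x\<bar>"
        unfolding abs_mult using mult_right_mono[OF abs_ge_self[of C] abs_ge_zero[of "g x"]] by linarith
      then show ?case by (simp add: abs_le_square_iff)
    qed
  qed
qed (rule assms(2))

lemma sq_integrable_mult_bounded:
  assumes "sq_integrable M g" "h \<in> borel_measurable M" "AE x in M. \<bar>h x\<bar> \<le> C"
  shows "sq_integrable M (\<lambda>x. h x * g x)"
proof (rule sq_integrable_bound[OF assms(1)])
  show "(\<lambda>x. h x * g x) \<in> borel_measurable M"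
    using assms by (auto simp: sq_integrable_def)
  show "AE x in M. \<bar>h x * g x\<bar> \<le> C * \<bar>g x\<bar>"
    using assms(3) by eventually_elim (simp add: abs_mult mult_right_mono)
qed

lemma sq_integrable_cong_AE:
  assumes "AE x in M. f x = g x" "f \<in> borel_measurable M" "sq_integrable M g"
  shows "sq_integrable M f"
proof (rule sq_integrable_bound[where C = 1 and g = g])
  show "AE x in M. \<bar>f x\<bar> \<le> 1 * \<bar>g x\<bar>" using assms(1) by eventually_elim simp
qed (use assms in auto)

lemma (in finite_measure) sq_integrable_bounded:
  assumes "f \<in> borel_measurable M" "AE x in M. \<bar>f x\<bar> \<le> C"
  shows "sq_integrable M f"
  by (rule sq_integrable_bound[where C = C and g = "\<lambda>x. 1"]) (use assms in \<open>simp_all add: sq_integrable_def\<close>)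

lemma (in finite_measure) sq_integrable_const: "sq_integrable M (\<lambda>x. c)"
  by (simp add: sq_integrable_def)

lemma (in finite_measure) sq_integrable_integrable: "sq_integrable M f \<Longrightarrow> integrable M f"
  using sq_integrable_mult[of M f "\<lambda>x. 1"] sq_integrable_const[of 1] by simp

text \<open>The quadratic polynomial behind every Cauchy-Schwarz argument: for integrals, for
  \<open>ip\<close>, and in \<open>Riesz_representation\<close>, where \<open>a\<close> is an excess
  over the infimum and the conclusion bounds a residual. The factor 2 in the linear term avoids a
  factor 4 in the conclusion.\<close>

lemma quadratic_form_discriminant:
  fixes a b c :: real
  assumes "\<And>t. 0 \<le> a + 2 * t * b + t\<^sup>2 * c" "c \<ge> 0"
  shows "b\<^sup>2 \<le> a * c"
proof (cases "c = 0")
  case True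
  have "b = 0"
  proof (rule ccontr)
    assume "b \<noteq> 0"
    \<comment> \<open>With \<open>c = 0\<close> the form is affine in \<open>t\<close>; this
      \<open>t\<close> gives it the value -1.\<close>
    with assms(1)[of "- (a + 1) / (2 * b)"] True show False
      by (simp add: field_simps)
  qed
  with True show ?thesis by simp
next
  case False
  with assms(2) have "c > 0" by simp
  have "0 \<le> a + 2 * (- b / c) * b + (- b / c)\<^sup>2 * c" by (rule assms(1))
  also have "\<dots> = a - b\<^sup>2 / c"
    using False by (simp add: field_simps power2_eq_square)
  finally show ?thesis using \<open>c > 0\<close> by (simp add: field_simps)
qed

lemma integral_Cauchy_Schwarz:
  assumes "sq_integrable M f" "sq_integrable M g"
  shows "(LINT x|M. f x * g x)\<^sup>2 \<le> (LINT x|M. (f x)\<^sup>2) * (LINT x|M. (g x)\<^sup>2)"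
proof (rule quadratic_form_discriminant)
  fix t :: real
  have "0 \<le> (LINT x|M. (f x + t * g x)\<^sup>2)" by simp
  also have "\<dots> = (LINT x|M. (f x)\<^sup>2 + 2 * t * (f x * g x) + t\<^sup>2 * (g x)\<^sup>2)"
    by (simp add: power2_sum power_mult_distrib algebra_simps)
  also have "\<dots> = (LINT x|M. (f x)\<^sup>2) + 2 * t * (LINT x|M. f x * g x) + t\<^sup>2 * (LINT x|M. (g x)\<^sup>2)"
    using assms by (simp add: sq_integrable_mult sq_integrable_square)
  finally show "0 \<le> (LINT x|M. (f x)\<^sup>2) + 2 * t * (LINT x|M. f x * g x) + t\<^sup>2 * (LINT x|M. (g x)\<^sup>2)" .
qed simp

lemma integral_Cauchy_Schwarz_sqrt:
  assumes "sq_integrable M f" "sq_integrable M g"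
  shows "\<bar>LINT x|M. f x * g x\<bar> \<le> sqrt (LINT x|M. (f x)\<^sup>2) * sqrt (LINT x|M. (g x)\<^sup>2)"
  using real_sqrt_le_mono[OF integral_Cauchy_Schwarz[OF assms]] by (simp add: real_sqrt_mult)

lemma (in finite_measure) integral_abs_le_L2:
  assumes "sq_integrable M f"
  shows "(LINT x|M. \<bar>f x\<bar>) \<le> sqrt (measure M (space M)) * sqrt (LINT x|M. (f x)\<^sup>2)"
proof -
  have "sq_integrable M (\<lambda>x. \<bar>f x\<bar>)" using assms by (auto simp: sq_integrable_def)
  from integral_Cauchy_Schwarz_sqrt[OF sq_integrable_const[of 1] this]
  show ?thesis by simp
qed

text \<open>Riesz-Fischer. On a finite measure space L2-Cauchy implies L1-Cauchy, which yields an
  almost everywhere convergent subsequence; Fatou's lemma then shows that its limit is the L2 limit.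
  The subsequence is part of the conclusion because \<open>L2_per_complete\<close> rebuilds the
  limit from it outside the cell.\<close>

lemma (in finite_measure) L2_complete:
  fixes f :: "nat \<Rightarrow> 'a \<Rightarrow> real"
  assumes f: "\<And>n. sq_integrable M (f n)"
    and C: "\<And>e. e > 0 \<Longrightarrow> \<exists>N. \<forall>m\<ge>N. \<forall>n\<ge>N. (LINT x|M. (f m x - f n x)\<^sup>2) < e"
  obtains r g where "strict_mono r" "sq_integrable M g" "AE x in M. (\<lambda>k. f (r k) x) \<longlonglongrightarrow> g x"
    "(\<lambda>n. LINT x|M. (f n x - g x)\<^sup>2) \<longlonglongrightarrow> 0"
proof -
  note [measurable] = f[THEN sq_integrable_measurable]
  define m where "m = measure M (space M)"
  have "\<exists>N. \<forall>i\<ge>N. \<forall>j\<ge>N. (LINT x|M. norm (f i x - f j x)) < e" if "e > 0" for e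
  proof -
    \<comment> \<open>The summand 1 keeps the denominator positive even for the zero measure and
      makes the final estimate strict.\<close>
    define e' where "e' = (e / (sqrt m + 1))\<^sup>2"
    have m: "sqrt m + 1 > 0" by (simp add: m_def add_nonneg_pos)
    have "e' > 0" using that m by (simp add: e'_def)
    then obtain N where N: "\<And>i j. i \<ge> N \<Longrightarrow> j \<ge> N \<Longrightarrow> (LINT x|M. (f i x - f j x)\<^sup>2) < e'"
      using C by metis
    have "(LINT x|M. norm (f i x - f j x)) < e" if "i \<ge> N" "j \<ge> N" for i j
    proof -
      have "(LINT x|M. norm (f i x - f j x)) \<le> sqrt m * sqrt (LINT x|M. (f i x - f j x)\<^sup>2)"
        using integral_abs_le_L2[OF sq_integrable_diff[OF f[of i] f[of j]]] by (simp add: m_def)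
      also have "\<dots> \<le> sqrt m * sqrt e'"
        using N[OF that] by (intro mult_left_mono) (auto simp: m_def)
      also have "\<dots> < (sqrt m + 1) * sqrt e'" using \<open>e' > 0\<close> by simp
      also have "\<dots> = e" using m \<open>e > 0\<close> by (simp add: e'_def real_sqrt_divide)
      finally show ?thesis .
    qed
    then show ?thesis by blast
  qed
  from cauchy_L1_AE_cauchy_subseq[OF sq_integrable_integrable[OF f] this]
  obtain r where r: "strict_mono r" "AE x in M. Cauchy (\<lambda>i. f (r i) x)" by blast
  define g where "g x = lim (\<lambda>i. f (r i) x)" for x
  have g[measurable]: "g \<in> borel_measurable M"
    unfolding g_def by measurable
  have conv: "AE x in M. (\<lambda>i. f (r i) x) \<longlonglongrightarrow> g x"
    using r(2) by eventually_elim (simp add: g_def Cauchy_convergent_iff convergent_LIMSEQ_iff)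
  \<comment> \<open>Fatou along the subsequence: a bound for the distance of \<open>f n\<close> to
    all later terms persists for its distance to \<open>g\<close>. Integrability comes from the same
    finite bound.\<close>
  have key: "integrable M (\<lambda>x. (f n x - g x)\<^sup>2) \<and> (LINT x|M. (f n x - g x)\<^sup>2) \<le> e"
    if n: "\<And>k. k \<ge> n \<Longrightarrow> (LINT x|M. (f n x - f k x)\<^sup>2) \<le> e" and e: "e \<ge> 0" for n e
  proof -
    have "(\<integral>\<^sup>+x. ennreal ((f n x - g x)\<^sup>2) \<partial>M) \<le> (\<integral>\<^sup>+x. liminf (\<lambda>k. ennreal ((f n x - f (r k) x)\<^sup>2)) \<partial>M)"
    proof (rule nn_integral_mono_AE)
      show "AE x in M. ennreal ((f n x - g x)\<^sup>2) \<le> liminf (\<lambda>k. ennreal ((f n x - f (r k) x)\<^sup>2))"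
        using conv
      proof eventually_elim
        case (elim x)
        then have "(\<lambda>k. ennreal ((f n x - f (r k) x)\<^sup>2)) \<longlonglongrightarrow> ennreal ((f n x - g x)\<^sup>2)"
          by (intro tendsto_ennrealI tendsto_intros)
        from lim_imp_Liminf[OF sequentially_bot this] show ?case by simp
      qed
    qed
    also have "\<dots> \<le> liminf (\<lambda>k. \<integral>\<^sup>+x. ennreal ((f n x - f (r k) x)\<^sup>2) \<partial>M)"
      by (rule nn_integral_liminf) measurable
    also have "\<dots> = liminf (\<lambda>k. ennreal (LINT x|M. (f n x - f (r k) x)\<^sup>2))"
      by (subst nn_integral_eq_integral) (use sq_integrable_square[OF sq_integrable_diff[OF f f]] in auto)
    also have "\<dots> \<le> liminf (\<lambda>k::nat. ennreal e)"
    proof (rule Liminf_mono)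
      have "LINT x|M. (f n x - f (r k) x)\<^sup>2 \<le> e" if "k \<ge> n" for k
        using n[of "r k"] seq_suble[OF r(1), of k] that by linarith
      then show "\<forall>\<^sub>F k in sequentially. ennreal (LINT x|M. (f n x - f (r k) x)\<^sup>2) \<le> ennreal e"
        using e by (auto simp: eventually_sequentially intro!: ennreal_leI)
    qed
    finally have le: "(\<integral>\<^sup>+x. ennreal ((f n x - g x)\<^sup>2) \<partial>M) \<le> ennreal e" by (simp add: Liminf_const)
    then have "integrable M (\<lambda>x. (f n x - g x)\<^sup>2)"
      by (intro integrableI_nonneg) (auto simp: ennreal_less_top le_less_trans)
    with le e show ?thesis by (simp add: nn_integral_eq_integral)
  qed
  obtain N1 where "\<And>m n. m \<ge> N1 \<Longrightarrow> n \<ge> N1 \<Longrightarrow> (LINT x|M. (f m x - f n x)\<^sup>2) < 1"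
    using C[of 1] by auto
  then have "sq_integrable M (\<lambda>x. f N1 x - g x)"
    using key[of N1 1] by (simp add: sq_integrable_def less_imp_le)
  from sq_integrable_diff[OF f[of N1] this] have sg: "sq_integrable M g" by simp
  have "(\<lambda>n. LINT x|M. (f n x - g x)\<^sup>2) \<longlonglongrightarrow> 0"
  proof (rule LIMSEQ_I)
    fix e :: real assume "e > 0"
    then obtain N where N: "\<And>m n. m \<ge> N \<Longrightarrow> n \<ge> N \<Longrightarrow> (LINT x|M. (f m x - f n x)\<^sup>2) < e / 2"
      using C[of "e / 2"] by auto
    have "norm ((LINT x|M. (f n x - g x)\<^sup>2) - 0) < e" if "n \<ge> N" for n
    proof -
      have "(LINT x|M. (f n x - g x)\<^sup>2) \<le> e / 2"
        using key[of n "e / 2"] N[of n] that \<open>e > 0\<close> by (simp add: less_imp_le)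
      then show ?thesis using \<open>e > 0\<close> by simp
    qed
    then show "\<exists>N. \<forall>n\<ge>N. norm ((LINT x|M. (f n x - g x)\<^sup>2) - 0) < e" by blast
  qed
  with that r(1) sg conv show thesis by blast
qed

lemma L2_tendsto_integral_mult:
  assumes f: "\<And>n. sq_integrable M (f n)" and g: "sq_integrable M g" and h: "sq_integrable M h"
    and lim: "(\<lambda>n. LINT x|M. (f n x - g x)\<^sup>2) \<longlonglongrightarrow> 0"
  shows "(\<lambda>n. LINT x|M. f n x * h x) \<longlonglongrightarrow> (LINT x|M. g x * h x)"
proof (rule Lim_transform2[OF tendsto_const])
  have "(\<lambda>n. sqrt (LINT x|M. (f n x - g x)\<^sup>2) * sqrt (LINT x|M. (h x)\<^sup>2)) \<longlonglongrightarrow> 0"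
    using tendsto_mult[OF tendsto_real_sqrt[OF lim] tendsto_const] by simp
  then show "(\<lambda>n. (LINT x|M. g x * h x) - (LINT x|M. f n x * h x)) \<longlonglongrightarrow> 0"
  proof (rule Lim_null_comparison[rotated], intro always_eventually allI)
    fix n
    have "(LINT x|M. g x * h x) - (LINT x|M. f n x * h x) = - (LINT x|M. (f n x - g x) * h x)"
      using f[of n] g h by (simp add: algebra_simps sq_integrable_mult)
    then show "norm ((LINT x|M. g x * h x) - (LINT x|M. f n x * h x))
        \<le> sqrt (LINT x|M. (f n x - g x)\<^sup>2) * sqrt (LINT x|M. (h x)\<^sup>2)"
      using integral_Cauchy_Schwarz_sqrt[OF sq_integrable_diff[OF f[of n] g] h] by simp
  qed
qed

section \<open>Complete semi-inner product spaces of functions\<close>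

text \<open>\<open>ip\<close> need not be definite, as functions that agree almost everywhere are
  not identified. Hence \<open>complete\<close> yields some limit without uniqueness, and uniqueness
  of solutions is derived from coercivity where it is needed.\<close>

locale function_hilbert =
  fixes V :: "('b \<Rightarrow> 'c::real_vector) set" and ip :: "('b \<Rightarrow> 'c) \<Rightarrow> ('b \<Rightarrow> 'c) \<Rightarrow> real"
  assumes zero_mem: "(\<lambda>x. 0) \<in> V"
    and add_mem: "u \<in> V \<Longrightarrow> v \<in> V \<Longrightarrow> (\<lambda>x. u x + v x) \<in> V"
    and scale_mem: "u \<in> V \<Longrightarrow> (\<lambda>x. c *\<^sub>R u x) \<in> V"
    and ip_sym: "u \<in> V \<Longrightarrow> v \<in> V \<Longrightarrow> ip u v = ip v u"
    and ip_add_left: "u \<in> V \<Longrightarrow> v \<in> V \<Longrightarrow> w \<in> V \<Longrightarrow> ip (\<lambda>x. u x + v x) w = ip u w + ip v w"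
    and ip_scale_left: "u \<in> V \<Longrightarrow> w \<in> V \<Longrightarrow> ip (\<lambda>x. c *\<^sub>R u x) w = c * ip u w"
    and ip_nonneg: "u \<in> V \<Longrightarrow> 0 \<le> ip u u"
    and complete: "(\<And>n::nat. s n \<in> V) \<Longrightarrow>
      (\<And>e. e > 0 \<Longrightarrow> \<exists>N. \<forall>m\<ge>N. \<forall>n\<ge>N. ip (\<lambda>x. s m x - s n x) (\<lambda>x. s m x - s n x) < e) \<Longrightarrow>
      \<exists>v\<in>V. (\<lambda>n. ip (\<lambda>x. s n x - v x) (\<lambda>x. s n x - v x)) \<longlonglongrightarrow> 0"
begin

definition nrm :: "('b \<Rightarrow> 'c) \<Rightarrow> real" where
  "nrm u = sqrt (ip u u)"

lemma diff_mem: "u \<in> V \<Longrightarrow> v \<in> V \<Longrightarrow> (\<lambda>x. u x - v x) \<in> V"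
  using add_mem[of u "\<lambda>x. (-1) *\<^sub>R v x"] scale_mem[of v "-1"] by simp

lemma ip_diff_left:
  "u \<in> V \<Longrightarrow> v \<in> V \<Longrightarrow> w \<in> V \<Longrightarrow> ip (\<lambda>x. u x - v x) w = ip u w - ip v w"
  using ip_add_left[of u "\<lambda>x. (-1) *\<^sub>R v x" w] ip_scale_left[of v w "-1"] scale_mem[of v "-1"] by simp

lemma ip_add_right:
  "u \<in> V \<Longrightarrow> v \<in> V \<Longrightarrow> w \<in> V \<Longrightarrow> ip w (\<lambda>x. u x + v x) = ip w u + ip w v"
  using ip_add_left[of u v w] by (simp add: ip_sym add_mem)

lemma ip_scale_right: "u \<in> V \<Longrightarrow> w \<in> V \<Longrightarrow> ip w (\<lambda>x. c *\<^sub>R u x) = c * ip w u"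
  using ip_scale_left[of u w c] by (simp add: ip_sym scale_mem)

lemma ip_diff_right:
  "u \<in> V \<Longrightarrow> v \<in> V \<Longrightarrow> w \<in> V \<Longrightarrow> ip w (\<lambda>x. u x - v x) = ip w u - ip w v"
  using ip_diff_left[of u v w] by (simp add: ip_sym diff_mem)

lemma nrm_nonneg: "u \<in> V \<Longrightarrow> 0 \<le> nrm u"
  by (simp add: nrm_def ip_nonneg)

lemma nrm_square: "u \<in> V \<Longrightarrow> (nrm u)\<^sup>2 = ip u u"
  by (simp add: nrm_def ip_nonneg)

lemma ip_lincomb:
  assumes "u \<in> V" "v \<in> V"
  shows "ip (\<lambda>x. u x + t *\<^sub>R v x) (\<lambda>x. u x + t *\<^sub>R v x) = ip u u + 2 * t * ip u v + t\<^sup>2 * ip v v"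
proof -
  note m = assms scale_mem[OF assms(2), of t] add_mem[OF assms(1) scale_mem[OF assms(2), of t]]
  show ?thesis
    using m by (simp add: ip_add_left ip_add_right ip_scale_left ip_scale_right ip_sym[of v u]
        power2_eq_square algebra_simps)
qed

lemma ip_Cauchy_Schwarz:
  assumes "u \<in> V" "v \<in> V"
  shows "\<bar>ip u v\<bar> \<le> nrm u * nrm v"
proof -
  have "(ip u v)\<^sup>2 \<le> ip u u * ip v v"
  proof (rule quadratic_form_discriminant)
    show "0 \<le> ip u u + 2 * t * ip u v + t\<^sup>2 * ip v v" for t
      using ip_nonneg[OF add_mem[OF assms(1) scale_mem[OF assms(2), of t]]]
      by (simp add: ip_lincomb[OF assms])
  qed (rule ip_nonneg[OF assms(2)])
  from real_sqrt_le_mono[OF this] show ?thesis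
    by (simp add: nrm_def real_sqrt_mult)
qed

lemma nrm_triangle:
  assumes "u \<in> V" "v \<in> V"
  shows "nrm (\<lambda>x. u x + v x) \<le> nrm u + nrm v"
proof (rule power2_le_imp_le)
  have "(nrm (\<lambda>x. u x + v x))\<^sup>2 = ip u u + 2 * ip u v + ip v v"
    using ip_lincomb[OF assms, of 1] by (simp add: nrm_square add_mem assms)
  also have "\<dots> \<le> ip u u + 2 * (nrm u * nrm v) + ip v v"
    using ip_Cauchy_Schwarz[OF assms] by simp
  also have "\<dots> = (nrm u + nrm v)\<^sup>2"
    by (simp add: power2_sum nrm_square assms)
  finally show "(nrm (\<lambda>x. u x + v x))\<^sup>2 \<le> (nrm u + nrm v)\<^sup>2" .
  show "0 \<le> nrm u + nrm v" using assms by (simp add: nrm_nonneg)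
qed

lemma ip_tendsto:
  assumes "\<And>n. u n \<in> V" "v \<in> V" "w \<in> V"
    and "(\<lambda>n. ip (\<lambda>x. u n x - v x) (\<lambda>x. u n x - v x)) \<longlonglongrightarrow> 0"
  shows "(\<lambda>n. ip (u n) w) \<longlonglongrightarrow> ip v w"
proof -
  have "(\<lambda>n. nrm (\<lambda>x. u n x - v x)) \<longlonglongrightarrow> 0"
    using tendsto_real_sqrt[OF assms(4)] by (simp add: nrm_def)
  then have "(\<lambda>n. nrm (\<lambda>x. u n x - v x) * nrm w) \<longlonglongrightarrow> 0"
    by (rule tendsto_mult_left_zero)
  then have "(\<lambda>n. ip (u n) w - ip v w) \<longlonglongrightarrow> 0"
    by (rule Lim_null_comparison[rotated], intro always_eventually allI)
      (use ip_Cauchy_Schwarz[OF diff_mem[OF assms(1,2)] assms(3)] in \<open>simp add: ip_diff_left assms(1-3)\<close>)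
  then show ?thesis by (simp add: LIM_zero_iff)
qed

text \<open>The functional \<open>v \<mapsto> ip v v - 2 * l v\<close> is minimized; the parallelogram law makes every minimizing
  sequence a Cauchy sequence.\<close>

lemma Riesz_representation:
  assumes l_add: "\<And>u v. u \<in> V \<Longrightarrow> v \<in> V \<Longrightarrow> l (\<lambda>x. u x + v x) = l u + l v"
    and l_scale: "\<And>c u. u \<in> V \<Longrightarrow> l (\<lambda>x. c *\<^sub>R u x) = c * l u"
    and l_bound: "\<And>u. u \<in> V \<Longrightarrow> \<bar>l u\<bar> \<le> K * nrm u"
  shows "\<exists>u\<in>V. \<forall>v\<in>V. ip u v = l v"
proof -
  define J where "J v = ip v v - 2 * l v" for v
  have J_ge: "J v \<ge> - K\<^sup>2" if "v \<in> V" for v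
  proof -
    have "0 \<le> (nrm v - K)\<^sup>2" by simp
    then show ?thesis
      using l_bound[OF that] by (simp add: J_def power2_diff nrm_square[OF that] mult.commute)
  qed
  define m where "m = Inf (J ` V)"
  have bdd: "bdd_below (J ` V)" using J_ge by (intro bdd_belowI[of _ "- K\<^sup>2"]) blast
  have m_le: "m \<le> J v" if "v \<in> V" for v
    unfolding m_def by (rule cINF_lower[OF bdd that])
  have "\<exists>v\<in>V. J v < m + 1 / real (Suc n)" for n
    using cINF_less_iff[OF _ bdd, of "m + 1 / real (Suc n)"] zero_mem by (auto simp: m_def)
  then obtain u where u: "\<And>n. u n \<in> V" "\<And>n. J (u n) < m + 1 / real (Suc n)" by metis
  have parallelogram:
    "ip (\<lambda>x. v x - w x) (\<lambda>x. v x - w x) \<le> 2 * (J v - m) + 2 * (J w - m)" if "v \<in> V" "w \<in> V" for v w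
  proof -
    have a: "m \<le> J (\<lambda>x. (1/2) *\<^sub>R (v x + w x))"
      using that by (intro m_le scale_mem add_mem)
    define h where "h = (\<lambda>x. v x + w x)"
    have h: "h \<in> V" unfolding h_def by (intro add_mem that)
    have e1: "ip (\<lambda>x. (1/2) *\<^sub>R h x) (\<lambda>x. (1/2) *\<^sub>R h x) = ip h h / 4"
      by (simp only: ip_scale_left[OF h scale_mem[OF h]] ip_scale_right[OF h h])
    have e2: "ip h h = ip v v + 2 * ip v w + ip w w"
      using ip_lincomb[OF that, of 1] by (simp add: h_def)
    have e3: "l (\<lambda>x. (1/2) *\<^sub>R h x) = (l v + l w) / 2"
      by (simp only: l_scale[OF h]) (simp add: h_def l_add that)
    have "J (\<lambda>x. (1/2) *\<^sub>R h x) = (ip v v + 2 * ip v w + ip w w) / 4 - (l v + l w)"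
      by (simp only: J_def e1 e2 e3) (simp add: add_divide_distrib)
    then have "J (\<lambda>x. (1/2) *\<^sub>R (v x + w x)) = (ip v v + 2 * ip v w + ip w w) / 4 - (l v + l w)"
      by (simp only: h_def)
    moreover have "ip (\<lambda>x. v x - w x) (\<lambda>x. v x - w x) = ip v v - 2 * ip v w + ip w w"
      using ip_lincomb[OF that, of "-1"] by simp
    ultimately show ?thesis using a unfolding J_def by (simp add: field_simps)
  qed
  have "\<exists>v\<in>V. (\<lambda>n. ip (\<lambda>x. u n x - v x) (\<lambda>x. u n x - v x)) \<longlonglongrightarrow> 0"
  proof (rule complete[OF u(1)])
    fix e :: real assume "e > 0"
    then obtain N where N: "1 / real (Suc N) < e / 4"
      using nat_approx_posE[of "e / 4"] by auto
    have "ip (\<lambda>x. u i x - u j x) (\<lambda>x. u i x - u j x) < e" if "i \<ge> N" "j \<ge> N" for i j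
    proof -
      have "1 / real (Suc i) \<le> 1 / real (Suc N)" "1 / real (Suc j) \<le> 1 / real (Suc N)"
        using that by (auto intro!: divide_left_mono)
      then show ?thesis
        using parallelogram[OF u(1)[of i] u(1)[of j]] u(2)[of i] u(2)[of j] N
        unfolding right_diff_distrib by linarith
    qed
    then show "\<exists>N. \<forall>i\<ge>N. \<forall>j\<ge>N. ip (\<lambda>x. u i x - u j x) (\<lambda>x. u i x - u j x) < e" by blast
  qed
  then obtain w where w: "w \<in> V" "(\<lambda>n. ip (\<lambda>x. u n x - w x) (\<lambda>x. u n x - w x)) \<longlonglongrightarrow> 0" by blast
  have "ip w v = l v" if v: "v \<in> V" for v
  proof -
    \<comment> \<open>\<open>u n\<close> misses the infimum by less than 1 / (n + 1), so the
      functional along the line through \<open>u n\<close> in direction \<open>v\<close>, minus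
      \<open>m\<close>, is a nonnegative quadratic polynomial in \<open>t\<close>. Its discriminant
      bounds the residual of the Euler equation.\<close>
    have d: "(ip (u n) v - l v)\<^sup>2 \<le> 1 / real (Suc n) * ip v v" for n
    proof (rule quadratic_form_discriminant)
      fix t
      have tv: "(\<lambda>x. t *\<^sub>R v x) \<in> V" using v by (rule scale_mem)
      have "m \<le> J (\<lambda>x. u n x + t *\<^sub>R v x)" using tv u(1) by (intro m_le add_mem)
      also have "\<dots> = J (u n) + 2 * t * (ip (u n) v - l v) + t\<^sup>2 * ip v v"
        by (simp add: J_def ip_lincomb u(1) v tv l_add l_scale algebra_simps)
      finally show "0 \<le> 1 / real (Suc n) + 2 * t * (ip (u n) v - l v) + t\<^sup>2 * ip v v"
        using u(2)[of n] by linarith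
    qed (rule ip_nonneg[OF v])
    have "(\<lambda>n. (ip (u n) v - l v)\<^sup>2) \<longlonglongrightarrow> 0"
    proof (rule Lim_null_comparison)
      show "(\<lambda>n. 1 / real (Suc n) * ip v v) \<longlonglongrightarrow> 0"
        using LIMSEQ_inverse_real_of_nat by (intro tendsto_mult_left_zero) (simp add: inverse_eq_divide)
      show "\<forall>\<^sub>F n in sequentially. norm ((ip (u n) v - l v)\<^sup>2) \<le> 1 / real (Suc n) * ip v v"
        using d by simp
    qed
    moreover have "(\<lambda>n. (ip (u n) v - l v)\<^sup>2) \<longlonglongrightarrow> (ip w v - l v)\<^sup>2"
      by (intro tendsto_intros ip_tendsto u w v)
    ultimately have "(ip w v - l v)\<^sup>2 = 0" by (rule LIMSEQ_unique[symmetric])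
    then show ?thesis by simp
  qed
  with w(1) show ?thesis by blast
qed

text \<open>Solutions are fixed points of the contraction \<open>u \<mapsto> w\<close> with \<open>ip w v = l v + ip u v - B v u\<close>.\<close>

lemma Lax_Milgram_near_inner_product:
  assumes B_add_left: "\<And>u v w. u \<in> V \<Longrightarrow> v \<in> V \<Longrightarrow> w \<in> V \<Longrightarrow> B (\<lambda>x. u x + v x) w = B u w + B v w"
    and B_scale_left: "\<And>c u w. u \<in> V \<Longrightarrow> w \<in> V \<Longrightarrow> B (\<lambda>x. c *\<^sub>R u x) w = c * B u w"
    and B_diff_right: "\<And>u v w. u \<in> V \<Longrightarrow> v \<in> V \<Longrightarrow> w \<in> V \<Longrightarrow> B w (\<lambda>x. u x - v x) = B w u - B w v"
    and near: "\<And>u v. u \<in> V \<Longrightarrow> v \<in> V \<Longrightarrow> \<bar>B v u - ip v u\<bar> \<le> q * nrm v * nrm u"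
    and q: "0 \<le> q" "q < 1"
    and l_add: "\<And>u v. u \<in> V \<Longrightarrow> v \<in> V \<Longrightarrow> l (\<lambda>x. u x + v x) = l u + l v"
    and l_scale: "\<And>c u. u \<in> V \<Longrightarrow> l (\<lambda>x. c *\<^sub>R u x) = c * l u"
    and l_bound: "\<And>u. u \<in> V \<Longrightarrow> \<bar>l u\<bar> \<le> K * nrm u"
  shows "\<exists>u\<in>V. \<forall>v\<in>V. B v u = l v"
proof -
  have "\<exists>w\<in>V. \<forall>v\<in>V. ip w v = l v + (ip v u - B v u)" if u: "u \<in> V" for u
  proof (rule Riesz_representation[where K = "K + q * nrm u"])
    fix v assume v: "v \<in> V"
    show "\<bar>l v + (ip v u - B v u)\<bar> \<le> (K + q * nrm u) * nrm v"
      using l_bound[OF v] near[OF u v] by (simp add: algebra_simps)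
  qed (auto simp: l_add l_scale ip_add_left ip_scale_left B_add_left B_scale_left u algebra_simps)
  then obtain T where T: "\<And>u. u \<in> V \<Longrightarrow> T u \<in> V"
    "\<And>u v. u \<in> V \<Longrightarrow> v \<in> V \<Longrightarrow> ip (T u) v = l v + (ip v u - B v u)" by metis
  have contraction: "nrm (\<lambda>x. T u x - T v x) \<le> q * nrm (\<lambda>x. u x - v x)" if uv: "u \<in> V" "v \<in> V" for u v
  proof -
    define w where "w = (\<lambda>x. T u x - T v x)"
    have w: "w \<in> V" unfolding w_def by (intro diff_mem T uv)
    have "nrm w * nrm w = ip w w" using nrm_square[OF w] by (simp add: power2_eq_square)
    also have "\<dots> = ip (T u) w - ip (T v) w"
      using ip_diff_left[of "T u" "T v" w] T(1) uv w by (simp add: w_def)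
    also have "\<dots> = - (B w (\<lambda>x. u x - v x) - ip w (\<lambda>x. u x - v x))"
      using uv w by (simp add: T B_diff_right ip_diff_right)
    also have "\<dots> \<le> q * nrm (\<lambda>x. u x - v x) * nrm w"
      using near[OF diff_mem[OF uv] w] by (simp add: algebra_simps)
    finally have le: "nrm w * nrm w \<le> q * nrm (\<lambda>x. u x - v x) * nrm w" .
    show ?thesis
    proof (cases "nrm w = 0")
      case True
      then show ?thesis using q(1) nrm_nonneg[OF diff_mem[OF uv]] by (simp add: w_def)
    next
      case False
      then have "nrm w > 0" using nrm_nonneg[OF w] by simp
      with le show ?thesis by (simp add: w_def)
    qed
  qed
  define u where "u n = (T ^^ n) (\<lambda>x. 0)" for n
  have u: "u n \<in> V" for n
    by (induction n) (auto simp: u_def zero_mem T)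
  have u_Suc: "u (Suc n) = T (u n)" for n by (simp add: u_def)
  define D where "D = nrm (\<lambda>x. u 1 x - u 0 x)"
  have D: "D \<ge> 0" unfolding D_def by (intro nrm_nonneg diff_mem u)
  have step: "nrm (\<lambda>x. u (Suc n) x - u n x) \<le> q ^ n * D" for n
  proof (induction n)
    case 0
    then show ?case by (simp add: D_def)
  next
    case (Suc n)
    have "nrm (\<lambda>x. u (Suc (Suc n)) x - u (Suc n) x) \<le> q * nrm (\<lambda>x. u (Suc n) x - u n x)"
      using contraction[OF u[of "Suc n"] u[of n]] by (simp add: u_Suc)
    also have "\<dots> \<le> q * (q ^ n * D)" by (rule mult_left_mono[OF Suc q(1)])
    finally show ?case by simp
  qed
  \<comment> \<open>The exact partial geometric sum, rather than its limit, is what the induction on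
    \<open>p\<close> reproduces.\<close>
  have dist: "nrm (\<lambda>x. u (n + p) x - u n x) \<le> q ^ n * D * ((1 - q ^ p) / (1 - q))" for n p
  proof (induction p)
    case 0
    have "nrm (\<lambda>x. 0) = 0"
      using ip_scale_left[OF zero_mem zero_mem, of 0] by (simp add: nrm_def)
    then show ?case by simp
  next
    case (Suc p)
    have "nrm (\<lambda>x. u (n + Suc p) x - u n x)
        = nrm (\<lambda>x. (u (Suc (n + p)) x - u (n + p) x) + (u (n + p) x - u n x))" by simp
    also have "\<dots> \<le> nrm (\<lambda>x. u (Suc (n + p)) x - u (n + p) x) + nrm (\<lambda>x. u (n + p) x - u n x)"
      by (intro nrm_triangle diff_mem u)
    also have "\<dots> \<le> q ^ (n + p) * D + q ^ n * D * ((1 - q ^ p) / (1 - q))"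
      by (intro add_mono step Suc)
    also have "\<dots> = q ^ n * D * ((1 - q ^ Suc p) / (1 - q))"
      using q by (simp add: field_simps power_add)
    finally show ?case .
  qed
  have dist': "nrm (\<lambda>x. u (n + p) x - u n x) \<le> q ^ n * (D / (1 - q))" for n p
  proof -
    have "q ^ n * D * ((1 - q ^ p) / (1 - q)) \<le> q ^ n * D * (1 / (1 - q))"
      using q D by (intro mult_left_mono divide_right_mono) auto
    with dist[of n p] show ?thesis by simp
  qed
  have "\<exists>v\<in>V. (\<lambda>n. ip (\<lambda>x. u n x - v x) (\<lambda>x. u n x - v x)) \<longlonglongrightarrow> 0"
  proof (rule complete[OF u])
    fix e :: real assume e: "e > 0"
    have "(\<lambda>n. q ^ n * (D / (1 - q))) \<longlonglongrightarrow> 0"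
      using q by (intro tendsto_mult_left_zero LIMSEQ_power_zero) simp
    then obtain N where N: "\<And>n. n \<ge> N \<Longrightarrow> q ^ n * (D / (1 - q)) < sqrt e"
      using e LIMSEQ_D[of "\<lambda>n. q ^ n * (D / (1 - q))" 0 "sqrt e"] q D
      by (auto simp: abs_mult abs_of_nonneg)
    have nn: "ip (\<lambda>x. u i x - u j x) (\<lambda>x. u i x - u j x) < e" if "j \<ge> N" "i \<ge> j" for i j
    proof -
      have "nrm (\<lambda>x. u i x - u j x) < sqrt e"
        using dist'[of j "i - j"] N[OF that(1)] that by simp
      then show ?thesis by (simp add: nrm_def)
    qed
    have "ip (\<lambda>x. u i x - u j x) (\<lambda>x. u i x - u j x) < e" if "i \<ge> N" "j \<ge> N" for i j
    proof (cases "i \<ge> j")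
      case False
      have "ip (\<lambda>x. u i x - u j x) (\<lambda>x. u i x - u j x) = ip (\<lambda>x. u j x - u i x) (\<lambda>x. u j x - u i x)"
        by (simp add: ip_diff_left ip_diff_right u diff_mem)
      with nn[of i j] False that show ?thesis by simp
    qed (use nn that in blast)
    then show "\<exists>N. \<forall>i\<ge>N. \<forall>j\<ge>N. ip (\<lambda>x. u i x - u j x) (\<lambda>x. u i x - u j x) < e" by blast
  qed
  then obtain w where w: "w \<in> V" and lim: "(\<lambda>n. ip (\<lambda>x. u n x - w x) (\<lambda>x. u n x - w x)) \<longlonglongrightarrow> 0" by blast
  have "B v w = l v" if v: "v \<in> V" for v
  proof -
    have ip_lim: "(\<lambda>n. ip (u n) v) \<longlonglongrightarrow> ip w v" by (rule ip_tendsto[OF u w v lim])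
    \<comment> \<open>Continuity of \<open>B v\<close> comes from \<open>near\<close>: the
      difference between \<open>B v\<close> and \<open>ip v\<close> is controlled by the
      norm.\<close>
    have "(\<lambda>n. q * nrm v * nrm (\<lambda>x. u n x - w x)) \<longlonglongrightarrow> q * nrm v * 0"
      using tendsto_real_sqrt[OF lim] by (intro tendsto_intros) (simp add: nrm_def)
    moreover have "norm ((B v (u n) - ip v (u n)) - (B v w - ip v w)) \<le> q * nrm v * nrm (\<lambda>x. u n x - w x)" for n
    proof -
      have "(B v (u n) - ip v (u n)) - (B v w - ip v w) = B v (\<lambda>x. u n x - w x) - ip v (\<lambda>x. u n x - w x)"
        by (simp only: B_diff_right[OF u w v] ip_diff_right[OF u w v])
      with near[OF diff_mem[OF u[of n] w] v] show ?thesis by (simp only: real_norm_def)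
    qed
    ultimately have "(\<lambda>n. (B v (u n) - ip v (u n)) - (B v w - ip v w)) \<longlonglongrightarrow> 0"
      using Lim_null_comparison[OF always_eventually[OF allI]] by (metis (no_types, lifting) mult_zero_right)
    then have "(\<lambda>n. B v (u n) - ip v (u n)) \<longlonglongrightarrow> B v w - ip v w" by (simp add: LIM_zero_iff)
    moreover have eq: "l v - ip (u (Suc n)) v = B v (u n) - ip v (u n)" for n
      using T(2)[OF u v, of n] by (simp add: u_Suc)
    have "(\<lambda>n. l v - ip (u (Suc n)) v) \<longlonglongrightarrow> l v - ip w v"
      by (intro tendsto_diff tendsto_const LIMSEQ_Suc[OF ip_lim])
    then have "(\<lambda>n. B v (u n) - ip v (u n)) \<longlonglongrightarrow> l v - ip w v"
      by (simp only: eq)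
    ultimately have "B v w - ip v w = l v - ip w v" by (rule LIMSEQ_unique)
    then show ?thesis by (simp add: ip_sym[OF v w])
  qed
  with w show ?thesis by blast
qed

end

section \<open>Translations and periodic functions\<close>

lemma lebesgue_distr_translation: "distr lebesgue lebesgue (\<lambda>x. x + a) = (lebesgue :: 'a::euclidean_space measure)"
  and measurable_translation_lebesgue: "(\<lambda>x::'a. x + a) \<in> lebesgue \<rightarrow>\<^sub>M lebesgue"
proof -
  have eq: "(\<lambda>x::'a. a + (\<Sum>j\<in>Basis. (1 * (x \<bullet> j)) *\<^sub>R j)) = (\<lambda>x. x + a)"
    by (auto simp: euclidean_representation add.commute)
  show "(\<lambda>x::'a. x + a) \<in> lebesgue \<rightarrow>\<^sub>M lebesgue"
    using lebesgue_affine_measurable[of "\<lambda>_. 1" a] unfolding eq by simp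
  show "distr lebesgue lebesgue (\<lambda>x. x + a) = (lebesgue :: 'a measure)"
    using lebesgue_affine_euclidean[of "\<lambda>_. 1" a] unfolding eq
    by (simp add: density_1)
qed

lemma borel_measurable_translation_lebesgue:
  fixes f :: "'a::euclidean_space \<Rightarrow> 'b::topological_space"
  assumes "f \<in> borel_measurable lebesgue"
  shows "(\<lambda>x. f (x + a)) \<in> borel_measurable lebesgue"
  using measurable_compose[OF measurable_translation_lebesgue assms] .

lemma AE_translation:
  fixes P :: "'a::euclidean_space \<Rightarrow> bool"
  assumes "AE x in lebesgue. P x"
  shows "AE x in lebesgue. P (x + a)"
proof (rule AE_distrD[OF measurable_translation_lebesgue])
  show "AE x in distr lebesgue lebesgue (\<lambda>x. x + a). P x"
    unfolding lebesgue_distr_translation by (rule assms)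
qed

lemma integral_translation:
  fixes f :: "'a::euclidean_space \<Rightarrow> 'b::{banach, second_countable_topology}"
  assumes "f \<in> borel_measurable lebesgue"
  shows "(LINT x|lebesgue. f (x + a)) = (LINT x|lebesgue. f x)"
  using integral_distr[OF measurable_translation_lebesgue[of a] assms]
  by (simp add: lebesgue_distr_translation)

lemma integrable_translation:
  fixes f :: "'a::euclidean_space \<Rightarrow> 'b::{banach, second_countable_topology}"
  assumes "integrable lebesgue f"
  shows "integrable lebesgue (\<lambda>x. f (x + a))"
  using integrable_distr[OF measurable_translation_lebesgue[of a], of f] assms
  by (simp add: lebesgue_distr_translation)

lemma nn_integral_translation:
  fixes f :: "'a::euclidean_space \<Rightarrow> ennreal"
  assumes "f \<in> borel_measurable lebesgue"
  shows "(\<integral>\<^sup>+x. f (x + a) \<partial>lebesgue) = (\<integral>\<^sup>+x. f x \<partial>lebesgue)"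
  using nn_integral_distr[OF measurable_translation_lebesgue[of a], of f] assms
  by (simp add: lebesgue_distr_translation)

section \<open>Lattice translates of the unit cell\<close>

definition lattice_vec :: "int^'n \<Rightarrow> real^'n" where
  "lattice_vec s = (\<chi> i. of_int (s $ i))"

lemma lattice_vec_nth [simp]: "lattice_vec s $ i = of_int (s $ i)"
  by (simp add: lattice_vec_def)

text \<open>The almost-everywhere periods of \<open>f\<close> form a group under addition, and the
  unit vectors generate the lattice.\<close>

lemma periodic_lattice:
  fixes f :: "real^'n \<Rightarrow> 'a"
  assumes "periodic f"
  shows "AE x in lebesgue. f (x + lattice_vec s) = f x"
proof -
  define S where "S = {a. AE x in lebesgue. f (x + a) = f x}"
  have add: "a + b \<in> S" if "a \<in> S" "b \<in> S" for a b
  proof -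
    have "AE x in lebesgue. f (x + a + b) = f (x + a)"
      using that(2) by (intro AE_translation[where P = "\<lambda>x. f (x + b) = f x"]) (simp add: S_def)
    moreover have "AE x in lebesgue. f (x + a) = f x" using that(1) by (simp add: S_def)
    ultimately have "AE x in lebesgue. f (x + (a + b)) = f x"
      by eventually_elim (simp add: add.assoc)
    then show ?thesis by (simp add: S_def)
  qed
  have minus: "- a \<in> S" if "a \<in> S" for a
  proof -
    have "AE x in lebesgue. f (x + - a + a) = f (x + - a)"
      using that by (intro AE_translation[where P = "\<lambda>x. f (x + a) = f x"]) (simp add: S_def)
    then show ?thesis by (simp add: S_def eq_commute)
  qed
  have zero: "0 \<in> S" by (simp add: S_def)
  have "axis i 1 \<in> S" for i using assms by (simp add: periodic_def S_def)
  then have "real m *\<^sub>R axis i 1 \<in> S" for m i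
    by (induction m) (auto simp: zero scaleR_add_left intro!: add)
  then have "of_int m *\<^sub>R axis i 1 \<in> S" for m i
    using minus[of "real (nat (-m)) *\<^sub>R axis i 1"] by (cases m) (auto simp del: of_nat_Suc)
  then have "(\<Sum>i\<in>A. of_int (s $ i) *\<^sub>R axis i 1) \<in> S" for A
    by (induction A rule: infinite_finite_induct) (auto simp: zero add)
  then have "(\<Sum>i\<in>UNIV. of_int (s $ i) *\<^sub>R axis i 1) \<in> S" .
  moreover have "(\<Sum>i\<in>UNIV. of_int (s $ i) *\<^sub>R axis i 1) = lattice_vec s"
    using basis_expansion[of "lattice_vec s"] by (simp add: scalar_mult_eq_scaleR)
  ultimately show ?thesis by (simp add: S_def)
qed

lemma AE_not_integer_coordinate:
  "AE x::real^'n in lebesgue. \<forall>i. x $ i \<notin> \<int>"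
proof -
  have "AE x::real^'n in lebesgue. x $ i \<noteq> of_int m" for i m
  proof -
    have "AE x::real^'n in lebesgue. x $ i \<noteq> 0"
      using negligible_standard_hyperplane_cart[of i]
      by (simp add: negligible_iff_null_sets AE_iff_null_sets[symmetric] del: negligible_standard_hyperplane_cart) (auto simp: eventually_ae_filter)
    from AE_translation[OF this, of "- (of_int m *\<^sub>R axis i 1)"] show ?thesis by simp
  qed
  then have "AE x::real^'n in lebesgue. \<forall>i. \<forall>m. x $ i \<noteq> of_int m"
    by (simp add: AE_all_countable)
  then show ?thesis by eventually_elim (auto simp: Ints_def)
qed

text \<open>Off the hyperplanes with an integer coordinate, the translates of the open cell tile the
  space, and the floors name the tile. The excluded points form a null set by
  \<open>AE_not_integer_coordinate\<close>.\<close>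

lemma unit_cell_cover:
  fixes x :: "real^'n"
  assumes "\<forall>i. x $ i \<notin> \<int>"
  shows "x - lattice_vec s \<in> unit_cell \<longleftrightarrow> s = (\<chi> i. \<lfloor>x $ i\<rfloor>)"
proof -
  have "0 < x $ i - of_int (s $ i) \<and> x $ i - of_int (s $ i) < 1 \<longleftrightarrow> s $ i = \<lfloor>x $ i\<rfloor>" for i
  proof -
    have "x $ i \<noteq> of_int (s $ i)" using assms by (metis Ints_of_int)
    then show ?thesis by linarith
  qed
  then show ?thesis by (simp add: unit_cell_def vec_eq_iff)
qed

text \<open>\<open>periodic\<close> is applied to the predicate \<open>P\<close> itself, as a
  boolean function. Countably many translates of the exceptional set are still null.\<close>

lemma AE_unit_cell_periodic:
  fixes P :: "real^'n \<Rightarrow> bool"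
  assumes "AE x in lebesgue. x \<in> unit_cell \<longrightarrow> P x" "periodic P"
  shows "AE x in lebesgue. P x"
proof -
  have "AE x in lebesgue. \<forall>s. P (x + lattice_vec s) = P x"
    using periodic_lattice[OF assms(2)] by (simp add: AE_all_countable)
  moreover have "AE x in lebesgue. \<forall>s. x + lattice_vec s \<in> unit_cell \<longrightarrow> P (x + lattice_vec s)"
    using AE_translation[OF assms(1)] by (simp add: AE_all_countable)
  ultimately show ?thesis
    using AE_not_integer_coordinate
  proof eventually_elim
    case (elim x)
    define s :: "int^'n" where "s = (\<chi> i. - \<lfloor>x $ i\<rfloor>)"
    have "x + lattice_vec s = x - lattice_vec (- s)" by (simp add: vec_eq_iff)
    then have "x + lattice_vec s \<in> unit_cell"
      using unit_cell_cover[of x "- s"] elim(3) by (simp only:) (simp add: s_def vec_eq_iff)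
    with elim show ?case by blast
  qed
qed

section \<open>The cell as a measure space of mass one, and integrals over compact sets\<close>

lemma unit_cell_eq_box: "unit_cell = box (0::real^'n) 1"
  by (auto simp: unit_cell_def mem_box_cart)

lemma sets_unit_cell [measurable, simp]: "(unit_cell :: (real^'n) set) \<in> sets lebesgue"
  by (simp add: unit_cell_eq_box)

abbreviation cell :: "(real^'n) measure" where
  "cell \<equiv> lebesgue_on unit_cell"

lemma int_cell_eq: "int_cell f = (LINT x|cell. f x)"
  by (simp add: set_lebesgue_integral_def integral_restrict_space)

lemma emeasure_unit_cell: "emeasure lebesgue (unit_cell :: (real^'n) set) = 1"
proof -
  have "emeasure lborel (box (0::real^'n) 1) = ennreal (\<Prod>b\<in>Basis. ((1::real^'n) - 0) \<bullet> b)"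
    by (rule emeasure_lborel_box) (auto simp: Basis_vec_def inner_axis)
  also have "(\<Prod>b\<in>Basis. ((1::real^'n) - 0) \<bullet> b) = 1"
    by (rule prod.neutral) (auto simp: Basis_vec_def inner_axis)
  finally show ?thesis by (simp add: unit_cell_eq_box)
qed

lemma measure_cell [simp]: "measure cell (space cell) = 1"
  by (simp add: measure_restrict_space measure_def emeasure_unit_cell space_restrict_space emeasure_restrict_space)

interpretation cell: finite_measure "cell :: (real^'n) measure"
  by standard (simp add: emeasure_restrict_space emeasure_unit_cell space_restrict_space)

lemma AE_cell_iff: "(AE x in cell. P x) \<longleftrightarrow> (AE x in lebesgue. x \<in> unit_cell \<longrightarrow> P x)"
  by (simp add: AE_restrict_space_iff)

lemma AE_cellI: "(AE x in lebesgue. P x) \<Longrightarrow> (AE x in cell. P x)"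
  by (auto simp: AE_cell_iff)

lemma measurable_cell: "f \<in> borel_measurable lebesgue \<Longrightarrow> f \<in> borel_measurable cell"
  by (rule measurable_restrict_space1)

lemma sum_indicator_unit_cell:
  fixes x :: "real^'n"
  assumes "\<forall>i. x $ i \<notin> \<int>" "finite S"
  shows "(\<Sum>s\<in>S. indicator unit_cell (x - lattice_vec s)) = (indicator S (\<chi> i. \<lfloor>x $ i\<rfloor>) :: 'b::comm_semiring_1)"
proof -
  have "(\<Sum>s\<in>S. indicator unit_cell (x - lattice_vec s) :: 'b) = (\<Sum>s\<in>S. if s = (\<chi> i. \<lfloor>x $ i\<rfloor>) then 1 else 0)"
    using unit_cell_cover[OF assms(1)] by (intro sum.cong) (auto simp: indicator_def)
  also have "\<dots> = indicator S (\<chi> i. \<lfloor>x $ i\<rfloor>)" using assms(2) by (simp add: indicator_def)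
  finally show ?thesis .
qed

text \<open>Up to a null set, a compact set is covered by finitely many lattice translates of the
  cell, and a periodic integrand has the same integral on each. \<open>N\<close> counts the
  translates and depends on \<open>K\<close> alone, so the bound is uniform along sequences of
  functions.\<close>

lemma nn_integral_compact_le_cell:
  fixes K :: "(real^'n) set"
  assumes "compact K"
  obtains N :: nat where "\<And>F :: real^'n \<Rightarrow> ennreal. F \<in> borel_measurable lebesgue \<Longrightarrow> periodic F \<Longrightarrow>
    (\<integral>\<^sup>+x. F x * indicator K x \<partial>lebesgue) \<le> of_nat N * (\<integral>\<^sup>+x. F x \<partial>cell)"
proof -
  obtain R where R: "\<And>x. x \<in> K \<Longrightarrow> norm x \<le> R"
    using compact_imp_bounded[OF assms] by (auto simp: bounded_iff)
  \<comment> \<open>The floor vectors of all points of norm at most \<open>R\<close> have their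
    entries in this range.\<close>
  define S :: "(int^'n) set" where "S = {s. \<forall>i. s $ i \<in> {\<lfloor>- R\<rfloor>..\<lceil>R\<rceil>}}"
  have "finite {f :: 'n \<Rightarrow> int. \<forall>i. f i \<in> {\<lfloor>- R\<rfloor>..\<lceil>R\<rceil>}}"
    using finite_PiE[of "UNIV :: 'n set" "\<lambda>_. {\<lfloor>- R\<rfloor>..\<lceil>R\<rceil>}"] by (simp add: PiE_def Pi_def)
  then have "finite (vec_nth -` {f :: 'n \<Rightarrow> int. \<forall>i. f i \<in> {\<lfloor>- R\<rfloor>..\<lceil>R\<rceil>}})"
    by (rule finite_vimageI) (simp add: inj_on_def vec_nth_inject)
  then have S: "finite S" by (simp add: S_def vimage_def)
  have "(\<integral>\<^sup>+x. F x * indicator K x \<partial>lebesgue) \<le> of_nat (card S) * (\<integral>\<^sup>+x. F x \<partial>cell)"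
    if F[measurable]: "F \<in> borel_measurable lebesgue" and per: "periodic F" for F :: "real^'n \<Rightarrow> ennreal"
  proof -
    have "(\<integral>\<^sup>+x. F x * indicator K x \<partial>lebesgue)
        \<le> (\<integral>\<^sup>+x. (\<Sum>s\<in>S. F x * indicator unit_cell (x - lattice_vec s)) \<partial>lebesgue)"
    proof (rule nn_integral_mono_AE)
      show "AE x in lebesgue. F x * indicator K x \<le> (\<Sum>s\<in>S. F x * indicator unit_cell (x - lattice_vec s))"
        using AE_not_integer_coordinate
      proof eventually_elim
        case (elim x)
        have "indicator K x \<le> (indicator S (\<chi> i. \<lfloor>x $ i\<rfloor>) :: ennreal)"
        proof (cases "x \<in> K")
          case True
          have "\<lfloor>- R\<rfloor> \<le> \<lfloor>x $ i\<rfloor> \<and> \<lfloor>x $ i\<rfloor> \<le> \<lceil>R\<rceil>" for i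
            using R[OF True] component_le_norm_cart[of x i] by linarith
          then show ?thesis by (simp add: S_def indicator_def)
        qed simp
        then show ?case
          using sum_indicator_unit_cell[OF elim S, where 'b = ennreal]
          by (simp add: sum_distrib_left[symmetric] mult_left_mono)
      qed
    qed
    also have "\<dots> = (\<Sum>s\<in>S. \<integral>\<^sup>+x. F x * indicator unit_cell (x - lattice_vec s) \<partial>lebesgue)"
    proof (rule nn_integral_sum)
      fix s :: "int^'n"
      have "(\<lambda>x. indicator unit_cell (x - lattice_vec s) :: ennreal) \<in> borel_measurable lebesgue"
        using borel_measurable_translation_lebesgue[of "indicator unit_cell" "- lattice_vec s"] by simp
      then show "(\<lambda>x. F x * indicator unit_cell (x - lattice_vec s)) \<in> borel_measurable lebesgue" by simp
    qed
    also have "\<dots> = (\<Sum>s\<in>S. \<integral>\<^sup>+x. F x \<partial>cell)"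
    proof (rule sum.cong[OF refl])
      fix s :: "int^'n"
      have m: "(\<lambda>x. indicator unit_cell (x - lattice_vec s) :: ennreal) \<in> borel_measurable lebesgue"
        using borel_measurable_translation_lebesgue[of "indicator unit_cell" "- lattice_vec s"] by simp
      have "(\<integral>\<^sup>+x. F x * indicator unit_cell (x - lattice_vec s) \<partial>lebesgue)
          = (\<integral>\<^sup>+x. F (x + lattice_vec s) * indicator unit_cell x \<partial>lebesgue)"
        using nn_integral_translation[of "\<lambda>x. F x * indicator unit_cell (x - lattice_vec s)" "lattice_vec s"] m by simp
      also have "\<dots> = (\<integral>\<^sup>+x. F x * indicator unit_cell x \<partial>lebesgue)"
        using periodic_lattice[OF per, of s] by (intro nn_integral_cong_AE) auto
      finally show "(\<integral>\<^sup>+x. F x * indicator unit_cell (x - lattice_vec s) \<partial>lebesgue) = (\<integral>\<^sup>+x. F x \<partial>cell)"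
        by (simp add: nn_integral_restrict_space)
    qed
    finally show ?thesis by simp
  qed
  then show thesis by (rule that)
qed

lemma periodic_compose: "periodic f \<Longrightarrow> periodic (\<lambda>x. h (f x))"
  unfolding periodic_def
proof
  fix i
  assume "\<forall>i. AE x in lebesgue. f (x + axis i 1) = f x"
  then have "AE x in lebesgue. f (x + axis i 1) = f x" ..
  then show "AE x in lebesgue. h (f (x + axis i 1)) = h (f x)" by eventually_elim simp
qed

lemma periodic_compose2:
  assumes "periodic f" "periodic g"
  shows "periodic (\<lambda>x. h (f x) (g x))"
  unfolding periodic_def
proof
  fix i
  have "AE x in lebesgue. f (x + axis i 1) = f x" "AE x in lebesgue. g (x + axis i 1) = g x"
    using assms by (auto simp: periodic_def)
  then show "AE x in lebesgue. h (f (x + axis i 1)) (g (x + axis i 1)) = h (f x) (g x)"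
    by eventually_elim simp
qed

lemma periodic_AE_eq:
  assumes "periodic f" "periodic g" "AE x in cell. f x = g x"
  shows "AE x in lebesgue. f x = g x"
  using AE_unit_cell_periodic[of "\<lambda>x. f x = g x"] assms periodic_compose2[of f g "(=)"]
  by (simp add: AE_cell_iff)

lemma periodic_integrable_compact:
  fixes f :: "real^'n \<Rightarrow> real"
  assumes "f \<in> borel_measurable lebesgue" "periodic f" "integrable cell f" "compact K"
  shows "set_integrable lebesgue K f"
proof -
  obtain N where N: "\<And>F :: real^'n \<Rightarrow> ennreal. F \<in> borel_measurable lebesgue \<Longrightarrow> periodic F \<Longrightarrow>
    (\<integral>\<^sup>+x. F x * indicator K x \<partial>lebesgue) \<le> of_nat N * (\<integral>\<^sup>+x. F x \<partial>cell)"
    by (rule nn_integral_compact_le_cell[OF assms(4)]) (rule that)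
  have [measurable]: "K \<in> sets lebesgue" using assms(4) by (simp add: lmeasurable_compact fmeasurableD)
  note [measurable] = assms(1)
  have "(\<integral>\<^sup>+x. ennreal (norm (indicator K x *\<^sub>R f x)) \<partial>lebesgue)
      = (\<integral>\<^sup>+x. ennreal (norm (f x)) * indicator K x \<partial>lebesgue)"
    by (intro nn_integral_cong) (auto simp: indicator_def)
  also have "\<dots> \<le> of_nat N * (\<integral>\<^sup>+x. ennreal (norm (f x)) \<partial>cell)"
    by (rule N) (auto intro: periodic_compose[OF assms(2)])
  also have "\<dots> < \<infinity>"
    using assms(3) by (auto simp: integrable_iff_bounded ennreal_mult_less_top of_nat_less_top)
  finally show ?thesis
    unfolding set_integrable_def by (intro integrableI_bounded) simp_all
qed

lemma periodic_integral_compact_le: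
  fixes K :: "(real^'n) set"
  assumes "compact K"
  obtains N :: nat where "\<And>f :: real^'n \<Rightarrow> real. f \<in> borel_measurable lebesgue \<Longrightarrow> periodic f \<Longrightarrow>
    integrable cell f \<Longrightarrow> (LINT x|lebesgue. indicator K x * \<bar>f x\<bar>) \<le> real N * (LINT x|cell. \<bar>f x\<bar>)"
proof -
  obtain N where N: "\<And>F :: real^'n \<Rightarrow> ennreal. F \<in> borel_measurable lebesgue \<Longrightarrow> periodic F \<Longrightarrow>
    (\<integral>\<^sup>+x. F x * indicator K x \<partial>lebesgue) \<le> of_nat N * (\<integral>\<^sup>+x. F x \<partial>cell)"
    by (rule nn_integral_compact_le_cell[OF assms]) (rule that)
  have "(LINT x|lebesgue. indicator K x * \<bar>f x\<bar>) \<le> real N * (LINT x|cell. \<bar>f x\<bar>)"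
    if f: "f \<in> borel_measurable lebesgue" "periodic f" "integrable cell f" for f :: "real^'n \<Rightarrow> real"
  proof -
    have a: "periodic (\<lambda>x. \<bar>f x\<bar>)" using periodic_compose[OF f(2)] .
    have "set_integrable lebesgue K (\<lambda>x. \<bar>f x\<bar>)"
      using f a by (intro periodic_integrable_compact assms) auto
    then have i: "integrable lebesgue (\<lambda>x. indicator K x * \<bar>f x\<bar>)" by (simp add: set_integrable_def)
    have "ennreal (LINT x|lebesgue. indicator K x * \<bar>f x\<bar>) = (\<integral>\<^sup>+x. ennreal \<bar>f x\<bar> * indicator K x \<partial>lebesgue)"
      by (subst nn_integral_eq_integral[OF i, symmetric]) (auto intro!: nn_integral_cong simp: indicator_def)
    also have "\<dots> \<le> of_nat N * (\<integral>\<^sup>+x. ennreal \<bar>f x\<bar> \<partial>cell)"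
      using f by (intro N periodic_compose[OF f(2)]) auto
    also have "\<dots> = ennreal (real N * (LINT x|cell. \<bar>f x\<bar>))"
      using f(3) by (subst nn_integral_eq_integral) (auto simp: ennreal_mult ennreal_of_nat_eq_real_of_nat)
    finally show ?thesis by (subst (asm) ennreal_le_iff) simp_all
  qed
  then show thesis by (rule that)
qed

text \<open>Local square integrability of a periodic function is decided on one cell; from here on
  all norms are taken there.\<close>

lemma L2_per_iff:
  fixes f :: "real^'n \<Rightarrow> real"
  shows "f \<in> L2_per \<longleftrightarrow> f \<in> borel_measurable lebesgue \<and> periodic f \<and> sq_integrable cell f"
proof safe
  assume f: "f \<in> L2_per"
  then show "f \<in> borel_measurable lebesgue" "periodic f"
    by (auto simp: L2_per_def L2_loc_def)
  have "set_integrable lebesgue (cbox 0 1) (\<lambda>x. (f x)\<^sup>2)"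
    using f by (auto simp: L2_per_def L2_loc_def)
  then have "set_integrable lebesgue unit_cell (\<lambda>x. (f x)\<^sup>2)"
    by (rule set_integrable_subset) (auto simp: unit_cell_eq_box box_subset_cbox)
  then show "sq_integrable cell f"
    using \<open>f \<in> borel_measurable lebesgue\<close>
    by (simp add: sq_integrable_def measurable_cell set_integrable_def integrable_restrict_space)
next
  assume f: "f \<in> borel_measurable lebesgue" "periodic f" "sq_integrable cell f"
  then have "set_integrable lebesgue K (\<lambda>x. (f x)\<^sup>2)" if "compact K" for K
    using that periodic_compose[of f "\<lambda>y. y\<^sup>2"]
    by (intro periodic_integrable_compact) (auto simp: sq_integrable_def)
  with f show "f \<in> L2_per" by (auto simp: L2_per_def L2_loc_def)
qed

lemma L2_loc_subset_L1_loc: "L2_loc \<subseteq> L1_loc"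
proof
  fix f :: "real^'n \<Rightarrow> real" assume f: "f \<in> L2_loc"
  then have [measurable]: "f \<in> borel_measurable lebesgue" by (simp add: L2_loc_def)
  have "set_integrable lebesgue K f" if K: "compact K" for K
  proof -
    have [measurable]: "K \<in> sets lebesgue" using K by (simp add: lmeasurable_compact fmeasurableD)
    have "set_integrable lebesgue K (\<lambda>x. (f x)\<^sup>2)" using f K by (auto simp: L2_loc_def)
    moreover have "set_integrable lebesgue K (\<lambda>x. 1)"
      using K lmeasurable_compact[OF K] by (simp add: set_integrable_def fmeasurable_def)
    ultimately have i: "integrable lebesgue (\<lambda>x. indicator K x *\<^sub>R (f x)\<^sup>2 + indicator K x *\<^sub>R 1)"
      unfolding set_integrable_def by (rule Bochner_Integration.integrable_add)
    have "\<bar>f x\<bar> \<le> (f x)\<^sup>2 + 1" for x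
      using sum_squares_bound[of "\<bar>f x\<bar>" 1] by simp
    then show ?thesis unfolding set_integrable_def
      by (intro Bochner_Integration.integrable_bound[OF i] AE_I2) (auto simp: indicator_def)
  qed
  then show "f \<in> L1_loc" by (simp add: L1_loc_def)
qed

lemma L2_per_complete:
  fixes f :: "nat \<Rightarrow> real^'n \<Rightarrow> real"
  assumes f: "\<And>n. f n \<in> L2_per"
    and C: "\<And>e. e > 0 \<Longrightarrow> \<exists>N. \<forall>m\<ge>N. \<forall>n\<ge>N. (LINT x|cell. (f m x - f n x)\<^sup>2) < e"
  obtains g where "g \<in> L2_per" "(\<lambda>n. LINT x|cell. (f n x - g x)\<^sup>2) \<longlonglongrightarrow> 0"
proof -
  have m[measurable]: "f n \<in> borel_measurable lebesgue" and per: "periodic (f n)"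
    and sq: "sq_integrable cell (f n)" for n
    using f[of n] by (auto simp: L2_per_iff)
  obtain r h where r0: "strict_mono r" and r: "sq_integrable cell h" "AE x in cell. (\<lambda>k. f (r k) x) \<longlonglongrightarrow> h x"
    "(\<lambda>n. LINT x|cell. (f n x - h x)\<^sup>2) \<longlonglongrightarrow> 0"
    by (rule cell.L2_complete[of f, OF sq C])
  \<comment> \<open>\<open>h\<close> is controlled on the cell only. The pointwise
    \<open>lim\<close> is a representative on the whole space, and it inherits periodicity even
    where the sequence diverges, because \<open>lim\<close> of equal sequences is equal.\<close>
  define g where "g x = lim (\<lambda>k. f (r k) x)" for x
  have [measurable]: "g \<in> borel_measurable lebesgue" unfolding g_def by measurable
  have eq: "AE x in cell. g x = h x"
    using r(2) by eventually_elim (simp add: g_def limI)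
  have "periodic g" unfolding periodic_def
  proof
    fix i
    have "AE x in lebesgue. \<forall>k. f (r k) (x + axis i 1) = f (r k) x"
      using per by (simp add: AE_all_countable periodic_def)
    then show "AE x in lebesgue. g (x + axis i 1) = g x"
      by eventually_elim (simp add: g_def)
  qed
  moreover have "sq_integrable cell g"
    using eq r(1) by (intro sq_integrable_cong_AE[OF eq]) (auto intro: measurable_cell)
  ultimately have "g \<in> L2_per" by (simp add: L2_per_iff)
  moreover have "(LINT x|cell. (f n x - g x)\<^sup>2) = (LINT x|cell. (f n x - h x)\<^sup>2)" for n
  proof (rule integral_cong_AE)
    show "AE x in cell. (f n x - g x)\<^sup>2 = (f n x - h x)\<^sup>2"
      using eq by eventually_elim simp
    have [measurable]: "f n \<in> borel_measurable cell" "g \<in> borel_measurable cell" "h \<in> borel_measurable cell"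
      by (simp_all add: measurable_cell sq_integrable_measurable[OF r(1)])
    show "(\<lambda>x. (f n x - g x)\<^sup>2) \<in> borel_measurable cell" "(\<lambda>x. (f n x - h x)\<^sup>2) \<in> borel_measurable cell"
      by simp_all
  qed
  ultimately show thesis using r(3) by (intro that[of g]) simp_all
qed

section \<open>Smooth functions\<close>

definition smooth :: "(real^'n \<Rightarrow> real) \<Rightarrow> bool" where
  "smooth f \<longleftrightarrow> (\<forall>k. C_k k f)"

lemma partial_deriv_eq: "(f has_derivative D) (at x) \<Longrightarrow> partial_deriv i f x = D (axis i 1)"
  unfolding partial_deriv_def using frechet_derivative_at by metis

lemma C_k_continuous: "C_k k f \<Longrightarrow> continuous_on UNIV f"
  by (cases k) (auto simp: continuous_on_eq_continuous_at differentiable_imp_continuous_within)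

lemma C_k_Suc_imp: "C_k (Suc k) f \<Longrightarrow> C_k k f"
proof (induction k arbitrary: f)
  case 0
  then show ?case using C_k_continuous[OF 0] by simp
qed auto

lemma smooth_partial_deriv: "smooth f \<Longrightarrow> smooth (partial_deriv i f)"
  unfolding smooth_def by (metis C_k.simps(2))

lemma smooth_differentiable: "smooth f \<Longrightarrow> f differentiable (at x)"
  unfolding smooth_def by (metis C_k.simps(2))

lemma smooth_continuous: "smooth f \<Longrightarrow> continuous_on UNIV f"
  unfolding smooth_def using C_k_continuous by blast

lemma smooth_has_derivative: "smooth f \<Longrightarrow> (f has_derivative frechet_derivative f (at x)) (at x)"
  using smooth_differentiable frechet_derivative_works by blast

section \<open>Closure properties of smooth functions\<close>

lemma C_k_const: "C_k k (\<lambda>x::real^'n. c)"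
proof (induction k arbitrary: c)
  case (Suc k)
  have "partial_deriv i (\<lambda>x. c) = (\<lambda>x. 0)" for i :: 'n
    by (rule ext, subst partial_deriv_eq[OF has_derivative_const]) simp
  with Suc show ?case by simp
qed simp

lemma C_k_add:
  assumes "C_k k f" "C_k k g"
  shows "C_k k (\<lambda>x. f x + g x)"
  using assms
proof (induction k arbitrary: f g)
  case 0
  then show ?case by (auto intro: continuous_intros)
next
  case (Suc k)
  have d: "(f has_derivative frechet_derivative f (at x)) (at x)" "(g has_derivative frechet_derivative g (at x)) (at x)" for x
    using Suc.prems by (simp_all add: frechet_derivative_works[symmetric])
  have "partial_deriv i (\<lambda>x. f x + g x) = (\<lambda>x. partial_deriv i f x + partial_deriv i g x)" for i
    using partial_deriv_eq[OF has_derivative_add[OF d]] by (simp add: partial_deriv_def fun_eq_iff)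
  with Suc show ?case by (auto intro: differentiable_add)
qed

lemma partial_deriv_mult:
  assumes "f differentiable (at x)" "g differentiable (at x)"
  shows "partial_deriv i (\<lambda>x. f x * g x) x = f x * partial_deriv i g x + partial_deriv i f x * g x"
proof -
  have d: "(f has_derivative frechet_derivative f (at x)) (at x)" "(g has_derivative frechet_derivative g (at x)) (at x)"
    using assms frechet_derivative_works by auto
  show ?thesis
    using partial_deriv_eq[OF has_derivative_mult[OF d]] by (simp add: partial_deriv_def)
qed

lemma C_k_mult:
  assumes "C_k k f" "C_k k g"
  shows "C_k k (\<lambda>x. f x * g x)"
  using assms
proof (induction k arbitrary: f g)
  case 0
  then show ?case by (auto intro: continuous_intros)
next
  case (Suc k)
  have "partial_deriv i (\<lambda>x. f x * g x) = (\<lambda>x. f x * partial_deriv i g x + partial_deriv i f x * g x)" for i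
    using Suc.prems by (intro ext partial_deriv_mult) auto
  moreover have "C_k k (\<lambda>x. f x * partial_deriv i g x + partial_deriv i f x * g x)" for i
    using Suc C_k_Suc_imp[OF Suc.prems(1)] C_k_Suc_imp[OF Suc.prems(2)] by (intro C_k_add Suc.IH) auto
  ultimately show ?case using Suc.prems by (auto intro: differentiable_mult)
qed

lemma smooth_const: "smooth (\<lambda>x. c)"
  and smooth_add: "smooth f \<Longrightarrow> smooth g \<Longrightarrow> smooth (\<lambda>x. f x + g x)"
  and smooth_mult: "smooth f \<Longrightarrow> smooth g \<Longrightarrow> smooth (\<lambda>x. f x * g x)"
  by (auto simp: smooth_def C_k_const C_k_add C_k_mult)

lemma smooth_prod: "(\<And>i. i \<in> I \<Longrightarrow> smooth (f i)) \<Longrightarrow> smooth (\<lambda>x. \<Prod>i\<in>I. f i x)"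
  by (induction I rule: infinite_finite_induct) (auto intro: smooth_const smooth_mult)

lemma partial_deriv_cos: "partial_deriv i (\<lambda>x. cos (a \<bullet> x)) = (\<lambda>x. - (a $ i) * sin (a \<bullet> x))"
  and partial_deriv_sin: "partial_deriv i (\<lambda>x. sin (a \<bullet> x)) = (\<lambda>x. a $ i * cos (a \<bullet> x))"
proof -
  have "((\<lambda>x. cos (a \<bullet> x)) has_derivative (\<lambda>h. (a \<bullet> h) * - sin (a \<bullet> x))) (at x)"
    "((\<lambda>x. sin (a \<bullet> x)) has_derivative (\<lambda>h. (a \<bullet> h) * cos (a \<bullet> x))) (at x)" for x
    by (auto intro!: derivative_eq_intros)
  from this[THEN partial_deriv_eq]
  show "partial_deriv i (\<lambda>x. cos (a \<bullet> x)) = (\<lambda>x. - (a $ i) * sin (a \<bullet> x))"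
    "partial_deriv i (\<lambda>x. sin (a \<bullet> x)) = (\<lambda>x. a $ i * cos (a \<bullet> x))"
    by (auto simp: inner_axis)
qed

lemma differentiable_cos_sin_inner:
  "(\<lambda>x. cos (a \<bullet> x)) differentiable (at x)" "(\<lambda>x. sin (a \<bullet> x)) differentiable (at x)" for a x :: "real^'n"
proof -
  have "((\<lambda>x. cos (a \<bullet> x)) has_derivative (\<lambda>h. (a \<bullet> h) * - sin (a \<bullet> x))) (at x)"
    "((\<lambda>x. sin (a \<bullet> x)) has_derivative (\<lambda>h. (a \<bullet> h) * cos (a \<bullet> x))) (at x)"
    by (auto intro!: derivative_eq_intros)
  then show "(\<lambda>x. cos (a \<bullet> x)) differentiable (at x)" "(\<lambda>x. sin (a \<bullet> x)) differentiable (at x)"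
    by (auto simp: differentiable_def)
qed

lemma C_k_cos_sin: "C_k k (\<lambda>x. cos (a \<bullet> x)) \<and> C_k k (\<lambda>x. sin (a \<bullet> x))"
proof (induction k)
  case 0
  show ?case by (auto intro!: continuous_intros)
next
  case (Suc k)
  have "C_k k (\<lambda>x. c * cos (a \<bullet> x))" "C_k k (\<lambda>x. c * sin (a \<bullet> x))" for c
    using Suc by (auto intro: C_k_mult[OF C_k_const])
  then show ?case
    unfolding C_k.simps partial_deriv_cos partial_deriv_sin
    by (intro conjI allI differentiable_cos_sin_inner)
qed

lemma smooth_cos: "smooth (\<lambda>x. cos (a \<bullet> x))" and smooth_sin: "smooth (\<lambda>x. sin (a \<bullet> x))"
  by (auto simp: smooth_def C_k_cos_sin)

lemma has_derivative_component:
  fixes h :: "real \<Rightarrow> real"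
  assumes "(h has_real_derivative h') (at (x $ i))"
  shows "((\<lambda>x::real^'n. h (x $ i)) has_derivative (\<lambda>y. h' * y $ i)) (at x)"
proof -
  have "((\<lambda>x::real^'n. x $ i) has_derivative (\<lambda>y. y $ i)) (at x)"
    by (rule bounded_linear_imp_has_derivative[OF bounded_linear_vec_nth])
  from has_derivative_compose[OF this assms[unfolded has_field_derivative_def]]
  show ?thesis .
qed

text \<open>A single step, for a function whose derivative is already known to be regular while no
  closed list of its derivatives is at hand. The cutoff of \<open>smooth_partition_function\<close>
  is of this kind.\<close>

lemma C_k_component_step:
  fixes h h' :: "real \<Rightarrow> real" and i :: "'n::finite"
  assumes "\<And>t. (h has_real_derivative h' t) (at t)" "C_k k (\<lambda>x::real^'n. h' (x $ i))"
  shows "C_k (Suc k) (\<lambda>x::real^'n. h (x $ i))"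
proof -
  have d: "((\<lambda>x::real^'n. h (x $ i)) has_derivative (\<lambda>y. h' (x $ i) * y $ i)) (at x)" for x
    by (rule has_derivative_component[OF assms(1)])
  have "partial_deriv j (\<lambda>x::real^'n. h (x $ i)) = (\<lambda>x. h' (x $ i) * (if j = i then 1 else 0))" for j
    using partial_deriv_eq[OF d] by (auto simp: axis_def)
  moreover have "C_k k (\<lambda>x::real^'n. h' (x $ i) * (if j = i then 1 else 0))" for j
    using assms(2) C_k_const[of k 0] by (cases "j = i") auto
  ultimately show ?thesis using d by (auto simp: differentiable_def)
qed

text \<open>\<open>H\<close> lists a function together with all its derivatives. Carrying the whole
  list lets the induction on the order shift the index.\<close>

lemma smooth_component:
  fixes H :: "nat \<Rightarrow> real \<Rightarrow> real" and i :: "'n::finite"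
  assumes "\<And>n t. (H n has_real_derivative H (Suc n) t) (at t)"
  shows "smooth (\<lambda>x::real^'n. H n (x $ i))"
proof -
  have "C_k k (\<lambda>x::real^'n. H n (x $ i))" for k n
  proof (induction k arbitrary: n)
    case 0
    show ?case using has_derivative_continuous[OF has_derivative_component[OF assms, where i = i]]
      by (simp add: continuous_on_eq_continuous_at)
  next
    case (Suc k)
    show ?case by (rule C_k_component_step[OF assms Suc])
  qed
  then show ?thesis by (simp add: smooth_def)
qed

section \<open>Flat functions and bumps\<close>

fun flat_poly :: "nat \<Rightarrow> real poly" where
  "flat_poly 0 = 1"
| "flat_poly (Suc n) = [:0, 0, 1:] * (flat_poly n - pderiv (flat_poly n))"

text \<open>The \<open>n\<close>-th derivative of exp (- 1 / t), extended by 0. With s = 1 / t,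
  differentiating p(s) exp (- s) with respect to t gives s^2 (p(s) - p'(s)) exp (- s), which is the
  recursion of \<open>flat_poly\<close>.\<close>

definition flat :: "nat \<Rightarrow> real \<Rightarrow> real" where
  "flat n t = (if t > 0 then poly (flat_poly n) (1 / t) * exp (- (1 / t)) else 0)"

lemma tendsto_poly_exp: "((\<lambda>x. poly p x * exp (- x)) \<longlongrightarrow> (0::real)) at_top"
proof -
  have "((\<lambda>x. \<Sum>i\<le>degree p. coeff p i * (x ^ i / exp x)) \<longlongrightarrow> (\<Sum>i\<le>degree p. coeff p i * 0)) at_top"
    by (intro tendsto_intros tendsto_power_div_exp_0)
  then show ?thesis
    by (simp add: poly_altdef exp_minus sum_distrib_right divide_inverse mult.assoc)
qed

lemma flat_deriv: "(flat n has_real_derivative flat (Suc n) t) (at t)"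
proof -
  consider "t > 0" | "t < 0" | "t = 0" by linarith
  then show ?thesis
  proof cases
    case 1
    have "((\<lambda>t. poly (flat_poly n) (1 / t) * exp (- (1 / t))) has_real_derivative flat (Suc n) t) (at t)"
      using 1 by (auto intro!: derivative_eq_intros simp: flat_def field_simps power2_eq_square)
    moreover have "\<forall>\<^sub>F s in nhds t. flat n s = poly (flat_poly n) (1 / s) * exp (- (1 / s))"
      using eventually_nhds_in_open[of "{0<..}" t] 1 by (auto elim!: eventually_mono simp: flat_def)
    ultimately show ?thesis by (subst DERIV_cong_ev[OF refl _ refl]) auto
  next
    case 2
    have "\<forall>\<^sub>F s in nhds t. flat n s = 0"
      using eventually_nhds_in_open[of "{..<0}" t] 2 by (auto elim!: eventually_mono simp: flat_def)
    then show ?thesis using 2 by (subst DERIV_cong_ev[OF refl _ refl]) (auto simp: flat_def)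
  next
    case 3
    \<comment> \<open>At 0 the difference quotient from the right is s p(s) exp (- s) with s = 1 /
      h; the factor \<open>[:0, 1:]\<close> is this extra s.\<close>
    have "((\<lambda>s. poly ([:0, 1:] * flat_poly n) s * exp (- s)) \<longlongrightarrow> 0) at_top"
      by (rule tendsto_poly_exp)
    then have "((\<lambda>h. (flat n h) / h) \<longlongrightarrow> 0) (at_right 0)"
      unfolding filterlim_at_right_to_top
      by (rule Lim_transform_eventually)
        (rule eventually_mono[OF eventually_gt_at_top[of 0]], simp add: flat_def field_simps)
    moreover have "((\<lambda>h. (flat n h) / h) \<longlongrightarrow> 0) (at_left 0)"
      by (rule Lim_transform_eventually[OF tendsto_const])
        (auto simp: flat_def eventually_at_filter)
    ultimately have "((\<lambda>h. (flat n h) / h) \<longlongrightarrow> 0) (at 0)" by (simp add: filterlim_split_at)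
    then show ?thesis using 3 by (simp add: DERIV_def flat_def)
  qed
qed

text \<open>For \<open>m > 0\<close> the function is positive exactly between \<open>a\<close> and
  \<open>b\<close>. The factor \<open>m\<close> steepens the flanks, so that growing
  \<open>m\<close> approximates the indicator of the interval.\<close>

definition bump :: "real \<Rightarrow> real \<Rightarrow> real \<Rightarrow> real \<Rightarrow> real" where
  "bump m a b t = flat 0 (m * (t - a)) * flat 0 (m * (b - t))"

lemma flat_0: "flat 0 t = (if t > 0 then exp (- (1 / t)) else 0)"
  by (simp add: flat_def)

lemma flat_0_bounds: "0 \<le> flat 0 t" "flat 0 t \<le> 1"
  by (auto simp: flat_0)

lemma smooth_flat_affine: "smooth (\<lambda>x::real^'n. flat 0 (c * (x $ i) + d))"
proof -
  define H where "H n t = c ^ n * flat n (c * t + d)" for n t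
  have "(H n has_real_derivative H (Suc n) t) (at t)" for n t
    unfolding H_def by (auto intro!: derivative_eq_intros DERIV_chain2[OF flat_deriv])
  from smooth_component[where H = H and n = 0 and i = i, OF this] show ?thesis by (simp add: H_def)
qed

lemma smooth_bump: "smooth (\<lambda>x::real^'n. bump m a b (x $ i))"
  using smooth_mult[OF smooth_flat_affine[of m i "- m * a"] smooth_flat_affine[of "- m" i "m * b"]]
  by (simp add: bump_def algebra_simps)

lemma bump_bounds: "0 \<le> bump m a b t" "bump m a b t \<le> 1"
  using flat_0_bounds by (auto simp: bump_def mult_le_one)

lemma bump_eq_0: "m > 0 \<Longrightarrow> t \<le> a \<or> b \<le> t \<Longrightarrow> bump m a b t = 0"
  by (auto simp: bump_def flat_0 zero_less_mult_iff)

lemma bump_pos: "m > 0 \<Longrightarrow> a < t \<Longrightarrow> t < b \<Longrightarrow> bump m a b t > 0"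
  by (auto simp: bump_def flat_0)

lemma bump_tendsto: "(\<lambda>m. bump (real (Suc m)) a b t) \<longlonglongrightarrow> indicator {a<..<b} t"
proof (cases "a < t \<and> t < b")
  case True
  have l: "(\<lambda>m. flat 0 (real (Suc m) * c)) \<longlonglongrightarrow> 1" if "c > 0" for c
  proof -
    have "(\<lambda>m. exp (- (inverse (real (Suc m)) * (1 / c)))) \<longlonglongrightarrow> exp (- (0 * (1 / c)))"
      by (intro tendsto_intros LIMSEQ_inverse_real_of_nat)
    moreover have "flat 0 (real (Suc m) * c) = exp (- (inverse (real (Suc m)) * (1 / c)))" for m
      using that by (simp add: flat_0 divide_simps del: of_nat_Suc)
    ultimately show ?thesis by simp
  qed
  have "(\<lambda>m. bump (real (Suc m)) a b t) \<longlonglongrightarrow> 1 * 1"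
    unfolding bump_def using True by (intro tendsto_mult l) auto
  then show ?thesis using True by simp
next
  case False
  then have "bump (real (Suc m)) a b t = 0" for m by (intro bump_eq_0) auto
  moreover have "indicator {a<..<b} t = (0::real)" using False by auto
  ultimately show ?thesis by (simp only: tendsto_const)
qed

lemma continuous_flat: "continuous_on UNIV (flat n)"
  using DERIV_isCont[OF flat_deriv] by (simp add: continuous_on_eq_continuous_at)

lemma continuous_bump: "continuous_on S (bump m a b)"
proof -
  have "continuous_on S (\<lambda>t. flat 0 (m * (t - a)))" "continuous_on S (\<lambda>t. flat 0 (m * (b - t)))"
    by (rule continuous_on_compose2[OF continuous_flat]; auto intro!: continuous_intros)+
  then show ?thesis unfolding bump_def by (rule continuous_on_mult)
qed

text \<open>The moving average of a bump over an interval of length 1.\<close>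

lemma smooth_partition_function:
  obtains h h' :: "real \<Rightarrow> real" and c :: real where
    "c > 0" "\<And>t. (h has_real_derivative h' t) (at t)" "\<And>i::'n. smooth (\<lambda>x::real^'n. h (x $ i))"
    "\<And>t. t \<le> 0 \<or> 2 \<le> t \<Longrightarrow> h t = 0 \<and> h' t = 0"
    "\<And>t. 0 < t \<Longrightarrow> t < 1 \<Longrightarrow> h t + h (t + 1) = c \<and> h' t + h' (t + 1) = 0"
proof -
  define g where "g = bump 1 0 1"
  have g0: "g t = 0" if "t \<le> 0 \<or> 1 \<le> t" for t using that by (simp add: g_def bump_eq_0)
  have gint: "g integrable_on {a..b}" for a b
    unfolding g_def by (intro integrable_continuous_real continuous_bump)
  \<comment> \<open>The base point -1 lies to the left of the support of \<open>g\<close>, so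
    \<open>F\<close> vanishes on the nonpositive axis and is constant from 1 on.\<close>
  define F where "F t = integral {-1..t} g" for t
  have F_le0: "F t = 0" if "t \<le> 0" for t
  proof -
    have "integral {-1..t} g = integral {-1..t} (\<lambda>_. 0)"
      using that by (intro Henstock_Kurzweil_Integration.integral_cong g0) auto
    then show ?thesis by (simp add: F_def)
  qed
  define c where "c = F 1"
  have F_ge1: "F t = c" if "t \<ge> 1" for t
  proof -
    have "F t = integral {-1..1} g + integral {1..t} g"
      unfolding F_def using that by (intro Henstock_Kurzweil_Integration.integral_combine[symmetric] gint) auto
    also have "integral {1..t} g = integral {1..t} (\<lambda>_. 0)"
      by (intro Henstock_Kurzweil_Integration.integral_cong g0) auto
    finally show ?thesis by (simp add: F_def c_def)
  qed
  have F_deriv: "(F has_real_derivative g t) (at t)" for t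
  proof (cases "t < 0")
    case True
    have "\<forall>\<^sub>F s in nhds t. F s = 0"
      using eventually_nhds_in_open[of "{..<0}" t] True by (auto elim!: eventually_mono simp: F_le0)
    then show ?thesis using True g0[of t] by (subst DERIV_cong_ev[OF refl _ refl]) auto
  next
    case False
    have "(F has_real_derivative g t) (at t within {-1..t+1})"
      unfolding F_def using False by (intro integral_has_real_derivative) (auto simp: g_def continuous_bump)
    moreover have "t \<in> interior {-1..t+1}" using False by simp
    ultimately show ?thesis by (metis at_within_interior)
  qed
  have "c > 0"
  proof -
    have "c = integral {-1..1} g" by (simp add: c_def F_def)
    moreover have "integral {-1..1} g \<ge> 0"
      by (rule Henstock_Kurzweil_Integration.integral_nonneg[OF gint]) (simp add: g_def bump_bounds)
    moreover have "integral {-1..1} g \<noteq> 0"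
    proof
      assume "integral {-1..1} g = 0"
      then have "g (1/2) = 0"
        using integral_eq_0_iff[of "-1" 1 g] by (auto simp: g_def continuous_bump bump_bounds)
      then show False using bump_pos[of 1 0 "1/2" 1] by (simp add: g_def)
    qed
    ultimately show ?thesis by simp
  qed
  \<comment> \<open>In \<open>h t + h (t + 1)\<close> the terms \<open>F t\<close> cancel and F (t +
    1) - F (t - 1) remains, which is \<open>c\<close> for \<open>t\<close> between 0 and 1.\<close>
  define h where "h t = F t - F (t - 1)" for t
  define h' where "h' t = g t - g (t - 1)" for t
  have d: "(h has_real_derivative h' t) (at t)" for t
    unfolding h_def h'_def by (auto intro!: derivative_eq_intros DERIV_chain2[OF F_deriv] F_deriv)
  have sg: "smooth (\<lambda>x::real^'n. g (x $ i))" for i unfolding g_def by (rule smooth_bump)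
  have "(\<lambda>x::real^'n. bump 1 1 2 (x $ i)) = (\<lambda>x. g (x $ i - 1))" for i
    by (auto simp: g_def bump_def algebra_simps)
  then have sg1: "smooth (\<lambda>x::real^'n. g (x $ i - 1))" for i using smooth_bump[of 1 1 2 i] by simp
  have "smooth (\<lambda>x::real^'n. h' (x $ i))" for i
    using smooth_add[OF sg smooth_mult[OF smooth_const[of "-1"] sg1]] by (simp add: h'_def)
  then have "C_k (Suc k) (\<lambda>x::real^'n. h (x $ i))" for k i
    by (intro C_k_component_step[OF d]) (simp add: smooth_def)
  then have "C_k k (\<lambda>x::real^'n. h (x $ i))" for k i using C_k_Suc_imp by blast
  then have "smooth (\<lambda>x::real^'n. h (x $ i))" for i unfolding smooth_def by blast
  moreover have "h t = 0 \<and> h' t = 0" if "t \<le> 0 \<or> 2 \<le> t" for t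
    using that by (auto simp: h_def h'_def F_le0 F_ge1 g0)
  moreover have "h t + h (t + 1) = c \<and> h' t + h' (t + 1) = 0" if "0 < t" "t < 1" for t
    using that by (auto simp: h_def h'_def F_le0 F_ge1 g0)
  ultimately show thesis by (rule that[OF \<open>c > 0\<close> d])
qed

section \<open>Weak derivatives\<close>

lemma test_functionI:
  assumes "smooth f" "compact K" "\<And>x. x \<notin> K \<Longrightarrow> f x = 0"
  shows "f \<in> test_functions"
proof -
  have "closure {x. f x \<noteq> 0} \<subseteq> K"
    using assms(2,3) by (intro closure_minimal) (auto simp: compact_imp_closed)
  then have "compact (closure {x. f x \<noteq> 0})"
    using assms(2) by (metis compact_Int_closed closed_closure inf.absorb_iff2)
  with assms(1) show ?thesis by (simp add: test_functions_def smooth_def)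
qed

lemma test_function_smooth: "f \<in> test_functions \<Longrightarrow> smooth f"
  by (simp add: test_functions_def smooth_def)

lemma partial_deriv_eq_0_outside:
  assumes "closed K" "\<And>x. x \<notin> K \<Longrightarrow> f x = 0" "x \<notin> K"
  shows "partial_deriv i f x = 0"
proof -
  have "(f has_derivative (\<lambda>_. 0)) (at x)"
  proof (rule has_derivative_transform_within_open[OF has_derivative_const[of 0]])
    show "open (- K)" using assms(1) by (simp add: open_Compl)
  qed (use assms in auto)
  from partial_deriv_eq[OF this] show ?thesis .
qed

lemma test_function_support:
  assumes "f \<in> test_functions"
  obtains K where "compact K" "\<And>x. x \<notin> K \<Longrightarrow> f x = 0" "\<And>i x. x \<notin> K \<Longrightarrow> partial_deriv i f x = 0"
proof -
  define K where "K = closure {x. f x \<noteq> 0}"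
  have K: "compact K" using assms by (simp add: K_def test_functions_def)
  have z: "f x = 0" if "x \<notin> K" for x
    using that closure_subset[of "{x. f x \<noteq> 0}"] by (auto simp: K_def)
  show thesis
    by (rule that[OF K z partial_deriv_eq_0_outside[OF compact_imp_closed[OF K] z]])
qed

lemma test_function_partial_deriv:
  assumes "f \<in> test_functions"
  shows "partial_deriv i f \<in> test_functions"
proof -
  obtain K where K: "compact K" "\<And>x. x \<notin> K \<Longrightarrow> f x = 0" "\<And>i x. x \<notin> K \<Longrightarrow> partial_deriv i f x = 0"
    by (rule test_function_support[OF assms]) (rule that)
  show ?thesis
    by (rule test_functionI[OF smooth_partial_deriv[OF test_function_smooth[OF assms]] K(1,3)])
qed

lemma test_function_mult_smooth:
  assumes "smooth e" "f \<in> test_functions"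
  shows "(\<lambda>x. e x * f x) \<in> test_functions"
proof -
  obtain K where "compact K" "\<And>x. x \<notin> K \<Longrightarrow> f x = 0" "\<And>i x. x \<notin> K \<Longrightarrow> partial_deriv i f x = 0"
    by (rule test_function_support[OF assms(2)]) (rule that)
  then show ?thesis
    by (intro test_functionI[OF smooth_mult[OF assms(1) test_function_smooth[OF assms(2)]], of K]) simp_all
qed

lemma partial_deriv_translation:
  assumes "f differentiable (at (x + a))"
  shows "partial_deriv i (\<lambda>x. f (x + a)) x = partial_deriv i f (x + a)"
proof -
  have "((\<lambda>x. x + a) has_derivative (\<lambda>h. h)) (at x)" by (auto intro!: derivative_eq_intros)
  moreover have "(f has_derivative frechet_derivative f (at (x + a))) (at (x + a))"
    using assms by (simp add: frechet_derivative_works)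
  ultimately have "((\<lambda>x. f (x + a)) has_derivative (\<lambda>h. frechet_derivative f (at (x + a)) h)) (at x)"
    by (rule has_derivative_compose)
  from partial_deriv_eq[OF this] show ?thesis by (simp add: partial_deriv_def)
qed

lemma C_k_translation: "C_k k f \<Longrightarrow> C_k k (\<lambda>x. f (x + a))"
proof (induction k arbitrary: f)
  case 0
  then show ?case by (auto intro!: continuous_on_compose2[of UNIV f] continuous_intros)
next
  case (Suc k)
  have "partial_deriv i (\<lambda>x. f (x + a)) = (\<lambda>x. partial_deriv i f (x + a))" for i
    using Suc.prems by (intro ext partial_deriv_translation) simp
  moreover have "(\<lambda>x. f (x + a)) differentiable at x" for x
    using Suc.prems differentiable_chain_at[of "\<lambda>x. x + a" x f] by (simp add: o_def)
  ultimately show ?case using Suc by simp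
qed

lemma test_function_translation:
  assumes "f \<in> test_functions"
  shows "(\<lambda>x. f (x + a)) \<in> test_functions"
proof -
  obtain K where K: "compact K" "\<And>x. x \<notin> K \<Longrightarrow> f x = 0" "\<And>i x. x \<notin> K \<Longrightarrow> partial_deriv i f x = 0"
    by (rule test_function_support[OF assms]) (rule that)
  show ?thesis
  proof (rule test_functionI)
    show "smooth (\<lambda>x. f (x + a))" using test_function_smooth[OF assms] by (simp add: smooth_def C_k_translation)
    show "compact ((\<lambda>x. - a + x) ` K)" by (rule compact_translation[OF K(1)])
    fix x assume "x \<notin> (\<lambda>x. - a + x) ` K"
    then have "x + a \<notin> K" by (metis add.commute add.inverse_inverse image_eqI minus_add_cancel)
    then show "f (x + a) = 0" by (rule K(2))
  qed
qed

section \<open>Local integrability and the fundamental lemma of the calculus of variations\<close>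

lemma continuous_measurable_lebesgue:
  fixes g :: "'a::euclidean_space \<Rightarrow> real"
  shows "continuous_on UNIV g \<Longrightarrow> g \<in> borel_measurable lebesgue"
  by (intro measurable_completion) (simp add: borel_measurable_continuous_onI)

lemma continuous_compact_support_bounded:
  fixes g :: "'a::euclidean_space \<Rightarrow> real"
  assumes "continuous_on UNIV g" "compact K" "\<And>x. x \<notin> K \<Longrightarrow> g x = 0"
  obtains C where "C \<ge> 0" "\<And>x. \<bar>g x\<bar> \<le> C"
proof -
  have "compact (g ` K)" using assms(1,2) continuous_on_subset by (blast intro: compact_continuous_image)
  then obtain C where C: "\<And>x. x \<in> K \<Longrightarrow> \<bar>g x\<bar> \<le> C"
    using compact_imp_bounded[of "g ` K"] by (auto simp: bounded_iff)
  have "\<bar>g x\<bar> \<le> max C 0" for x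
    using C[of x] assms(3)[of x] by (cases "x \<in> K") auto
  then show thesis by (intro that[of "max C 0"]) auto
qed

lemma L1_loc_mult_compact_support:
  assumes f: "f \<in> L1_loc" and g: "continuous_on UNIV g" "compact K" "\<And>x. x \<notin> K \<Longrightarrow> g x = 0"
  shows "integrable lebesgue (\<lambda>x. f x * g x)"
proof -
  obtain C where "C \<ge> 0" and C: "\<And>x. \<bar>g x\<bar> \<le> C"
    by (rule continuous_compact_support_bounded[OF g]) (assumption, rule that)
  have i: "integrable lebesgue (\<lambda>x. indicator K x *\<^sub>R f x)"
    using f g(2) by (simp add: L1_loc_def set_integrable_def)
  have eq: "f x * g x = (indicator K x *\<^sub>R f x) * g x" for x
    using g(3)[of x] by (auto simp: indicator_def)
  show ?thesis unfolding eq
  proof (rule Bochner_Integration.integrable_bound)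
    show "integrable lebesgue (\<lambda>x. C * (indicator K x *\<^sub>R f x))" using i by simp
    show "(\<lambda>x. (indicator K x *\<^sub>R f x) * g x) \<in> borel_measurable lebesgue"
      using borel_measurable_integrable[OF i] continuous_measurable_lebesgue[OF g(1)] by simp
    show "AE x in lebesgue. norm ((indicator K x *\<^sub>R f x) * g x) \<le> norm (C * (indicator K x *\<^sub>R f x))"
    proof (rule AE_I2)
      fix x
      have "\<bar>g x\<bar> \<le> \<bar>C\<bar>" using C[of x] by linarith
      then have "\<bar>g x\<bar> * \<bar>indicator K x *\<^sub>R f x\<bar> \<le> \<bar>C\<bar> * \<bar>indicator K x *\<^sub>R f x\<bar>"
        by (rule mult_right_mono) simp
      then show "norm ((indicator K x *\<^sub>R f x) * g x) \<le> norm (C * (indicator K x *\<^sub>R f x))"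
        by (simp add: abs_mult mult.commute)
    qed
  qed
qed

lemma L1_loc_mult_test:
  assumes "f \<in> L1_loc" "\<phi> \<in> test_functions"
  shows "integrable lebesgue (\<lambda>x. f x * \<phi> x)" "integrable lebesgue (\<lambda>x. f x * partial_deriv i \<phi> x)"
proof -
  obtain K where "compact K" "\<And>x. x \<notin> K \<Longrightarrow> \<phi> x = 0" "\<And>i x. x \<notin> K \<Longrightarrow> partial_deriv i \<phi> x = 0"
    by (rule test_function_support[OF assms(2)]) (rule that)
  then show "integrable lebesgue (\<lambda>x. f x * \<phi> x)" "integrable lebesgue (\<lambda>x. f x * partial_deriv i \<phi> x)"
    using assms test_function_smooth[OF assms(2)]
    by (auto intro!: L1_loc_mult_compact_support[of f _ K] smooth_continuous smooth_partial_deriv)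
qed

text \<open>The boxes generate the Borel sets and are stable under intersection, so a Dynkin
  argument extends the vanishing from boxes to all Borel sets.\<close>

lemma AE_zero_if_box_integrals_zero:
  fixes f :: "'a::euclidean_space \<Rightarrow> real"
  assumes f: "integrable lebesgue f" and box: "\<And>a b. (LINT x|lebesgue. indicator (box a b) x * f x) = 0"
  shows "AE x in lebesgue. f x = 0"
proof -
  \<comment> \<open>The Dynkin argument runs over Borel sets and \<open>lborel\<close>, hence the
    passage to a Borel measurable representative.\<close>
  obtain g where g[measurable]: "g \<in> borel_measurable lborel" and fg: "AE x in lborel. f x = g x"
    using completion_ex_borel_measurable_real[OF borel_measurable_integrable[OF f]] by blast
  have fg': "AE x in lebesgue. f x = g x" using fg by (rule AE_completion)
  have gl: "g \<in> borel_measurable lebesgue" by (rule measurable_completion[OF g])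
  have "integrable lebesgue g"
    using integrable_cong_AE[OF borel_measurable_integrable[OF f] gl fg'] f by simp
  then have gi: "integrable lborel g" using integrable_completion[OF g] by simp
  have int_box: "(LINT x|lborel. indicator (box a b) x * g x) = 0" for a b
  proof -
    have "(LINT x|lborel. indicator (box a b) x * g x) = (LINT x|lebesgue. indicator (box a b) x * g x)"
      by (rule integral_completion[symmetric]) simp
    also have "\<dots> = (LINT x|lebesgue. indicator (box a b) x * f x)"
    proof (rule integral_cong_AE)
      have [measurable]: "(indicator (box a b) :: _ \<Rightarrow> real) \<in> borel_measurable lebesgue"
        by (rule borel_measurable_indicator) simp
      note [measurable] = gl borel_measurable_integrable[OF f]
      show "(\<lambda>x. indicator (box a b) x * g x) \<in> borel_measurable lebesgue"
        "(\<lambda>x. indicator (box a b) x * f x) \<in> borel_measurable lebesgue" by measurable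
      show "AE x in lebesgue. indicator (box a b) x * g x = indicator (box a b) x * f x"
        using fg' by eventually_elim simp
    qed
    finally show ?thesis using box by simp
  qed
  have ind: "integrable lborel (\<lambda>x. indicator A x * g x)" if "A \<in> sets borel" for A
    using integrable_mult_indicator[of A lborel g] that gi by simp
  \<comment> \<open>The complement step of the induction needs the integral over the whole space,
    which is exhausted by boxes.\<close>
  have univ: "(LINT x|lborel. g x) = 0"
  proof -
    have "(\<lambda>n. LINT x|lborel. indicator (box (- real n *\<^sub>R One) (real n *\<^sub>R One)) x * g x) \<longlonglongrightarrow> (LINT x|lborel. g x)"
    proof (rule integral_dominated_convergence[where w = "\<lambda>x. norm (g x)"])
      show "AE x in lborel. (\<lambda>n. indicator (box (- real n *\<^sub>R One) (real n *\<^sub>R One)) x * g x) \<longlonglongrightarrow> g x"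
      proof (rule AE_I2)
        fix x :: 'a
        obtain N :: nat where N: "norm x < real N" using reals_Archimedean2 by blast
        have "x \<in> box (- real n *\<^sub>R One) (real n *\<^sub>R One)" if "n \<ge> N" for n
        proof -
          have "\<bar>x \<bullet> b\<bar> < real n" if "b \<in> Basis" for b
            using Basis_le_norm[OF that, of x] N \<open>n \<ge> N\<close> by linarith
          then show ?thesis by (fastforce simp: mem_box abs_less_iff)
        qed
        then have "\<forall>\<^sub>F n in sequentially. indicator (box (- real n *\<^sub>R One) (real n *\<^sub>R One)) x * g x = g x"
          unfolding eventually_sequentially by (intro exI[of _ N]) auto
        then show "(\<lambda>n. indicator (box (- real n *\<^sub>R One) (real n *\<^sub>R One)) x * g x) \<longlonglongrightarrow> g x"
          by (rule tendsto_eventually)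
      qed
      show "AE x in lborel. norm (indicator (box (- real n *\<^sub>R One) (real n *\<^sub>R One)) x * g x) \<le> norm (g x)" for n
        by (rule AE_I2) (auto simp: indicator_def)
    qed (use gi in auto)
    then show ?thesis unfolding int_box using LIMSEQ_unique tendsto_const by blast
  qed
  have "(LINT x|lborel. indicator A x * g x) = 0" if "A \<in> sets borel" for A
  proof -
    have "Int_stable (range (\<lambda>(a::'a, b). box a b))"
      by (auto simp: Int_stable_def box_Int_box)
    moreover have "range (\<lambda>(a::'a, b). box a b) \<subseteq> Pow UNIV" by auto
    moreover have "A \<in> sigma_sets UNIV (range (\<lambda>(a::'a, b). box a b))"
      using that unfolding borel_eq_box by simp
    ultimately show ?thesis
    proof (induction rule: sigma_sets_induct_disjoint)
      case (basic A)
      then show ?case using int_box by auto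
    next
      case empty
      then show ?case by simp
    next
      case (compl A)
      then have A: "A \<in> sets borel" by (simp add: borel_eq_box)
      have "(LINT x|lborel. indicator (UNIV - A) x * g x) = (LINT x|lborel. g x - indicator A x * g x)"
        by (intro Bochner_Integration.integral_cong) (auto simp: indicator_def)
      also have "\<dots> = 0" using compl gi ind[OF A] univ by simp
      finally show ?case .
    next
      case (union A)
      then have A: "A i \<in> sets borel" for i by (auto simp: borel_eq_box subset_eq)
      have "(LINT x:(\<Union>i. A i)|lborel. g x) = (\<Sum>i. (LINT x:A i|lborel. g x))"
        using A union(1) integrable_mult_indicator[of "\<Union>i. A i" lborel g] gi
        by (intro lebesgue_integral_countable_add) (auto simp: disjoint_family_on_def set_integrable_def)
      also have "\<dots> = 0" using union by (simp add: set_lebesgue_integral_def)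
      finally show ?case by (simp add: set_lebesgue_integral_def)
    qed
  qed
  then have "AE x in lborel. g x = 0"
    using gi by (intro sigma_finite_measure.density_zero[OF sigma_finite_lborel]) (auto simp: set_lebesgue_integral_def)
  with fg have "AE x in lborel. f x = 0" by eventually_elim simp
  then show ?thesis by (rule AE_completion)
qed

lemma test_function_box_bump:
  assumes "m > 0"
  shows "(\<lambda>x::real^'n. \<Prod>i\<in>UNIV. bump m (a $ i) (b $ i) (x $ i)) \<in> test_functions"
proof (rule test_functionI)
  show "smooth (\<lambda>x::real^'n. \<Prod>i\<in>UNIV. bump m (a $ i) (b $ i) (x $ i))"
    by (intro smooth_prod smooth_bump)
  show "compact (cbox a b)" by simp
  fix x assume "x \<notin> cbox a b"
  then obtain i where "x $ i < a $ i \<or> b $ i < x $ i" by (auto simp: mem_box_cart not_le)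
  then have "bump m (a $ i) (b $ i) (x $ i) = 0" using assms by (intro bump_eq_0) auto
  then show "(\<Prod>i\<in>UNIV. bump m (a $ i) (b $ i) (x $ i)) = 0" by (intro prod_zero) auto
qed

text \<open>Products of steep bumps are test functions that converge boundedly to box indicators, so
  \<open>f\<close> integrates to zero over every box. As \<open>f\<close> is only locally
  integrable, the box criterion is applied to its truncations.\<close>

lemma fundamental_lemma:
  fixes f :: "real^'n \<Rightarrow> real"
  assumes f: "f \<in> L1_loc" and zero: "\<And>\<phi>. \<phi> \<in> test_functions \<Longrightarrow> (LINT x|lebesgue. f x * \<phi> x) = 0"
  shows "AE x in lebesgue. f x = 0"
proof -
  have box: "(LINT x|lebesgue. indicator (box a b) x * f x) = 0" for a b :: "real^'n"
  proof -
    define \<phi> where "\<phi> m x = (\<Prod>i\<in>UNIV. bump (real (Suc m)) (a $ i) (b $ i) (x $ i))" for m and x :: "real^'n"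
    have t: "\<phi> m \<in> test_functions" for m
      unfolding \<phi>_def by (rule test_function_box_bump) simp
    have i: "integrable lebesgue (\<lambda>x. indicator (cbox a b) x *\<^sub>R f x)"
      using f by (simp add: L1_loc_def set_integrable_def)
    have lim: "(\<lambda>m. \<phi> m x) \<longlonglongrightarrow> indicator (box a b) x" for x
    proof -
      have "(\<lambda>m. \<phi> m x) \<longlonglongrightarrow> (\<Prod>i\<in>UNIV. indicator {a $ i<..<b $ i} (x $ i))"
        unfolding \<phi>_def by (intro tendsto_prod bump_tendsto)
      also have "(\<Prod>i\<in>UNIV. indicator {a $ i<..<b $ i} (x $ i)) = (indicator (box a b) x :: real)"
        by (cases "x \<in> box a b") (auto simp: mem_box_cart prod_zero_iff indicator_def)
      finally show ?thesis .
    qed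
    have bd: "\<bar>\<phi> m x\<bar> \<le> indicator (cbox a b) x" for m x
    proof (cases "x \<in> cbox a b")
      case True
      then show ?thesis
        by (auto simp: \<phi>_def abs_prod bump_bounds intro!: prod_le_1)
    next
      case False
      then obtain i where "x $ i < a $ i \<or> b $ i < x $ i" by (auto simp: mem_box_cart not_le)
      then have "bump (real (Suc m)) (a $ i) (b $ i) (x $ i) = 0" by (intro bump_eq_0) auto
      then have "\<phi> m x = 0" unfolding \<phi>_def by (intro prod_zero) auto
      then show ?thesis by simp
    qed
    have bm: "(\<lambda>x. indicator (box a b) x * f x) \<in> borel_measurable lebesgue"
    proof -
      have "indicator (box a b) x * f x = indicator (box a b) x * (indicator (cbox a b) x *\<^sub>R f x)" for x
        using box_subset_cbox[of a b] by (auto simp: indicator_def)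
      moreover have "(indicator (box a b) :: _ \<Rightarrow> real) \<in> borel_measurable lebesgue"
        by (rule borel_measurable_indicator) simp
      ultimately show ?thesis
        using borel_measurable_times[OF _ borel_measurable_integrable[OF i]] by presburger
    qed
    have "(\<lambda>m. LINT x|lebesgue. f x * \<phi> m x) \<longlonglongrightarrow> (LINT x|lebesgue. indicator (box a b) x * f x)"
    proof (rule integral_dominated_convergence[where w = "\<lambda>x. norm (indicator (cbox a b) x *\<^sub>R f x)"])
      show "AE x in lebesgue. (\<lambda>m. f x * \<phi> m x) \<longlonglongrightarrow> indicator (box a b) x * f x"
        using tendsto_mult[OF tendsto_const lim] by (intro AE_I2) (simp add: mult.commute)
      show "AE x in lebesgue. norm (f x * \<phi> m x) \<le> norm (indicator (cbox a b) x *\<^sub>R f x)" for m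
      proof (rule AE_I2)
        fix x
        show "norm (f x * \<phi> m x) \<le> norm (indicator (cbox a b) x *\<^sub>R f x)"
          using mult_left_mono[OF bd[of m x] abs_ge_zero[of "f x"]] by (simp add: abs_mult mult.commute)
      qed
      show "(\<lambda>x. f x * \<phi> m x) \<in> borel_measurable lebesgue" for m
        using L1_loc_mult_test(1)[OF f t] by (rule borel_measurable_integrable)
    qed (use i bm in auto)
    then show ?thesis using zero[OF t] LIMSEQ_unique[OF _ tendsto_const] by simp
  qed
  have "AE x in lebesgue. indicator (box (- real n *\<^sub>R One) (real n *\<^sub>R One)) x * f x = 0" for n :: nat
  proof (rule AE_zero_if_box_integrals_zero)
    have "set_integrable lebesgue (cbox (- real n *\<^sub>R One) (real n *\<^sub>R One)) f"
      using f by (simp add: L1_loc_def)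
    then have "set_integrable lebesgue (box (- real n *\<^sub>R One) (real n *\<^sub>R One)) f"
      by (rule set_integrable_subset) (auto simp: box_subset_cbox)
    then show "integrable lebesgue (\<lambda>x. indicator (box (- real n *\<^sub>R One) (real n *\<^sub>R One)) x * f x)"
      by (simp add: set_integrable_def)
    fix a b :: "real^'n"
    have "indicator (box a b) x * (indicator (box (- real n *\<^sub>R One) (real n *\<^sub>R One)) x * f x)
      = indicator (box a b \<inter> box (- real n *\<^sub>R One) (real n *\<^sub>R One)) x * f x" for x
      by (auto simp: indicator_def)
    moreover obtain c d where "box a b \<inter> box (- real n *\<^sub>R One) (real n *\<^sub>R One) = box c d"
      unfolding box_Int_box by blast
    ultimately show "(LINT x|lebesgue. indicator (box a b) x * (indicator (box (- real n *\<^sub>R One) (real n *\<^sub>R One)) x * f x)) = 0"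
      by (simp only: box)
  qed
  then have "AE x in lebesgue. \<forall>n::nat. indicator (box (- real n *\<^sub>R One) (real n *\<^sub>R One)) x * f x = 0"
    unfolding AE_all_countable by blast
  then show ?thesis
  proof eventually_elim
    case (elim x)
    obtain N :: nat where N: "norm x < real N" using reals_Archimedean2 by blast
    have "\<bar>x \<bullet> b\<bar> < real N" if "b \<in> Basis" for b
      using Basis_le_norm[OF that, of x] N by linarith
    then have "x \<in> box (- real N *\<^sub>R One) (real N *\<^sub>R One)" by (fastforce simp: mem_box abs_less_iff)
    with elim show ?case by (auto dest!: spec[of _ N])
  qed
qed

lemma continuous_L1_loc:
  fixes f :: "real^'n \<Rightarrow> real"
  assumes "continuous_on UNIV f"
  shows "f \<in> L1_loc"
proof -
  have "set_integrable lebesgue K f" if K: "compact K" for K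
  proof -
    obtain a where a: "K \<subseteq> cbox (- a) a"
      by (rule bounded_subset_cbox_symmetric[OF compact_imp_bounded[OF K]])
    have "f absolutely_integrable_on cbox (- a) a"
      by (intro absolutely_integrable_continuous continuous_on_subset[OF assms]) simp
    then show ?thesis
      by (rule set_integrable_subset) (use a K in \<open>auto simp: lmeasurable_compact fmeasurableD\<close>)
  qed
  then show ?thesis by (simp add: L1_loc_def)
qed

lemma L1_loc_measurable:
  fixes f :: "real^'n \<Rightarrow> real"
  assumes "f \<in> L1_loc"
  shows "f \<in> borel_measurable lebesgue"
proof (rule borel_measurable_LIMSEQ_real)
  show "(\<lambda>x. indicator (cball 0 (real n)) x *\<^sub>R f x) \<in> borel_measurable lebesgue" for n
    by (rule borel_measurable_integrable) (use assms in \<open>simp add: L1_loc_def set_integrable_def\<close>)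
  fix x :: "real^'n"
  obtain N :: nat where N: "norm x \<le> real N" using real_arch_simple by blast
  have "\<forall>\<^sub>F n in sequentially. indicator (cball 0 (real n)) x *\<^sub>R f x = f x"
    unfolding eventually_sequentially using N by (intro exI[of _ N]) (auto simp: indicator_def)
  then show "(\<lambda>n. indicator (cball 0 (real n)) x *\<^sub>R f x) \<longlonglongrightarrow> f x"
    by (rule tendsto_eventually)
qed

lemma L1_loc_add: "f \<in> L1_loc \<Longrightarrow> g \<in> L1_loc \<Longrightarrow> (\<lambda>x. f x + g x) \<in> L1_loc"
  and L1_loc_cmult: "f \<in> L1_loc \<Longrightarrow> (\<lambda>x. c * f x) \<in> L1_loc"
  by (auto simp: L1_loc_def intro!: set_integral_add)

lemma L1_loc_translation:
  assumes "f \<in> L1_loc"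
  shows "(\<lambda>x. f (x + a)) \<in> L1_loc"
proof -
  have "set_integrable lebesgue K (\<lambda>x. f (x + a))" if K: "compact K" for K
  proof -
    have "compact ((\<lambda>x. a + x) ` K)" by (rule compact_translation[OF K])
    then have "integrable lebesgue (\<lambda>x. indicator ((\<lambda>x. a + x) ` K) x *\<^sub>R f x)"
      using assms by (simp add: L1_loc_def set_integrable_def)
    from integrable_translation[OF this, of a] show ?thesis
      unfolding set_integrable_def by (simp add: indicator_def image_iff add.commute)
  qed
  then show ?thesis by (simp add: L1_loc_def)
qed

section \<open>Integration by parts for smooth functions\<close>

lemma test_function_integrable: "\<phi> \<in> test_functions \<Longrightarrow> integrable lebesgue \<phi>"
  using L1_loc_mult_test(1)[of "\<lambda>x. 1" \<phi>] by (simp add: continuous_L1_loc)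

lemma smooth_directional_derivative:
  assumes "smooth f"
  shows "((\<lambda>t. f (x + t *\<^sub>R axis i 1)) has_real_derivative partial_deriv i f (x + t *\<^sub>R axis i 1)) (at t)"
proof -
  have "((\<lambda>t. x + t *\<^sub>R axis i 1) has_derivative (\<lambda>h. h *\<^sub>R axis i 1)) (at t)"
    by (auto intro!: derivative_eq_intros)
  moreover have d: "(f has_derivative frechet_derivative f (at y)) (at y)" for y
    by (rule smooth_has_derivative[OF assms])
  ultimately have "((\<lambda>t. f (x + t *\<^sub>R axis i 1)) has_derivative
      (\<lambda>h. frechet_derivative f (at (x + t *\<^sub>R axis i 1)) (h *\<^sub>R axis i 1))) (at t)"
    by (rule has_derivative_compose)
  moreover have "frechet_derivative f (at y) (h *\<^sub>R axis i 1) = partial_deriv i f y * h" for y h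
    using linear_scale[OF has_derivative_linear[OF d[of y]], of h "axis i 1"]
    by (simp add: partial_deriv_def)
  ultimately show ?thesis by (simp add: has_field_derivative_def)
qed

text \<open>The integrals of the difference quotients vanish by translation invariance.\<close>

lemma integral_partial_deriv_test_function:
  fixes \<phi> :: "real^'n \<Rightarrow> real"
  assumes \<phi>: "\<phi> \<in> test_functions"
  shows "(LINT x|lebesgue. partial_deriv i \<phi> x) = 0"
proof -
  note sm = test_function_smooth[OF \<phi>]
  obtain K where K: "compact K" "\<And>x. x \<notin> K \<Longrightarrow> \<phi> x = 0" "\<And>i x. x \<notin> K \<Longrightarrow> partial_deriv i \<phi> x = 0"
    by (rule test_function_support[OF \<phi>]) (rule that)
  obtain R where R: "\<And>x. x \<in> K \<Longrightarrow> norm x \<le> R" using compact_imp_bounded[OF K(1)] by (auto simp: bounded_iff)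
  obtain C where "C \<ge> 0" and C: "\<And>x. \<bar>partial_deriv i \<phi> x\<bar> \<le> C"
    by (rule continuous_compact_support_bounded[OF smooth_continuous[OF smooth_partial_deriv[OF sm]] K(1,3)]) 
      (assumption, rule that)
  define e :: "real^'n" where "e = axis i 1"
  define h where "h n = inverse (real (Suc n))" for n
  have h: "0 < h n" "h n \<le> 1" for n by (auto simp: h_def inverse_le_1_iff)
  have \<phi>m[measurable]: "\<phi> \<in> borel_measurable lebesgue"
    using test_function_integrable[OF \<phi>] by (rule borel_measurable_integrable)
  have \<phi>t[measurable]: "(\<lambda>x. \<phi> (x + h n *\<^sub>R e)) \<in> borel_measurable lebesgue" for n
    by (rule borel_measurable_translation_lebesgue[OF \<phi>m])
  define D where "D n x = (\<phi> (x + h n *\<^sub>R e) - \<phi> x) / h n" for n x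
  have "(LINT x|lebesgue. D n x) = 0" for n
    unfolding D_def using test_function_integrable[OF \<phi>] integrable_translation[OF test_function_integrable[OF \<phi>]]
    by (simp add: integral_translation)
  moreover have "(\<lambda>n. LINT x|lebesgue. D n x) \<longlonglongrightarrow> (LINT x|lebesgue. partial_deriv i \<phi> x)"
  \<comment> \<open>By the mean value theorem the quotient is a derivative at an intermediate point,
    hence at most \<open>C\<close> in absolute value. As the steps are at most 1, it vanishes
    outside the ball of radius \<open>R + 1\<close>.\<close>
  proof (rule integral_dominated_convergence[where w = "\<lambda>x. indicator (cball 0 (R + 1)) x *\<^sub>R C"])
    show "integrable lebesgue (\<lambda>x::real^'n. indicator (cball 0 (R + 1)) x *\<^sub>R C)"
      using continuous_L1_loc[of "\<lambda>x::real^'n. C"] by (auto simp: L1_loc_def set_integrable_def)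
    show "partial_deriv i \<phi> \<in> borel_measurable lebesgue"
      using test_function_integrable[OF test_function_partial_deriv[OF \<phi>]] by (rule borel_measurable_integrable)
    show "D n \<in> borel_measurable lebesgue" for n unfolding D_def by measurable
    show "AE x in lebesgue. (\<lambda>n. D n x) \<longlonglongrightarrow> partial_deriv i \<phi> x"
    proof (rule AE_I2)
      fix x
      have "((\<lambda>t. \<phi> (x + t *\<^sub>R e)) has_real_derivative partial_deriv i \<phi> x) (at 0)"
        using smooth_directional_derivative[OF sm, of x i 0] by (simp add: e_def)
      then have l: "((\<lambda>t. (\<phi> (x + t *\<^sub>R e) - \<phi> x) / t) \<longlongrightarrow> partial_deriv i \<phi> x) (at 0)"
        by (simp add: DERIV_def)
      have "filterlim h (at 0) sequentially"
        unfolding filterlim_at using LIMSEQ_inverse_real_of_nat h(1) by (auto simp: h_def[abs_def] less_imp_neq[symmetric])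
      from filterlim_compose[OF l this] show "(\<lambda>n. D n x) \<longlonglongrightarrow> partial_deriv i \<phi> x" by (simp add: D_def)
    qed
    show "AE x in lebesgue. norm (D n x) \<le> indicator (cball 0 (R + 1)) x *\<^sub>R C" for n
    proof (rule AE_I2)
      fix x
      show "norm (D n x) \<le> indicator (cball 0 (R + 1)) x *\<^sub>R C"
      proof (cases "x \<in> cball 0 (R + 1)")
        case True
        obtain z where "\<phi> (x + h n *\<^sub>R e) - \<phi> (x + 0 *\<^sub>R e) = (h n - 0) * partial_deriv i \<phi> (x + z *\<^sub>R e)"
          using MVT2[of 0 "h n" "\<lambda>t. \<phi> (x + t *\<^sub>R e)" "\<lambda>t. partial_deriv i \<phi> (x + t *\<^sub>R e)"]
            smooth_directional_derivative[OF sm] h[of n] by (auto simp: e_def)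
        then have "D n x = partial_deriv i \<phi> (x + z *\<^sub>R e)" using h(1)[of n] by (simp add: D_def)
        with True C show ?thesis by simp
      next
        case False
        then have "norm x > R + 1" by simp
        moreover have "norm x \<le> norm (x + h n *\<^sub>R e) + norm (h n *\<^sub>R e)"
          using norm_triangle_ineq4[of "x + h n *\<^sub>R e" "h n *\<^sub>R e"] by simp
        moreover have "norm (h n *\<^sub>R e) \<le> 1" using h[of n] by (simp add: e_def norm_axis_1)
        ultimately have "x \<notin> K" "x + h n *\<^sub>R e \<notin> K" using R by force+
        then show ?thesis using False by (simp add: D_def K(2))
      qed
    qed
  qed
  ultimately show ?thesis using LIMSEQ_unique[OF _ tendsto_const] by simp
qed

lemma has_weak_partial_smooth:
  assumes "smooth e"
  shows "has_weak_partial i e (partial_deriv i e)"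
proof -
  have L: "e \<in> L1_loc" "partial_deriv i e \<in> L1_loc"
    using assms smooth_partial_deriv by (auto intro!: continuous_L1_loc smooth_continuous)
  have "(LINT x|lebesgue. e x * partial_deriv i \<phi> x) = - (LINT x|lebesgue. partial_deriv i e x * \<phi> x)"
    if \<phi>: "\<phi> \<in> test_functions" for \<phi>
  proof -
    have "partial_deriv i (\<lambda>x. e x * \<phi> x) = (\<lambda>x. e x * partial_deriv i \<phi> x + partial_deriv i e x * \<phi> x)"
      by (intro ext partial_deriv_mult smooth_differentiable assms test_function_smooth[OF \<phi>])
    then have "(LINT x|lebesgue. e x * partial_deriv i \<phi> x + partial_deriv i e x * \<phi> x) = 0"
      using integral_partial_deriv_test_function[OF test_function_mult_smooth[OF assms \<phi>], of i] by simp
    then show ?thesis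
      using L1_loc_mult_test[OF L(1) \<phi>] L1_loc_mult_test[OF L(2) \<phi>] by simp
  qed
  with L show ?thesis by (simp add: has_weak_partial_def)
qed

lemma smooth_periodic_partial_deriv:
  assumes "smooth e" "\<And>j x. e (x + axis j 1) = e x"
  shows "partial_deriv i e (x + axis j 1) = partial_deriv i e x"
  using partial_deriv_translation[OF smooth_differentiable[OF assms(1)], where i = i and a = "axis j 1" and x = x]
  by (simp add: assms(2))

section \<open>Uniqueness, periodicity and limits of weak derivatives\<close>

lemma has_weak_partial_unique:
  assumes "has_weak_partial i f g" "has_weak_partial i f g'"
  shows "AE x in lebesgue. g x = g' x"
proof -
  have L: "g \<in> L1_loc" "g' \<in> L1_loc" using assms by (auto simp: has_weak_partial_def)
  have "AE x in lebesgue. g x + (-1) * g' x = 0"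
  proof (rule fundamental_lemma)
    show "(\<lambda>x. g x + (-1) * g' x) \<in> L1_loc" by (intro L1_loc_add L1_loc_cmult L)
    fix \<phi> :: "real^'a \<Rightarrow> real" assume \<phi>: "\<phi> \<in> test_functions"
    have "(LINT x|lebesgue. g x * \<phi> x) = (LINT x|lebesgue. g' x * \<phi> x)"
      using assms \<phi> by (simp add: has_weak_partial_def)
    then show "(LINT x|lebesgue. (g x + (-1) * g' x) * \<phi> x) = 0"
      using L1_loc_mult_test[OF L(1) \<phi>] L1_loc_mult_test[OF L(2) \<phi>]
      by (simp add: algebra_simps)
  qed
  then show ?thesis by eventually_elim simp
qed

lemma has_weak_partial_weak_partial: "has_weak_partial i f g \<Longrightarrow> has_weak_partial i f (weak_partial i f)"
  unfolding weak_partial_def by (rule someI[of "has_weak_partial i f"])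

lemma weak_partial_AE: "has_weak_partial i f g \<Longrightarrow> AE x in lebesgue. weak_partial i f x = g x"
  by (rule has_weak_partial_unique[OF has_weak_partial_weak_partial])

lemma has_weak_partial_add:
  assumes "has_weak_partial i f g" "has_weak_partial i f' g'"
  shows "has_weak_partial i (\<lambda>x. f x + f' x) (\<lambda>x. g x + g' x)"
  using assms by (auto simp: has_weak_partial_def L1_loc_add distrib_right L1_loc_mult_test)

lemma has_weak_partial_cmult:
  assumes "has_weak_partial i f g"
  shows "has_weak_partial i (\<lambda>x. c * f x) (\<lambda>x. c * g x)"
  using assms by (auto simp: has_weak_partial_def L1_loc_cmult mult.assoc)

lemma has_weak_partial_cong_AE:
  assumes "has_weak_partial i f g" "AE x in lebesgue. f' x = f x" "f' \<in> L1_loc"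
  shows "has_weak_partial i f' g"
proof -
  have "(LINT x|lebesgue. f' x * partial_deriv i \<phi> x) = (LINT x|lebesgue. f x * partial_deriv i \<phi> x)"
    if \<phi>: "\<phi> \<in> test_functions" for \<phi>
  proof (rule integral_cong_AE)
    show "AE x in lebesgue. f' x * partial_deriv i \<phi> x = f x * partial_deriv i \<phi> x"
      using assms(2) by eventually_elim simp
    show "(\<lambda>x. f' x * partial_deriv i \<phi> x) \<in> borel_measurable lebesgue" "(\<lambda>x. f x * partial_deriv i \<phi> x) \<in> borel_measurable lebesgue"
      using L1_loc_mult_test(2)[OF _ \<phi>] assms by (auto simp: has_weak_partial_def)
  qed
  with assms show ?thesis by (simp add: has_weak_partial_def)
qed

text \<open>Shifting the test function shows that the shift of \<open>g\<close> is again a weak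
  derivative of \<open>f\<close>, and weak derivatives are unique. This is why \<open>H_per\<close>
  can impose periodicity on the function alone.\<close>

lemma has_weak_partial_periodic:
  assumes w: "has_weak_partial i f g" and per: "periodic f"
  shows "periodic g"
  unfolding periodic_def
proof
  fix j
  define a :: "real^'a" where "a = axis j 1"
  have L: "f \<in> L1_loc" "g \<in> L1_loc" using w by (auto simp: has_weak_partial_def)
  have "has_weak_partial i f (\<lambda>x. g (x + a))"
    unfolding has_weak_partial_def
  proof (intro conjI ballI L L1_loc_translation)
    fix \<phi> :: "real^'a \<Rightarrow> real" assume \<phi>: "\<phi> \<in> test_functions"
    define \<psi> where "\<psi> x = \<phi> (x + - a)" for x
    have \<psi>: "\<psi> \<in> test_functions" unfolding \<psi>_def by (rule test_function_translation[OF \<phi>])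
    have pd: "partial_deriv i \<psi> x = partial_deriv i \<phi> (x + - a)" for x
      unfolding \<psi>_def by (intro partial_deriv_translation smooth_differentiable test_function_smooth \<phi>)
    have "(LINT x|lebesgue. f x * partial_deriv i \<phi> x) = (LINT x|lebesgue. f (x + a) * partial_deriv i \<phi> x)"
    proof (rule integral_cong_AE)
      show "AE x in lebesgue. f x * partial_deriv i \<phi> x = f (x + a) * partial_deriv i \<phi> x"
        using per[unfolded periodic_def, rule_format, of j] by eventually_elim (simp add: a_def)
      show "(\<lambda>x. f x * partial_deriv i \<phi> x) \<in> borel_measurable lebesgue"
        "(\<lambda>x. f (x + a) * partial_deriv i \<phi> x) \<in> borel_measurable lebesgue"
        using L1_loc_mult_test(2)[OF L(1) \<phi>] L1_loc_mult_test(2)[OF L1_loc_translation[OF L(1)] \<phi>] by auto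
    qed
    also have "\<dots> = (LINT x|lebesgue. f x * partial_deriv i \<psi> x)"
      using integral_translation[OF borel_measurable_integrable[OF L1_loc_mult_test(2)[OF L(1) \<psi>]], of a i]
      by (simp add: pd)
    also have "\<dots> = - (LINT x|lebesgue. g x * \<psi> x)"
      using w \<psi> by (simp add: has_weak_partial_def)
    also have "\<dots> = - (LINT x|lebesgue. g (x + a) * \<phi> x)"
      using integral_translation[OF borel_measurable_integrable[OF L1_loc_mult_test(1)[OF L(2) \<psi>]], of a]
      by (simp add: \<psi>_def)
    finally show "(LINT x|lebesgue. f x * partial_deriv i \<phi> x) = - (LINT x|lebesgue. g (x + a) * \<phi> x)" .
  qed
  from has_weak_partial_unique[OF this w] show "AE x in lebesgue. g (x + axis j 1) = g x"
    by (simp add: a_def)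
qed

text \<open>Weak differentiation is closed under L2 convergence on one cell. A test function may
  spread over many cells; \<open>periodic_integral_compact_le\<close> bounds its pairing by a
  multiple of the norm on the cell, uniformly in \<open>n\<close>.\<close>

lemma has_weak_partial_limit:
  fixes f g :: "real^'n \<Rightarrow> real"
  assumes w: "\<And>n. has_weak_partial i (F n) (G n)"
    and F: "\<And>n. F n \<in> L2_per" and G: "\<And>n. G n \<in> L2_per" and f: "f \<in> L2_per" and g: "g \<in> L2_per"
    and limf: "(\<lambda>n. LINT x|cell. (F n x - f x)\<^sup>2) \<longlonglongrightarrow> 0"
    and limg: "(\<lambda>n. LINT x|cell. (G n x - g x)\<^sup>2) \<longlonglongrightarrow> 0"
  shows "has_weak_partial i f g"
proof -
  have L: "h \<in> L2_per \<Longrightarrow> h \<in> L1_loc" for h :: "real^'n \<Rightarrow> real"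
    using L2_loc_subset_L1_loc by (auto simp: L2_per_def)
  have conv: "(\<lambda>n. LINT x|lebesgue. H n x * \<psi> x) \<longlonglongrightarrow> (LINT x|lebesgue. h x * \<psi> x)"
    if \<psi>: "\<psi> \<in> test_functions" and H: "\<And>n. H n \<in> L2_per" and h: "h \<in> L2_per"
      and lim: "(\<lambda>n. LINT x|cell. (H n x - h x)\<^sup>2) \<longlonglongrightarrow> 0" for \<psi> H and h :: "real^'n \<Rightarrow> real"
  proof -
    obtain K where K: "compact K" "\<And>x. x \<notin> K \<Longrightarrow> \<psi> x = 0" "\<And>i x. x \<notin> K \<Longrightarrow> partial_deriv i \<psi> x = 0"
      by (rule test_function_support[OF \<psi>]) (rule that)
    obtain C where "C \<ge> 0" and C: "\<And>x. \<bar>\<psi> x\<bar> \<le> C"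
      by (rule continuous_compact_support_bounded[OF smooth_continuous[OF test_function_smooth[OF \<psi>]] K(1,2)])
        (assumption, rule that)
    obtain N where N: "\<And>f :: real^'n \<Rightarrow> real. f \<in> borel_measurable lebesgue \<Longrightarrow> periodic f \<Longrightarrow>
      integrable cell f \<Longrightarrow> (LINT x|lebesgue. indicator K x * \<bar>f x\<bar>) \<le> real N * (LINT x|cell. \<bar>f x\<bar>)"
      by (rule periodic_integral_compact_le[OF K(1)]) (rule that)
    have bound: "norm ((LINT x|lebesgue. H n x * \<psi> x) - (LINT x|lebesgue. h x * \<psi> x))
        \<le> C * real N * sqrt (LINT x|cell. (H n x - h x)\<^sup>2)" for n
    proof -
      define d where "d x = H n x - h x" for x
      have d: "d \<in> borel_measurable lebesgue" "periodic d" "sq_integrable cell d"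
        unfolding d_def using H[of n] h periodic_compose2[of "H n" h "\<lambda>a b. a - b"]
        by (auto simp: L2_per_iff sq_integrable_diff intro: borel_measurable_diff)
      have i: "integrable cell d" by (rule cell.sq_integrable_integrable[OF d(3)])
      have dK: "integrable lebesgue (\<lambda>x. indicator K x * \<bar>d x\<bar>)"
        using integrable_abs[OF periodic_integrable_compact[OF d(1,2) i K(1), unfolded set_integrable_def]]
        by (simp add: abs_mult)
      have "(LINT x|lebesgue. H n x * \<psi> x) - (LINT x|lebesgue. h x * \<psi> x) = (LINT x|lebesgue. d x * \<psi> x)"
        using L1_loc_mult_test(1)[OF L[OF H[of n]] \<psi>] L1_loc_mult_test(1)[OF L[OF h] \<psi>]
        by (simp add: d_def left_diff_distrib)
      also have "norm \<dots> \<le> (LINT x|lebesgue. C * (indicator K x * \<bar>d x\<bar>))"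
      proof (rule order_trans[OF integral_norm_bound integral_mono])
        show "integrable lebesgue (\<lambda>x. norm (d x * \<psi> x))"
          using L1_loc_mult_test(1)[OF L[OF H[of n]] \<psi>] L1_loc_mult_test(1)[OF L[OF h] \<psi>]
          by (intro integrable_norm) (simp add: d_def left_diff_distrib)
        show "integrable lebesgue (\<lambda>x. C * (indicator K x * \<bar>d x\<bar>))" using dK by simp
        show "norm (d x * \<psi> x) \<le> C * (indicator K x * \<bar>d x\<bar>)" for x
          using mult_right_mono[OF C[of x] abs_ge_zero[of "d x"]] K(2)[of x]
          by (cases "x \<in> K") (auto simp: abs_mult mult.commute)
      qed
      also have "\<dots> = C * (LINT x|lebesgue. indicator K x * \<bar>d x\<bar>)" by simp
      also have "\<dots> \<le> C * (real N * (LINT x|cell. \<bar>d x\<bar>))"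
        by (intro mult_left_mono N d i \<open>C \<ge> 0\<close>)
      also have "\<dots> \<le> C * (real N * sqrt (LINT x|cell. (d x)\<^sup>2))"
        using cell.integral_abs_le_L2[OF d(3), unfolded measure_cell real_sqrt_one mult_1] \<open>C \<ge> 0\<close> by (intro mult_left_mono) auto
      finally show ?thesis by (simp add: d_def mult.assoc)
    qed
    have "(\<lambda>n. C * real N * sqrt (LINT x|cell. (H n x - h x)\<^sup>2)) \<longlonglongrightarrow> 0"
      using tendsto_mult_right_zero[OF tendsto_real_sqrt[OF lim, simplified], of "C * real N"] .
    then have "(\<lambda>n. (LINT x|lebesgue. H n x * \<psi> x) - (LINT x|lebesgue. h x * \<psi> x)) \<longlonglongrightarrow> 0"
      by (rule Lim_null_comparison[OF always_eventually[OF allI[OF bound]]])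
    then show ?thesis by (simp add: LIM_zero_iff)
  qed
  have "(LINT x|lebesgue. f x * partial_deriv i \<phi> x) = - (LINT x|lebesgue. g x * \<phi> x)"
    if \<phi>: "\<phi> \<in> test_functions" for \<phi>
  proof -
    have "(\<lambda>n. LINT x|lebesgue. F n x * partial_deriv i \<phi> x) \<longlonglongrightarrow> (LINT x|lebesgue. f x * partial_deriv i \<phi> x)"
      by (rule conv[OF test_function_partial_deriv[OF \<phi>] F f limf])
    moreover have "(LINT x|lebesgue. F n x * partial_deriv i \<phi> x) = - (LINT x|lebesgue. G n x * \<phi> x)" for n
      using w \<phi> by (simp add: has_weak_partial_def)
    ultimately have "(\<lambda>n. - (LINT x|lebesgue. G n x * \<phi> x)) \<longlonglongrightarrow> (LINT x|lebesgue. f x * partial_deriv i \<phi> x)"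
      by simp
    moreover have "(\<lambda>n. - (LINT x|lebesgue. G n x * \<phi> x)) \<longlonglongrightarrow> - (LINT x|lebesgue. g x * \<phi> x)"
      by (intro tendsto_minus conv[OF \<phi> G g limg])
    ultimately show ?thesis by (rule LIMSEQ_unique)
  qed
  then show ?thesis using L[OF f] L[OF g] by (simp add: has_weak_partial_def)
qed

section \<open>Integration over the torus\<close>

lemma space_cell: "space (cell :: (real^'n) measure) = unit_cell"
  by (simp add: space_restrict_space)

lemma integrable_cell_mult_continuous:
  fixes f e :: "real^'n \<Rightarrow> real"
  assumes "integrable cell f" "continuous_on UNIV e"
  shows "integrable cell (\<lambda>x. f x * e x)"
proof -
  have "compact (e ` cbox 0 1)"
    by (intro compact_continuous_image continuous_on_subset[OF assms(2)]) auto
  then obtain C where C: "\<And>x. x \<in> cbox 0 1 \<Longrightarrow> \<bar>e x\<bar> \<le> C"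
    using compact_imp_bounded[of "e ` cbox 0 1"] by (auto simp: bounded_iff)
  show ?thesis
  proof (rule Bochner_Integration.integrable_bound)
    show "integrable cell (\<lambda>x. C * f x)" using assms(1) by simp
    show "(\<lambda>x. f x * e x) \<in> borel_measurable cell"
      by (intro borel_measurable_times borel_measurable_integrable[OF assms(1)]
          measurable_cell continuous_measurable_lebesgue assms(2))
    show "AE x in cell. norm (f x * e x) \<le> norm (C * f x)"
    proof (rule AE_I2)
      fix x :: "real^'n" assume "x \<in> space cell"
      then have "\<bar>e x\<bar> \<le> \<bar>C\<bar>"
        using C[of x] box_subset_cbox[of 0 "1::real^'n"] by (fastforce simp: space_cell unit_cell_eq_box)
      from mult_left_mono[OF this abs_ge_zero[of "f x"]]
      show "norm (f x * e x) \<le> norm (C * f x)" by (simp add: abs_mult mult.commute)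
    qed
  qed
qed

text \<open>Each \<open>h i\<close> lives on the interval from 0 to 2, so the integral splits over
  the translates of the cell by vectors with entries 0 and 1. Summing over all of them turns the
  product of the \<open>h i\<close> into a product of the sums \<open>h i t + h i (t + 1)\<close>.
  The functions may differ between coordinates because one of them will be a derivative.\<close>

lemma integral_unfold_periodic:
  fixes F :: "real^'n \<Rightarrow> real" and h :: "'n \<Rightarrow> real \<Rightarrow> real"
  assumes F: "F \<in> borel_measurable lebesgue" "periodic F" "integrable cell F"
    and cont: "\<And>i. continuous_on UNIV (h i)"
    and supp: "\<And>i t. t \<le> 0 \<or> 2 \<le> t \<Longrightarrow> h i t = 0"
    and sum: "\<And>i t. 0 < t \<Longrightarrow> t < 1 \<Longrightarrow> h i t + h i (t + 1) = c i"
  shows "(LINT x|lebesgue. F x * (\<Prod>i\<in>UNIV. h i (x $ i))) = (\<Prod>i\<in>UNIV. c i) * (LINT x|cell. F x)"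
proof -
  define G where "G x = (\<Prod>i\<in>UNIV. h i (x $ i))" for x :: "real^'n"
  have Gc: "continuous_on UNIV G"
    unfolding G_def by (intro continuous_on_prod continuous_on_compose2[OF cont] continuous_intros) auto
  have G0: "G x = 0" if x: "x \<notin> cbox 0 (\<chi> i. 2)" for x
  proof -
    obtain i where "x $ i < 0 \<or> 2 < x $ i" using x by (auto simp: mem_box_cart not_le)
    then have "h i (x $ i) = 0" by (intro supp) auto
    then show ?thesis unfolding G_def by (intro prod_zero) auto
  qed
  \<comment> \<open>The shift vectors are indexed by subsets, the form in which
    \<open>prod_add\<close> expands a product of sums.\<close>
  define s :: "'n set \<Rightarrow> int^'n" where "s A = (\<chi> i. if i \<in> A then 1 else 0)" for A
  have s_inj: "inj_on s (Pow UNIV)"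
    by (rule inj_onI) (auto simp: s_def vec_eq_iff split: if_splits)
  define I where "I A x = (indicator unit_cell (x - lattice_vec (s A)) :: real)" for A and x :: "real^'n"
  have Im[measurable]: "I A \<in> borel_measurable lebesgue" for A
    unfolding I_def using borel_measurable_translation_lebesgue[of "indicator unit_cell :: real^'n \<Rightarrow> real" "- lattice_vec (s A)"]
    by simp
  have FG: "integrable lebesgue (\<lambda>x. F x * G x)"
  proof (rule L1_loc_mult_compact_support[OF _ Gc compact_cbox G0])
    show "F \<in> L1_loc" using periodic_integrable_compact[OF F] by (simp add: L1_loc_def)
  qed
  have IFG: "integrable lebesgue (\<lambda>x. I A x * (F x * G x))" for A
  proof (rule Bochner_Integration.integrable_bound[OF FG])
    show "(\<lambda>x. I A x * (F x * G x)) \<in> borel_measurable lebesgue"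
      by (rule borel_measurable_times[OF Im borel_measurable_integrable[OF FG]])
  qed (auto simp: I_def indicator_def)
  have one: "(LINT x|lebesgue. I A x * (F x * G x)) = (LINT x|cell. F x * G (x + lattice_vec (s A)))" for A
  proof -
    have "(LINT x|lebesgue. I A x * (F x * G x))
      = (LINT x|lebesgue. indicator unit_cell x * (F (x + lattice_vec (s A)) * G (x + lattice_vec (s A))))"
      using integral_translation[OF borel_measurable_integrable[OF IFG[of A]], where a = "lattice_vec (s A)"]
      by (simp add: I_def)
    also have "\<dots> = (LINT x|lebesgue. indicator unit_cell x * (F x * G (x + lattice_vec (s A))))"
    proof (rule integral_cong_AE)
      have [measurable]: "G \<in> borel_measurable lebesgue" by (rule continuous_measurable_lebesgue[OF Gc])
      note [measurable] = F(1) borel_measurable_translation_lebesgue[OF F(1)] borel_measurable_translation_lebesgue[OF this]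
      show "(\<lambda>x. indicator unit_cell x * (F (x + lattice_vec (s A)) * G (x + lattice_vec (s A)))) \<in> borel_measurable lebesgue"
        "(\<lambda>x. indicator unit_cell x * (F x * G (x + lattice_vec (s A)))) \<in> borel_measurable lebesgue"
        by measurable
      show "AE x in lebesgue. indicator unit_cell x * (F (x + lattice_vec (s A)) * G (x + lattice_vec (s A)))
          = indicator unit_cell x * (F x * G (x + lattice_vec (s A)))"
        using periodic_lattice[OF F(2), of "s A"] by eventually_elim simp
    qed
    finally show ?thesis by (simp add: integral_restrict_space)
  qed
  have int: "integrable cell (\<lambda>x. F x * G (x + lattice_vec (s A)))" for A
    by (intro integrable_cell_mult_continuous F(3) continuous_on_compose2[OF Gc] continuous_intros) auto
  have "(LINT x|lebesgue. F x * G x) = (LINT x|lebesgue. (\<Sum>A\<in>Pow UNIV. I A x * (F x * G x)))"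
  proof (rule integral_cong_AE)
    show "(\<lambda>x. F x * G x) \<in> borel_measurable lebesgue" by (rule borel_measurable_integrable[OF FG])
    show "(\<lambda>x. \<Sum>A\<in>Pow UNIV. I A x * (F x * G x)) \<in> borel_measurable lebesgue"
      by (intro borel_measurable_sum borel_measurable_integrable[OF IFG])
    show "AE x in lebesgue. F x * G x = (\<Sum>A\<in>Pow UNIV. I A x * (F x * G x))"
      using AE_not_integer_coordinate
    proof eventually_elim
      case (elim x)
      have "(\<Sum>A\<in>Pow UNIV. I A x) = (\<Sum>k\<in>s ` Pow UNIV. indicator unit_cell (x - lattice_vec k))"
        by (subst sum.reindex[OF s_inj]) (simp add: I_def)
      also have "\<dots> = indicator (s ` Pow UNIV) (\<chi> i. \<lfloor>x $ i\<rfloor>)"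
        by (rule sum_indicator_unit_cell[OF elim]) simp
      finally have e: "(\<Sum>A\<in>Pow UNIV. I A x * (F x * G x)) = indicator (s ` Pow UNIV) (\<chi> i. \<lfloor>x $ i\<rfloor>) * (F x * G x)"
        by (simp add: sum_distrib_right[symmetric])
      show ?case
      proof (cases "G x = 0")
        case False
        \<comment> \<open>Where \<open>G\<close> is nonzero every coordinate lies strictly between 0
          and 2, so its floor is 0 or 1.\<close>
        have "\<lfloor>x $ i\<rfloor> = (if i \<in> {i. x $ i \<ge> 1} then 1 else 0)" for i
        proof -
          have "h i (x $ i) \<noteq> 0" using False unfolding G_def by (metis UNIV_I finite prod_zero)
          then have "0 < x $ i \<and> x $ i < 2" using supp[of "x $ i" i] by force
          then show ?thesis by (auto simp: floor_eq_iff)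
        qed
        then have "(\<chi> i. \<lfloor>x $ i\<rfloor>) = s {i. x $ i \<ge> 1}" by (simp add: s_def)
        then show ?thesis unfolding e by simp
      qed simp
    qed
  qed
  also have "\<dots> = (\<Sum>A\<in>Pow UNIV. LINT x|cell. F x * G (x + lattice_vec (s A)))"
    by (simp add: Bochner_Integration.integral_sum IFG one)
  also have "\<dots> = (LINT x|cell. (\<Sum>A\<in>Pow UNIV. F x * G (x + lattice_vec (s A))))"
    by (rule Bochner_Integration.integral_sum[symmetric]) (rule int)
  also have "\<dots> = (LINT x|cell. F x * (\<Prod>i\<in>UNIV. c i))"
  proof (rule Bochner_Integration.integral_cong[OF refl])
    fix x :: "real^'n" assume "x \<in> space cell"
    then have x: "0 < x $ i" "x $ i < 1" for i by (auto simp: space_cell unit_cell_def)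
    have "G (x + lattice_vec (s A)) = (\<Prod>i\<in>A. h i (x $ i + 1)) * (\<Prod>i\<in>UNIV - A. h i (x $ i))" for A
    proof -
      have "G (x + lattice_vec (s A)) = (\<Prod>i\<in>UNIV. if i \<in> A then h i (x $ i + 1) else h i (x $ i))"
        unfolding G_def by (intro prod.cong refl) (auto simp: s_def)
      also have "\<dots> = (\<Prod>i\<in>A. h i (x $ i + 1)) * (\<Prod>i\<in>UNIV - A. h i (x $ i))"
        by (subst prod.If_cases) (auto simp: Compl_eq_Diff_UNIV)
      finally show ?thesis .
    qed
    then have "(\<Sum>A\<in>Pow UNIV. G (x + lattice_vec (s A))) = (\<Prod>i\<in>UNIV. h i (x $ i + 1) + h i (x $ i))"
      by (subst prod_add) simp_all
    also have "\<dots> = (\<Prod>i\<in>UNIV. c i)" using sum[OF x] by (intro prod.cong refl) (simp add: add.commute)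
    finally show "(\<Sum>A\<in>Pow UNIV. F x * G (x + lattice_vec (s A))) = F x * (\<Prod>i\<in>UNIV. c i)"
      by (simp add: sum_distrib_left[symmetric])
  qed
  finally show ?thesis by (simp add: G_def mult.commute)
qed

text \<open>\<open>has_weak_partial\<close> tests only with compactly supported functions, while
  \<open>e\<close> is periodic. Multiplying \<open>e\<close> by a cutoff whose translates sum to a
  constant repairs this: where the derivative falls on the cutoff, the translates of
  \<open>h'\<close> sum to zero and the term disappears.\<close>

lemma torus_integration_by_parts:
  fixes f g e :: "real^'n \<Rightarrow> real"
  assumes w: "has_weak_partial i f g" and f: "periodic f" "integrable cell f" and g: "integrable cell g"
    and e: "smooth e" and per: "\<And>j x. e (x + axis j 1) = e x"
  shows "(LINT x|cell. f x * partial_deriv i e x) = - (LINT x|cell. g x * e x)"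
proof -
  have fm: "f \<in> borel_measurable lebesgue" and gm: "g \<in> borel_measurable lebesgue"
    using w by (auto simp: has_weak_partial_def intro: L1_loc_measurable)
  have gp: "periodic g" by (rule has_weak_partial_periodic[OF w f(1)])
  have ec: "continuous_on UNIV e" "continuous_on UNIV (partial_deriv i e)"
    using e by (auto intro: smooth_continuous smooth_partial_deriv)
  have ep: "periodic e" using per by (simp add: periodic_def)
  have dp: "periodic (partial_deriv i e)"
    by (simp add: periodic_def smooth_periodic_partial_deriv[OF e per])
  have em: "e \<in> borel_measurable lebesgue" "partial_deriv i e \<in> borel_measurable lebesgue"
    using ec by (auto intro: continuous_measurable_lebesgue)
  obtain h h' :: "real \<Rightarrow> real" and c :: real where c: "c > 0"
    and hd: "\<And>t. (h has_real_derivative h' t) (at t)" and hs: "\<And>j::'n. smooth (\<lambda>x::real^'n. h (x $ j))"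
    and h0: "\<And>t. t \<le> 0 \<or> 2 \<le> t \<Longrightarrow> h t = 0 \<and> h' t = 0"
    and hsum: "\<And>t. 0 < t \<Longrightarrow> t < 1 \<Longrightarrow> h t + h (t + 1) = c \<and> h' t + h' (t + 1) = 0"
    by (rule smooth_partition_function[where 'n = 'n]) (rule that)
  have hc: "continuous_on UNIV h"
    using DERIV_isCont[OF hd] by (simp add: continuous_on_eq_continuous_at)
  have h'c: "continuous_on UNIV h'"
  proof -
    have "continuous_on UNIV (\<lambda>x::real^'n. partial_deriv i (\<lambda>x. h (x $ i)) x)"
      by (rule smooth_continuous[OF smooth_partial_deriv[OF hs]])
    moreover have "partial_deriv i (\<lambda>x. h (x $ i)) x = h' (x $ i)" for x :: "real^'n"
      using partial_deriv_eq[OF has_derivative_component[OF hd, where i = i], where i = i] by simp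
    ultimately have "continuous_on UNIV (\<lambda>x::real^'n. h' (x $ i))" by simp
    \<comment> \<open>Restriction to the diagonal recovers continuity of the one-variable function
      \<open>h'\<close>.\<close>
    then have "continuous_on UNIV (\<lambda>t. h' ((\<chi> j. t) $ i))"
      by (rule continuous_on_compose2) (auto intro!: continuous_intros)
    then show ?thesis by simp
  qed
  define P where "P x = (\<Prod>j\<in>UNIV. h (x $ j))" for x :: "real^'n"
  define hh where "hh j = (if j = i then h' else h)" for j
  have Ps: "smooth P" unfolding P_def by (intro smooth_prod hs)
  have P_pd: "partial_deriv i P x = (\<Prod>j\<in>UNIV. hh j (x $ j))" for x
  proof -
    have "(P has_derivative (\<lambda>y. \<Sum>k\<in>UNIV. (h' (x $ k) * y $ k) * (\<Prod>j\<in>UNIV - {k}. h (x $ j)))) (at x)"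
      unfolding P_def by (intro has_derivative_prod has_derivative_component hd)
    then have "partial_deriv i P x = (\<Sum>k\<in>UNIV. (h' (x $ k) * axis i 1 $ k) * (\<Prod>j\<in>UNIV - {k}. h (x $ j)))"
      by (rule partial_deriv_eq)
    also have "\<dots> = (\<Sum>k\<in>UNIV. if k = i then h' (x $ i) * (\<Prod>j\<in>UNIV - {i}. h (x $ j)) else 0)"
      by (intro sum.cong refl) (auto simp: axis_def)
    also have "\<dots> = hh i (x $ i) * (\<Prod>j\<in>UNIV - {i}. hh j (x $ j))" by (simp add: hh_def)
    also have "\<dots> = (\<Prod>j\<in>UNIV. hh j (x $ j))" by (rule prod.remove[symmetric]) auto
    finally show ?thesis .
  qed
  define \<phi> where "\<phi> x = e x * P x" for x
  have \<phi>: "\<phi> \<in> test_functions"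
  proof (rule test_functionI)
    show "smooth \<phi>" unfolding \<phi>_def by (rule smooth_mult[OF e Ps])
    show "compact (cbox 0 (\<chi> i. 2) :: (real^'n) set)" by simp
    fix x :: "real^'n" assume "x \<notin> cbox 0 (\<chi> i. 2)"
    then obtain j where "x $ j < 0 \<or> 2 < x $ j" by (auto simp: mem_box_cart not_le)
    then have "h (x $ j) = 0" using h0[of "x $ j"] by auto
    then have "P x = 0" unfolding P_def by (intro prod_zero) auto
    then show "\<phi> x = 0" by (simp add: \<phi>_def)
  qed
  have \<phi>_pd: "partial_deriv i \<phi> x = e x * partial_deriv i P x + partial_deriv i e x * P x" for x
    unfolding \<phi>_def by (intro partial_deriv_mult smooth_differentiable e Ps)
  have unf: "(LINT x|lebesgue. (u x * v x) * (\<Prod>j\<in>UNIV. H j (x $ j))) = (\<Prod>j\<in>UNIV. C j) * (LINT x|cell. u x * v x)"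
    if "u \<in> borel_measurable lebesgue" "periodic u" "integrable cell u"
      "v \<in> borel_measurable lebesgue" "periodic v" "continuous_on UNIV v"
      "\<And>j. continuous_on UNIV (H j)" "\<And>j t. t \<le> 0 \<or> 2 \<le> t \<Longrightarrow> H j t = 0"
      "\<And>j t. 0 < t \<Longrightarrow> t < 1 \<Longrightarrow> H j t + H j (t + 1) = C j"
    for u v :: "real^'n \<Rightarrow> real" and H :: "'n \<Rightarrow> real \<Rightarrow> real" and C
    using that by (intro integral_unfold_periodic integrable_cell_mult_continuous periodic_compose2[of u v "(*)"] borel_measurable_times)
  have i1: "integrable lebesgue (\<lambda>x. (f x * e x) * (\<Prod>j\<in>UNIV. hh j (x $ j)))"
    and i2: "integrable lebesgue (\<lambda>x. (f x * partial_deriv i e x) * (\<Prod>j\<in>UNIV. h (x $ j)))"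
  proof -
    have fl: "f \<in> L1_loc" using w by (simp add: has_weak_partial_def)
    have 1: "(\<lambda>x. e x * partial_deriv i P x) x = 0" "(\<lambda>x. partial_deriv i e x * P x) x = 0"
      if x: "x \<notin> cbox 0 (\<chi> i. 2)" for x :: "real^'n"
    proof -
      obtain j where "x $ j < 0 \<or> 2 < x $ j" using x by (auto simp: mem_box_cart not_le)
      then have "h (x $ j) = 0 \<and> h' (x $ j) = 0" using h0[of "x $ j"] by auto
      then have "P x = 0" "partial_deriv i P x = 0"
        unfolding P_def P_pd[unfolded P_def] hh_def by (auto intro!: prod_zero bexI[of _ j])
      then show "(\<lambda>x. e x * partial_deriv i P x) x = 0" "(\<lambda>x. partial_deriv i e x * P x) x = 0" by auto
    qed
    have Pc: "continuous_on UNIV P" "continuous_on UNIV (partial_deriv i P)"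
      by (intro smooth_continuous Ps smooth_partial_deriv)+
    have "integrable lebesgue (\<lambda>x. f x * (e x * partial_deriv i P x))"
      by (rule L1_loc_mult_compact_support[OF fl continuous_on_mult[OF ec(1) Pc(2)] compact_cbox 1(1)])
    moreover have "integrable lebesgue (\<lambda>x. f x * (partial_deriv i e x * P x))"
      by (rule L1_loc_mult_compact_support[OF fl continuous_on_mult[OF ec(2) Pc(1)] compact_cbox 1(2)])
    ultimately show "integrable lebesgue (\<lambda>x. (f x * e x) * (\<Prod>j\<in>UNIV. hh j (x $ j)))"
      "integrable lebesgue (\<lambda>x. (f x * partial_deriv i e x) * (\<Prod>j\<in>UNIV. h (x $ j)))"
      by (simp_all add: P_pd P_def mult.assoc)
  qed
  have "(LINT x|lebesgue. f x * partial_deriv i \<phi> x)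
      = (LINT x|lebesgue. (f x * e x) * (\<Prod>j\<in>UNIV. hh j (x $ j))) +
        (LINT x|lebesgue. (f x * partial_deriv i e x) * (\<Prod>j\<in>UNIV. h (x $ j)))"
    using i1 i2 by (subst Bochner_Integration.integral_add[symmetric]) (auto simp: \<phi>_pd P_pd P_def algebra_simps)
  \<comment> \<open>In coordinate \<open>i\<close> the factor is \<open>h'\<close>, whose two
    shifted copies cancel; this entry 0 annihilates the product.\<close>
  also have "(LINT x|lebesgue. (f x * e x) * (\<Prod>j\<in>UNIV. hh j (x $ j)))
      = (\<Prod>j\<in>UNIV. if j = i then 0 else c) * (LINT x|cell. f x * e x)"
    by (rule unf) (use fm f em ep ec hc h'c h0 hsum in \<open>auto simp: hh_def\<close>)
  also have "(\<Prod>j\<in>UNIV. if j = i then 0 else c) = 0" by (intro prod_zero) auto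
  also have "(LINT x|lebesgue. (f x * partial_deriv i e x) * (\<Prod>j\<in>UNIV. h (x $ j)))
      = (\<Prod>j\<in>(UNIV::'n set). c) * (LINT x|cell. f x * partial_deriv i e x)"
    by (rule unf) (use fm f em dp ec hc h0 hsum in auto)
  finally have L: "(LINT x|lebesgue. f x * partial_deriv i \<phi> x) = c ^ CARD('n) * (LINT x|cell. f x * partial_deriv i e x)"
    by simp
  have "(LINT x|lebesgue. g x * \<phi> x) = (LINT x|lebesgue. (g x * e x) * (\<Prod>j\<in>UNIV. h (x $ j)))"
    by (simp add: \<phi>_def P_def mult.assoc)
  also have "\<dots> = (\<Prod>j\<in>(UNIV::'n set). c) * (LINT x|cell. g x * e x)"
    by (rule unf) (use gm gp g em ep ec hc h0 hsum in auto)
  finally have R: "(LINT x|lebesgue. g x * \<phi> x) = c ^ CARD('n) * (LINT x|cell. g x * e x)" by simp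
  have "(LINT x|lebesgue. f x * partial_deriv i \<phi> x) = - (LINT x|lebesgue. g x * \<phi> x)"
    using w \<phi> by (simp add: has_weak_partial_def)
  then have "c ^ CARD('n) * (LINT x|cell. f x * partial_deriv i e x) = c ^ CARD('n) * (- (LINT x|cell. g x * e x))"
    unfolding L R by simp
  moreover have "c ^ CARD('n) \<noteq> 0" using c by simp
  ultimately show ?thesis using mult_left_cancel by blast
qed

section \<open>Fourier series\<close>

definition tcos :: "int^'n \<Rightarrow> real^'n \<Rightarrow> real" where
  "tcos k x = cos (((2 * pi) *\<^sub>R lattice_vec k) \<bullet> x)"

definition tsin :: "int^'n \<Rightarrow> real^'n \<Rightarrow> real" where
  "tsin k x = sin (((2 * pi) *\<^sub>R lattice_vec k) \<bullet> x)"

lemma lattice_vec_add: "lattice_vec (k + l) = lattice_vec k + lattice_vec l"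
  and lattice_vec_diff: "lattice_vec (k - l) = lattice_vec k - lattice_vec l"
  and lattice_vec_minus: "lattice_vec (- k) = - lattice_vec k"
  and lattice_vec_0: "lattice_vec 0 = 0"
  by (simp_all add: vec_eq_iff)

lemma tcos_0 [simp]: "tcos 0 x = 1" and tsin_0 [simp]: "tsin 0 x = 0"
  and tcos_minus [simp]: "tcos (- k) x = tcos k x" and tsin_minus [simp]: "tsin (- k) x = - tsin k x"
  by (simp_all add: tcos_def tsin_def lattice_vec_0 lattice_vec_minus)

lemma tcos_tcos: "tcos k x * tcos l x = (tcos (k - l) x + tcos (k + l) x) / 2"
  and tsin_tsin: "tsin k x * tsin l x = (tcos (k - l) x - tcos (k + l) x) / 2"
  and tsin_tcos: "tsin k x * tcos l x = (tsin (k + l) x + tsin (k - l) x) / 2"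
  by (simp_all add: tcos_def tsin_def lattice_vec_add lattice_vec_diff inner_add_left inner_diff_left
      scaleR_add_right scaleR_diff_right cos_times_cos sin_times_sin sin_times_cos)

lemma smooth_tcos: "smooth (tcos k)" and smooth_tsin: "smooth (tsin k)"
  unfolding tcos_def[abs_def] tsin_def[abs_def] by (rule smooth_cos smooth_sin)+

lemma partial_deriv_tcos: "partial_deriv i (tcos k) x = - (2 * pi * of_int (k $ i)) * tsin k x"
  and partial_deriv_tsin: "partial_deriv i (tsin k) x = (2 * pi * of_int (k $ i)) * tcos k x"
  unfolding tcos_def[abs_def] tsin_def[abs_def] by (simp_all add: partial_deriv_cos partial_deriv_sin del: inner_scaleR_left)

lemma cos_sin_add_int_2pi:
  fixes m :: int
  shows "cos (x + 2 * pi * of_int m) = cos x" "sin (x + 2 * pi * of_int m) = sin x"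
  by (simp_all add: cos_add sin_add)

lemma tcos_periodic: "tcos k (x + axis j 1) = tcos k x"
  and tsin_periodic: "tsin k (x + axis j 1) = tsin k x"
  using cos_sin_add_int_2pi[of "((2 * pi) *\<^sub>R lattice_vec k) \<bullet> x" "k $ j"]
  by (simp_all add: tcos_def tsin_def inner_add_right inner_axis)

lemma tcos_bound: "\<bar>tcos k x\<bar> \<le> 1" and tsin_bound: "\<bar>tsin k x\<bar> \<le> 1"
  by (simp_all add: tcos_def tsin_def)

lemma measurable_tcos: "tcos k \<in> borel_measurable cell" and measurable_tsin: "tsin k \<in> borel_measurable cell"
  by (auto intro!: measurable_cell continuous_measurable_lebesgue smooth_continuous smooth_tcos smooth_tsin)

lemma sq_integrable_tcos: "sq_integrable cell (tcos k)" and sq_integrable_tsin: "sq_integrable cell (tsin k)"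
  by (auto intro!: cell.sq_integrable_bounded[where C = 1] measurable_tcos measurable_tsin AE_I2 tcos_bound tsin_bound)

section \<open>Fourier coefficients\<close>

definition fcos :: "(real^'n \<Rightarrow> real) \<Rightarrow> int^'n \<Rightarrow> real" where
  "fcos f k = (LINT x|cell. f x * tcos k x)"

definition fsin :: "(real^'n \<Rightarrow> real) \<Rightarrow> int^'n \<Rightarrow> real" where
  "fsin f k = (LINT x|cell. f x * tsin k x)"

lemma integrable_fcos: "sq_integrable cell f \<Longrightarrow> integrable cell (\<lambda>x. f x * tcos k x)"
  and integrable_fsin: "sq_integrable cell f \<Longrightarrow> integrable cell (\<lambda>x. f x * tsin k x)"
  by (rule sq_integrable_mult; simp add: sq_integrable_tcos sq_integrable_tsin)+

lemma fcos_add: "sq_integrable cell f \<Longrightarrow> sq_integrable cell g \<Longrightarrow> fcos (\<lambda>x. f x + g x) k = fcos f k + fcos g k"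
  and fsin_add: "sq_integrable cell f \<Longrightarrow> sq_integrable cell g \<Longrightarrow> fsin (\<lambda>x. f x + g x) k = fsin f k + fsin g k"
  by (simp_all add: fcos_def fsin_def distrib_right integrable_fcos integrable_fsin)

lemma fcos_cmult: "fcos (\<lambda>x. c * f x) k = c * fcos f k"
  and fsin_cmult: "fsin (\<lambda>x. c * f x) k = c * fsin f k"
  by (simp_all add: fcos_def fsin_def mult.assoc)

lemma fcos_diff: "sq_integrable cell f \<Longrightarrow> sq_integrable cell g \<Longrightarrow> fcos (\<lambda>x. f x - g x) k = fcos f k - fcos g k"
  and fsin_diff: "sq_integrable cell f \<Longrightarrow> sq_integrable cell g \<Longrightarrow> fsin (\<lambda>x. f x - g x) k = fsin f k - fsin g k"
  by (simp_all add: fcos_def fsin_def left_diff_distrib integrable_fcos integrable_fsin)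

lemma fcos_sum: "(\<And>i. i \<in> I \<Longrightarrow> sq_integrable cell (f i)) \<Longrightarrow> fcos (\<lambda>x. \<Sum>i\<in>I. f i x) k = (\<Sum>i\<in>I. fcos (f i) k)"
  and fsin_sum: "(\<And>i. i \<in> I \<Longrightarrow> sq_integrable cell (f i)) \<Longrightarrow> fsin (\<lambda>x. \<Sum>i\<in>I. f i x) k = (\<Sum>i\<in>I. fsin (f i) k)"
  by (simp_all add: fcos_def fsin_def sum_distrib_right Bochner_Integration.integral_sum integrable_fcos integrable_fsin)

lemma fcos_minus [simp]: "fcos f (- k) = fcos f k" and fsin_minus [simp]: "fsin f (- k) = - fsin f k"
  and fsin_0 [simp]: "fsin f 0 = 0"
  by (simp_all add: fcos_def fsin_def)

text \<open>Integration by parts against \<open>tcos k\<close> and \<open>tsin k\<close>, whose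
  derivatives are multiples of each other.\<close>

lemma fourier_weak_partial:
  fixes f g :: "real^'n \<Rightarrow> real"
  assumes "has_weak_partial i f g" "f \<in> L2_per" "g \<in> L2_per"
  shows "fcos g k = 2 * pi * of_int (k $ i) * fsin f k" "fsin g k = - (2 * pi * of_int (k $ i)) * fcos f k"
proof -
  have f: "periodic f" "integrable cell f" and g: "integrable cell g"
    using assms by (auto simp: L2_per_iff intro: cell.sq_integrable_integrable)
  have "- fcos g k = (LINT x|cell. f x * partial_deriv i (tcos k) x)"
    unfolding fcos_def by (subst torus_integration_by_parts[OF assms(1) f g smooth_tcos tcos_periodic]) simp
  also have "\<dots> = (LINT x|cell. - (2 * pi * of_int (k $ i)) * (f x * tsin k x))"
    by (simp add: partial_deriv_tcos mult.left_commute)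
  also have "\<dots> = - (2 * pi * of_int (k $ i)) * fsin f k" unfolding fsin_def by (rule integral_mult_right_zero)
  finally show "fcos g k = 2 * pi * of_int (k $ i) * fsin f k" by simp
  have "- fsin g k = (LINT x|cell. f x * partial_deriv i (tsin k) x)"
    unfolding fsin_def by (subst torus_integration_by_parts[OF assms(1) f g smooth_tsin tsin_periodic]) simp
  also have "\<dots> = (LINT x|cell. (2 * pi * of_int (k $ i)) * (f x * tcos k x))"
    by (simp add: partial_deriv_tsin mult.left_commute)
  also have "\<dots> = (2 * pi * of_int (k $ i)) * fcos f k" unfolding fcos_def by (rule integral_mult_right_zero)
  finally show "fsin g k = - (2 * pi * of_int (k $ i)) * fcos f k" by simp
qed

text \<open>No explicit integration: the constant 1 has weak derivative 0, so by
  \<open>fourier_weak_partial\<close> its coefficients at \<open>k \<noteq> 0\<close>, multiplied by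
  a nonzero entry of \<open>k\<close>, vanish.\<close>

lemma integral_tcos: "(LINT x|cell. tcos k x) = (if k = 0 then 1 else 0)"
  and integral_tsin: "(LINT x|cell. tsin k x) = 0" for k :: "int^'n"
proof -
  have "(LINT x|cell. tcos k x) = 0 \<and> (LINT x|cell. tsin k x) = 0" if k: "k \<noteq> 0"
  proof -
    obtain i where i: "k $ i \<noteq> 0" using k by (auto simp: vec_eq_iff)
    have "has_weak_partial i (\<lambda>x::real^'n. 1) (\<lambda>x. 0)"
    proof -
      have "partial_deriv i (\<lambda>x::real^'n. 1) = (\<lambda>x. 0)"
        by (rule ext, subst partial_deriv_eq[OF has_derivative_const]) simp
      then show ?thesis using has_weak_partial_smooth[OF smooth_const, of i 1] by simp
    qed
    moreover have "(\<lambda>x::real^'n. 1) \<in> L2_per" "(\<lambda>x::real^'n. 0) \<in> L2_per"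
      by (auto simp: L2_per_iff periodic_def cell.sq_integrable_const)
    ultimately have "fcos (\<lambda>x. 0) k = 2 * pi * of_int (k $ i) * fsin (\<lambda>x. 1) k"
      "fsin (\<lambda>x. 0) k = - (2 * pi * of_int (k $ i)) * fcos (\<lambda>x. 1) k"
      by (rule fourier_weak_partial)+
    then show ?thesis using i by (simp add: fcos_def fsin_def)
  qed
  moreover have "measure cell (unit_cell :: (real^'n) set) = 1"
    using measure_cell unfolding space_cell .
  ultimately show "(LINT x|cell. tcos k x) = (if k = 0 then 1 else 0)" "(LINT x|cell. tsin k x) = 0"
    by (cases "k = 0"; simp add: space_cell)+
qed

lemma
  fixes k l :: "int^'n"
  shows fourier_tcos_cos: "fcos (tcos k) l = ((if k = l then 1 else 0) + (if k = - l then 1 else 0)) / 2"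
  and fourier_tsin_cos: "fcos (tsin k) l = 0"
  and fourier_tcos_sin: "fsin (tcos k) l = 0"
  and fourier_tsin: "fsin (tsin k) l = ((if k = l then 1 else 0) - (if k = - l then 1 else 0)) / 2"
proof -
  have i: "integrable cell (tcos k)" "integrable cell (tsin k)" for k :: "int^'n"
    by (auto intro: cell.sq_integrable_integrable sq_integrable_tcos sq_integrable_tsin)
  have m: "k + l = 0 \<longleftrightarrow> k = - l" by (metis add_eq_0_iff2)
  have "fcos (tcos k) l = ((LINT x|cell. tcos (k - l) x) + (LINT x|cell. tcos (k + l) x)) / 2"
    unfolding fcos_def tcos_tcos using i by simp
  then show "fcos (tcos k) l = ((if k = l then 1 else 0) + (if k = - l then 1 else 0)) / 2"
    unfolding integral_tcos m by simp
  have "fsin (tsin k) l = ((LINT x|cell. tcos (k - l) x) - (LINT x|cell. tcos (k + l) x)) / 2"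
    unfolding fsin_def tsin_tsin using i by simp
  then show "fsin (tsin k) l = ((if k = l then 1 else 0) - (if k = - l then 1 else 0)) / 2"
    unfolding integral_tcos m by simp
  show "fcos (tsin k) l = 0"
    unfolding fcos_def tsin_tcos using i by (simp add: integral_tsin)
  have "fsin (tcos k) l = (LINT x|cell. tsin l x * tcos k x)" by (simp add: fsin_def mult.commute)
  also have "\<dots> = 0" unfolding tsin_tcos using i by (simp add: integral_tsin)
  finally show "fsin (tcos k) l = 0" .
qed

section \<open>Partial sums and the Bessel identity\<close>

definition freq_box :: "nat \<Rightarrow> (int^'n) set" where
  "freq_box N = {k. \<forall>i. \<bar>k $ i\<bar> \<le> int N}"

lemma finite_freq_box: "finite (freq_box N :: (int^'n) set)"
proof -
  have "finite {f :: 'n \<Rightarrow> int. \<forall>i. f i \<in> {- int N..int N}}"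
    using finite_PiE[of "UNIV :: 'n set" "\<lambda>_. {- int N..int N}"] by (simp add: PiE_def Pi_def)
  then have "finite (vec_nth -` {f :: 'n \<Rightarrow> int. \<forall>i. f i \<in> {- int N..int N}})"
    by (rule finite_vimageI) (simp add: inj_on_def vec_nth_inject)
  moreover have "(freq_box N :: (int^'n) set) = vec_nth -` {f. \<forall>i. f i \<in> {- int N..int N}}"
  proof -
    have "z \<in> {- int N..int N} \<longleftrightarrow> \<bar>z\<bar> \<le> int N" for z by auto
    then show ?thesis by (simp only: freq_box_def vimage_def mem_Collect_eq)
  qed
  ultimately show ?thesis by simp
qed

lemma freq_box_minus [simp]: "- k \<in> freq_box N \<longleftrightarrow> k \<in> freq_box N"
  by (simp add: freq_box_def)

lemma freq_box_mono: "M \<le> N \<Longrightarrow> freq_box M \<subseteq> freq_box N"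
  unfolding freq_box_def by (safe, drule_tac x = i in spec) linarith

lemma freq_box_exhaust: "\<exists>N. k \<in> freq_box N"
proof -
  have "\<bar>k $ i\<bar> \<le> int (nat (\<Sum>i\<in>UNIV. \<bar>k $ i\<bar>))" for i
    using member_le_sum[of i UNIV "\<lambda>i. \<bar>k $ i\<bar>"] by (simp add: sum_nonneg)
  then show ?thesis unfolding freq_box_def by blast
qed

text \<open>The sum runs over a symmetric box, so every nonzero frequency occurs together with its
  negative and contributes twice. This makes up for the value 1 / 2 of the squared norms of cosine
  and sine, and frequency 0 needs no special treatment.\<close>

definition fsum :: "nat \<Rightarrow> (real^'n \<Rightarrow> real) \<Rightarrow> real^'n \<Rightarrow> real" where
  "fsum N f x = (\<Sum>k\<in>freq_box N. fcos f k * tcos k x + fsin f k * tsin k x)"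

lemma sq_integrable_fsum: "sq_integrable cell (fsum N f)"
  unfolding fsum_def[abs_def]
  by (intro sq_integrable_sum sq_integrable_add sq_integrable_cmult sq_integrable_tcos sq_integrable_tsin)

lemma fourier_fsum:
  fixes l :: "int^'n"
  assumes "l \<in> freq_box N"
  shows "fcos (fsum N f) l = fcos f l" "fsin (fsum N f) l = fsin f l"
proof -
  have sq: "sq_integrable cell (\<lambda>x. fcos f k * tcos k x + fsin f k * tsin k x)" for k
    by (intro sq_integrable_add sq_integrable_cmult sq_integrable_tcos sq_integrable_tsin)
  have d: "(\<Sum>k\<in>freq_box N. g k * (if k = l then 1 else 0)) = g l"
    "(\<Sum>k\<in>freq_box N. g k * (if k = - l then 1 else 0)) = g (- l)" for g :: "int^'n \<Rightarrow> real"
    using assms by (simp_all add: if_distrib finite_freq_box cong: if_cong)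
  have "fcos (fsum N f) l = (\<Sum>k\<in>freq_box N. fcos f k * fcos (tcos k) l + fsin f k * fcos (tsin k) l)"
    unfolding fsum_def[abs_def]
    by (simp add: fcos_sum[OF sq] fcos_add fcos_cmult sq_integrable_cmult sq_integrable_tcos sq_integrable_tsin)
  also have "\<dots> = (\<Sum>k\<in>freq_box N. (fcos f k * (if k = l then 1 else 0) + fcos f k * (if k = - l then 1 else 0)) / 2)"
    by (intro sum.cong refl) (simp add: fourier_tcos_cos fourier_tsin_cos algebra_simps)
  also have "\<dots> = fcos f l" by (simp only: sum_divide_distrib[symmetric] sum.distrib d) simp
  finally show "fcos (fsum N f) l = fcos f l" .
  have "fsin (fsum N f) l = (\<Sum>k\<in>freq_box N. fcos f k * fsin (tcos k) l + fsin f k * fsin (tsin k) l)"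
    unfolding fsum_def[abs_def]
    by (simp add: fsin_sum[OF sq] fsin_add fsin_cmult sq_integrable_cmult sq_integrable_tcos sq_integrable_tsin)
  also have "\<dots> = (\<Sum>k\<in>freq_box N. (fsin f k * (if k = l then 1 else 0) - fsin f k * (if k = - l then 1 else 0)) / 2)"
    by (intro sum.cong refl) (simp add: fourier_tsin fourier_tcos_sin algebra_simps)
  also have "\<dots> = fsin f l" by (simp only: sum_divide_distrib[symmetric] sum_subtractf d) simp
  finally show "fsin (fsum N f) l = fsin f l" .
qed

lemma integral_fsum_mult:
  assumes "sq_integrable cell g"
  shows "(LINT x|cell. fsum N f x * g x) = (\<Sum>k\<in>freq_box N. fcos f k * fcos g k + fsin f k * fsin g k)"
proof -
  have "(LINT x|cell. fsum N f x * g x)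
      = (LINT x|cell. (\<Sum>k\<in>freq_box N. fcos f k * (g x * tcos k x) + fsin f k * (g x * tsin k x)))"
    unfolding fsum_def
    by (intro Bochner_Integration.integral_cong refl, simp only: sum_distrib_right, intro sum.cong refl)
      (simp add: algebra_simps)
  also have "\<dots> = (\<Sum>k\<in>freq_box N. fcos f k * fcos g k + fsin f k * fsin g k)"
    using assms by (simp add: Bochner_Integration.integral_sum integrable_fcos integrable_fsin fcos_def fsin_def)
  finally show ?thesis .
qed

definition energy :: "nat \<Rightarrow> (real^'n \<Rightarrow> real) \<Rightarrow> real" where
  "energy N f = (\<Sum>k\<in>freq_box N. (fcos f k)\<^sup>2 + (fsin f k)\<^sup>2)"

lemma integral_diff_square:
  assumes "sq_integrable M f" "sq_integrable M g"
  shows "(LINT x|M. (f x - g x)\<^sup>2) = (LINT x|M. (f x)\<^sup>2) - 2 * (LINT x|M. f x * g x) + (LINT x|M. (g x)\<^sup>2)"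
proof -
  have "(LINT x|M. (f x - g x)\<^sup>2) = (LINT x|M. (f x)\<^sup>2 - 2 * (f x * g x) + (g x)\<^sup>2)"
    by (simp add: power2_diff algebra_simps)
  then show ?thesis using assms by (simp add: sq_integrable_square sq_integrable_mult)
qed

lemma integral_fsum_fsum:
  assumes "M \<le> N"
  shows "(LINT x|cell. fsum M f x * fsum N f x) = energy M f"
  unfolding integral_fsum_mult[OF sq_integrable_fsum] energy_def
  by (intro sum.cong refl) (simp add: power2_eq_square fourier_fsum subsetD[OF freq_box_mono[OF assms]])

lemma integral_fsum_diff:
  assumes "M \<le> N"
  shows "(LINT x|cell. (fsum M f x - fsum N f x)\<^sup>2) = energy N f - energy M f"
  using integral_fsum_fsum[OF assms, of f] integral_fsum_fsum[of M M f] integral_fsum_fsum[of N N f]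
  by (simp add: integral_diff_square sq_integrable_fsum power2_eq_square[symmetric])

lemma energy_mono: "M \<le> N \<Longrightarrow> energy M f \<le> energy N f"
  unfolding energy_def by (intro sum_mono2 finite_freq_box freq_box_mono) auto

lemma Bessel_identity:
  assumes "sq_integrable cell f"
  shows "(LINT x|cell. (fsum N f x - f x)\<^sup>2) = (LINT x|cell. (f x)\<^sup>2) - energy N f"
  using integral_fsum_fsum[of N N f] integral_fsum_mult[OF assms, of N f]
  by (simp add: integral_diff_square sq_integrable_fsum assms power2_eq_square[symmetric] energy_def)

text \<open>Completeness of the trigonometric system: the functions with vanishing Fourier coefficients
  are stable under multiplication by trigonometric polynomials, hence (by Weierstrass) by indicator
  functions of arcs and of boxes.\<close>

definition fourier_null :: "(real^'n \<Rightarrow> real) set" where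
  "fourier_null = {f. sq_integrable cell f \<and> (\<forall>k. fcos f k = 0 \<and> fsin f k = 0)}"

definition null_multiplier :: "(real^'n \<Rightarrow> real) set" where
  "null_multiplier = {w. w \<in> borel_measurable cell \<and> (\<exists>C. \<forall>x. \<bar>w x\<bar> \<le> C) \<and>
     (\<forall>f\<in>fourier_null. (\<lambda>x. w x * f x) \<in> fourier_null)}"

lemma null_multiplier_sq_integrable:
  assumes "w \<in> borel_measurable cell" "\<And>x. \<bar>w x\<bar> \<le> C" "sq_integrable cell f"
  shows "sq_integrable cell (\<lambda>x. w x * f x)"
  by (rule sq_integrable_mult_bounded[OF assms(3,1), of C]) (simp add: assms(2))

lemma null_multiplier_mult:
  assumes w: "w \<in> null_multiplier" and v: "v \<in> null_multiplier"
  shows "(\<lambda>x. w x * v x) \<in> null_multiplier"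
proof -
  obtain C D where C: "\<And>x. \<bar>w x\<bar> \<le> C" and D: "\<And>x. \<bar>v x\<bar> \<le> D"
    using assms by (auto simp: null_multiplier_def)
  have "\<bar>w x * v x\<bar> \<le> C * D" for x
    unfolding abs_mult using C[of x] D[of x] by (intro mult_mono) auto
  moreover have "(\<lambda>x. w x * v x * f x) \<in> fourier_null" if "f \<in> fourier_null" for f
  proof -
    have "(\<lambda>x. v x * f x) \<in> fourier_null" using v that by (simp add: null_multiplier_def)
    then have "(\<lambda>x. w x * (v x * f x)) \<in> fourier_null" using w by (simp add: null_multiplier_def)
    then show ?thesis by (simp add: mult.assoc)
  qed
  ultimately show ?thesis using assms by (auto simp: null_multiplier_def)
qed

lemma null_multiplier_cmult:
  assumes w: "w \<in> null_multiplier"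
  shows "(\<lambda>x. c * w x) \<in> null_multiplier"
proof -
  obtain C where C: "\<And>x. \<bar>w x\<bar> \<le> C" using assms by (auto simp: null_multiplier_def)
  have "\<bar>c * w x\<bar> \<le> \<bar>c\<bar> * C" for x
    unfolding abs_mult using C[of x] by (intro mult_left_mono) auto
  moreover have "(\<lambda>x. c * w x * f x) \<in> fourier_null" if "f \<in> fourier_null" for f
  proof -
    have "(\<lambda>x. w x * f x) \<in> fourier_null" using w that by (simp add: null_multiplier_def)
    then show ?thesis
      by (simp add: fourier_null_def mult.assoc fcos_cmult fsin_cmult sq_integrable_cmult)
  qed
  ultimately show ?thesis using assms by (auto simp: null_multiplier_def)
qed

lemma null_multiplier_add:
  assumes w: "w \<in> null_multiplier" and v: "v \<in> null_multiplier"
  shows "(\<lambda>x. w x + v x) \<in> null_multiplier"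
proof -
  obtain C D where C: "\<And>x. \<bar>w x\<bar> \<le> C" and D: "\<And>x. \<bar>v x\<bar> \<le> D"
    using assms by (auto simp: null_multiplier_def)
  have "\<bar>w x + v x\<bar> \<le> C + D" for x
    using C[of x] D[of x] by linarith
  moreover have "(\<lambda>x. (w x + v x) * f x) \<in> fourier_null" if "f \<in> fourier_null" for f
  proof -
    have "(\<lambda>x. w x * f x) \<in> fourier_null" "(\<lambda>x. v x * f x) \<in> fourier_null"
      using assms that by (simp_all add: null_multiplier_def)
    then show ?thesis
      by (simp add: fourier_null_def distrib_right fcos_add fsin_add sq_integrable_add)
  qed
  ultimately show ?thesis using assms by (auto simp: null_multiplier_def)
qed

text \<open>By the product formulas, the coefficients of a product of \<open>f\<close> with
  \<open>tcos l\<close> or \<open>tsin l\<close> are, up to signs, averages of coefficients of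
  \<open>f\<close> at the sum and the difference of the two frequencies.\<close>

lemma null_multiplier_tcos: "tcos l \<in> null_multiplier"
  and null_multiplier_tsin: "tsin l \<in> null_multiplier"
proof -
  have *: "(\<lambda>x. tcos l x * f x) \<in> fourier_null \<and> (\<lambda>x. tsin l x * f x) \<in> fourier_null"
    if "f \<in> fourier_null" for f
  proof -
    have f: "sq_integrable cell f" and z: "\<And>k. fcos f k = 0" "\<And>k. fsin f k = 0"
      using that by (auto simp: fourier_null_def)
    note i = integrable_fcos[OF f] integrable_fsin[OF f]
    have e: "tcos l x * f x * tcos k x = (f x * tcos (l - k) x + f x * tcos (l + k) x) / 2"
      "tcos l x * f x * tsin k x = (f x * tsin (k + l) x + f x * tsin (k - l) x) / 2"
      "tsin l x * f x * tcos k x = (f x * tsin (l + k) x + f x * tsin (l - k) x) / 2"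
      "tsin l x * f x * tsin k x = (f x * tcos (l - k) x - f x * tcos (l + k) x) / 2" for k x
    proof -
      have "tcos l x * f x * tcos k x = f x * (tcos l x * tcos k x)"
        "tcos l x * f x * tsin k x = f x * (tsin k x * tcos l x)"
        "tsin l x * f x * tcos k x = f x * (tsin l x * tcos k x)"
        "tsin l x * f x * tsin k x = f x * (tsin l x * tsin k x)" by simp_all
      then show "tcos l x * f x * tcos k x = (f x * tcos (l - k) x + f x * tcos (l + k) x) / 2"
        "tcos l x * f x * tsin k x = (f x * tsin (k + l) x + f x * tsin (k - l) x) / 2"
        "tsin l x * f x * tcos k x = (f x * tsin (l + k) x + f x * tsin (l - k) x) / 2"
        "tsin l x * f x * tsin k x = (f x * tcos (l - k) x - f x * tcos (l + k) x) / 2"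
        unfolding tcos_tcos tsin_tsin tsin_tcos by (simp_all only: distrib_left right_diff_distrib times_divide_eq_right)
    qed
    have "fcos (\<lambda>x. tcos l x * f x) k = 0" "fsin (\<lambda>x. tcos l x * f x) k = 0"
      "fcos (\<lambda>x. tsin l x * f x) k = 0" "fsin (\<lambda>x. tsin l x * f x) k = 0" for k
      unfolding fcos_def[of "\<lambda>x. tcos l x * f x"] fsin_def[of "\<lambda>x. tcos l x * f x"]
        fcos_def[of "\<lambda>x. tsin l x * f x"] fsin_def[of "\<lambda>x. tsin l x * f x"] e
      using z[unfolded fcos_def fsin_def] by (simp_all add: i)
    moreover have "sq_integrable cell (\<lambda>x. tcos l x * f x)" "sq_integrable cell (\<lambda>x. tsin l x * f x)"
      by (intro null_multiplier_sq_integrable[OF _ _ f, where C = 1] measurable_tcos measurable_tsin tcos_bound tsin_bound)+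
    ultimately show ?thesis by (simp add: fourier_null_def)
  qed
  then show "tcos l \<in> null_multiplier" "tsin l \<in> null_multiplier"
    unfolding null_multiplier_def using measurable_tcos measurable_tsin tcos_bound tsin_bound by blast+
qed

lemma null_multiplier_const: "(\<lambda>x. c) \<in> null_multiplier"
  using null_multiplier_cmult[OF null_multiplier_tcos[of 0], of c] by simp

lemma null_multiplier_sum:
  "(\<And>i. i \<in> I \<Longrightarrow> w i \<in> null_multiplier) \<Longrightarrow> (\<lambda>x. \<Sum>i\<in>I. w i x) \<in> null_multiplier"
  by (induction I rule: infinite_finite_induct) (auto intro: null_multiplier_add null_multiplier_const)

lemma null_multiplier_prod:
  "(\<And>i. i \<in> I \<Longrightarrow> w i \<in> null_multiplier) \<Longrightarrow> (\<lambda>x. \<Prod>i\<in>I. w i x) \<in> null_multiplier"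
  by (induction I rule: infinite_finite_induct) (auto intro: null_multiplier_mult null_multiplier_const)

lemma null_multiplier_power:
  "w \<in> null_multiplier \<Longrightarrow> (\<lambda>x. w x ^ n) \<in> null_multiplier"
  by (induction n) (auto intro: null_multiplier_mult null_multiplier_const)

text \<open>Dominated convergence carries the vanishing of each coefficient to the limit, with
  \<open>C\<close> times the absolute value of \<open>f\<close> as majorant.\<close>

lemma null_multiplier_limit:
  assumes v: "\<And>n. v n \<in> null_multiplier" and bd: "\<And>n x. \<bar>v n x\<bar> \<le> C"
    and lim: "\<And>x. (\<lambda>n. v n x) \<longlonglongrightarrow> w x"
  shows "w \<in> null_multiplier"
proof -
  have vm: "v n \<in> borel_measurable cell" for n using v[of n] by (simp add: null_multiplier_def)
  have wm: "w \<in> borel_measurable cell" by (rule borel_measurable_LIMSEQ_real[OF lim vm])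
  have wb: "\<bar>w x\<bar> \<le> C" for x
    by (rule LIMSEQ_le_const2[OF tendsto_rabs[OF lim]]) (use bd in auto)
  have "(\<lambda>x. w x * f x) \<in> fourier_null" if f: "f \<in> fourier_null" for f
  proof -
    have sf: "sq_integrable cell f" using f by (simp add: fourier_null_def)
    have key: "(LINT x|cell. w x * f x * e x) = 0"
      if e: "e \<in> borel_measurable cell" "\<And>x. \<bar>e x\<bar> \<le> 1" and z: "\<And>n. (LINT x|cell. v n x * f x * e x) = 0" for e
    proof -
      have "(\<lambda>n. LINT x|cell. v n x * f x * e x) \<longlonglongrightarrow> (LINT x|cell. w x * f x * e x)"
      proof (rule integral_dominated_convergence[where w = "\<lambda>x. C * \<bar>f x\<bar>"])
        show "integrable cell (\<lambda>x. C * \<bar>f x\<bar>)" using cell.sq_integrable_integrable[OF sf] by simp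
        show "AE x in cell. (\<lambda>n. v n x * f x * e x) \<longlonglongrightarrow> w x * f x * e x"
          by (intro AE_I2 tendsto_mult tendsto_const lim)
        show "AE x in cell. norm (v n x * f x * e x) \<le> C * \<bar>f x\<bar>" for n
        proof (rule AE_I2)
          fix x
          have "\<bar>v n x\<bar> * \<bar>f x\<bar> * \<bar>e x\<bar> \<le> C * \<bar>f x\<bar> * 1"
            using bd[of n x] e(2)[of x] by (intro mult_mono mult_right_mono) auto
          then show "norm (v n x * f x * e x) \<le> C * \<bar>f x\<bar>" by (simp add: abs_mult)
        qed
        show "(\<lambda>x. w x * f x * e x) \<in> borel_measurable cell" "(\<lambda>x. v n x * f x * e x) \<in> borel_measurable cell" for n
          by (intro borel_measurable_times wm vm e(1) sq_integrable_measurable[OF sf])+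
      qed
      then show ?thesis unfolding z using LIMSEQ_unique[OF _ tendsto_const] by blast
    qed
    have vf: "(\<lambda>x. v n x * f x) \<in> fourier_null" for n using v[of n] f by (simp add: null_multiplier_def)
    have "fcos (\<lambda>x. w x * f x) k = 0" for k
      unfolding fcos_def using vf by (intro key measurable_tcos tcos_bound) (auto simp: fourier_null_def fcos_def)
    moreover have "fsin (\<lambda>x. w x * f x) k = 0" for k
      unfolding fsin_def using vf by (intro key measurable_tsin tsin_bound) (auto simp: fourier_null_def fsin_def)
    ultimately show ?thesis
      by (simp add: fourier_null_def null_multiplier_sq_integrable[OF wm wb sf])
  qed
  then show ?thesis using wm wb by (auto simp: null_multiplier_def)
qed

text \<open>A trigonometric polynomial with values between 0 and 1 that peaks at
  \<open>x $ i = m\<close> and decreases with the distance from \<open>m\<close> on the circle. Its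
  superlevel sets are arcs, which is how indicators of intervals are reached.\<close>

definition cosbump :: "'n \<Rightarrow> real \<Rightarrow> real^'n \<Rightarrow> real" where
  "cosbump i m x = (1 + cos (2 * pi * (x $ i - m))) / 2"

lemma cosbump_bounds: "0 \<le> cosbump i m x" "cosbump i m x \<le> 1"
proof -
  have "0 \<le> 1 + cos y" for y :: real using cos_ge_minus_one[of y] by linarith
  then show "0 \<le> cosbump i m x" "cosbump i m x \<le> 1" by (simp_all add: cosbump_def)
qed

lemma null_multiplier_arc: "cosbump i m \<in> null_multiplier"
proof -
  have l: "lattice_vec (axis i 1) = axis i 1" by (simp add: vec_eq_iff axis_def)
  have "cosbump i m = (\<lambda>x. 1 / 2 + (cos (2 * pi * m) / 2 * tcos (axis i 1) x + sin (2 * pi * m) / 2 * tsin (axis i 1) x))"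
  proof
    fix x
    have "cos (2 * pi * (x $ i - m)) = cos (2 * pi * m) * tcos (axis i 1) x + sin (2 * pi * m) * tsin (axis i 1) x"
    proof -
      have "2 * pi * (x $ i - m) = 2 * pi * x $ i - 2 * pi * m" by (simp add: right_diff_distrib)
      then show ?thesis by (simp add: tcos_def tsin_def l inner_axis' cos_diff)
    qed
    then show "cosbump i m x = 1 / 2 + (cos (2 * pi * m) / 2 * tcos (axis i 1) x + sin (2 * pi * m) / 2 * tsin (axis i 1) x)"
      by (simp add: cosbump_def field_simps)
  qed
  also have "\<dots> \<in> null_multiplier"
    by (intro null_multiplier_add null_multiplier_const null_multiplier_cmult null_multiplier_tcos null_multiplier_tsin)
  finally show ?thesis .
qed

text \<open>Multipliers are closed under sums and products, so Bernstein polynomials in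
  \<open>cosbump\<close> are multipliers. They converge uniformly to the composition with
  \<open>q\<close>.\<close>

lemma null_multiplier_continuous_arc:
  assumes q: "continuous_on {0..1} q"
  shows "(\<lambda>x. q (cosbump i m x)) \<in> null_multiplier"
proof -
  have "\<exists>N. \<forall>t\<in>{0..1}. \<bar>q t - (\<Sum>k\<le>N. q (k / N) * Bernstein N k t)\<bar> < 1 / real (Suc n)" for n
    using Bernstein_Weierstrass[OF q, of "1 / real (Suc n)"] by fastforce
  then obtain N where N: "\<And>n t. t \<in> {0..1} \<Longrightarrow>
      \<bar>q t - (\<Sum>k\<le>N n. q (k / N n) * Bernstein (N n) k t)\<bar> < 1 / real (Suc n)" by metis
  have "compact (q ` {0..1})" by (rule compact_continuous_image[OF q]) simp
  then obtain C where C: "\<And>t. t \<in> {0..1} \<Longrightarrow> \<bar>q t\<bar> \<le> C"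
    using compact_imp_bounded[of "q ` {0..1}"] by (auto simp: bounded_iff simp del: atLeastAtMost_iff)
  define v where "v n x = (\<Sum>k\<le>N n. q (k / N n) * Bernstein (N n) k (cosbump i m x))" for n x
  have arc: "cosbump i m x \<in> {0..1}" for x using cosbump_bounds by auto
  have d: "\<bar>v n x - q (cosbump i m x)\<bar> < 1 / real (Suc n)" for n x
    unfolding v_def using N[OF arc] by (simp add: abs_minus_commute)
  show ?thesis
  proof (rule null_multiplier_limit)
    have "(\<lambda>x. 1 - cosbump i m x) \<in> null_multiplier"
      using null_multiplier_add[OF null_multiplier_const[of 1] null_multiplier_cmult[OF null_multiplier_arc, of "-1"]]
      by simp
    then show "v n \<in> null_multiplier" for n
      unfolding v_def[abs_def] Bernstein_def
      by (intro null_multiplier_sum null_multiplier_mult null_multiplier_const null_multiplier_power null_multiplier_arc)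
    show "\<bar>v n x\<bar> \<le> C + 1" for n x
    proof -
      have "1 / real (Suc n) \<le> 1" by simp
      then show ?thesis using d[of n x] C[OF arc[of x]] by linarith
    qed
    show "(\<lambda>n. v n x) \<longlonglongrightarrow> q (cosbump i m x)" for x
    proof -
      have "(\<lambda>n. v n x - q (cosbump i m x)) \<longlonglongrightarrow> 0"
      proof (rule Lim_null_comparison)
        show "(\<lambda>n. 1 / real (Suc n)) \<longlonglongrightarrow> 0"
          using LIMSEQ_inverse_real_of_nat by (simp add: inverse_eq_divide)
        show "\<forall>\<^sub>F n in sequentially. norm (v n x - q (cosbump i m x)) \<le> 1 / real (Suc n)"
          using d by (intro always_eventually allI) (simp add: less_imp_le del: of_nat_Suc)
      qed
      then show ?thesis by (simp add: LIM_zero_iff)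
    qed
  qed
qed

lemma null_multiplier_arc_indicator:
  "(\<lambda>x. indicator {c<..} (cosbump i m x)) \<in> null_multiplier"
proof (rule null_multiplier_limit)
  \<comment> \<open>Clipped linear ramps of slope \<open>n\<close>; at the threshold
    \<open>c\<close> itself they are 0, in agreement with the open half-line.\<close>
  show "(\<lambda>x. min 1 (max 0 (real n * (cosbump i m x - c)))) \<in> null_multiplier" for n
    by (rule null_multiplier_continuous_arc) (intro continuous_intros)
  show "\<bar>min 1 (max 0 (real n * (cosbump i m x - c)))\<bar> \<le> 1" for n x by simp
  show "(\<lambda>n. min 1 (max 0 (real n * (cosbump i m x - c)))) \<longlonglongrightarrow> indicator {c<..} (cosbump i m x)" for x
  proof (cases "cosbump i m x > c")
    case True
    obtain K :: nat where K: "1 / (cosbump i m x - c) \<le> real K" using real_arch_simple by blast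
    have "min 1 (max 0 (real n * (cosbump i m x - c))) = 1" if "n \<ge> K" for n
    proof -
      have "1 / (cosbump i m x - c) \<le> real n" using K that by linarith
      then have "1 \<le> real n * (cosbump i m x - c)" using True by (simp add: field_simps)
      then show ?thesis by simp
    qed
    then have "\<forall>\<^sub>F n in sequentially. min 1 (max 0 (real n * (cosbump i m x - c))) = indicator {c<..} (cosbump i m x)"
      unfolding eventually_sequentially using True by (intro exI[of _ K]) auto
    then show ?thesis by (rule tendsto_eventually)
  next
    case False
    then have "real n * (cosbump i m x - c) \<le> 0" for n by (simp add: mult_nonneg_nonpos)
    then have "max 0 (real n * (cosbump i m x - c)) = 0" for n by (rule max_absorb1)
    then have "min 1 (max 0 (real n * (cosbump i m x - c))) = 0" for n by (simp only:)
    then show ?thesis using False by simp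
  qed
qed

text \<open>With midpoint \<open>m\<close> and half length \<open>d\<close>, both conditions compare
  the angle 2 pi |t - m| with 2 pi d. The latter is at most pi because the interval has length at
  most 1; the former may exceed pi and is then reflected.\<close>

lemma arc_interval:
  assumes ab: "0 \<le> a" "a < b" "b \<le> 1" and t: "0 < t" "t < (1::real)"
  shows "cos (pi * (b - a)) < cos (2 * pi * (t - (a + b) / 2)) \<longleftrightarrow> a < t \<and> t < b"
proof -
  define m where "m = (a + b) / 2"
  define d where "d = (b - a) / 2"
  have md: "a = m - d" "b = m + d" by (simp_all add: m_def d_def field_simps)
  define y where "y = 2 * pi * \<bar>t - m\<bar>"
  define z where "z = 2 * pi * d"
  have "cos (2 * pi * w) = cos (2 * pi * \<bar>w\<bar>)" for w by (cases "w \<ge> 0") simp_all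
  then have cy: "cos (2 * pi * (t - (a + b) / 2)) = cos y" unfolding y_def m_def .
  have cz: "pi * (b - a) = z" by (simp add: z_def d_def)
  have "0 \<le> d" "2 * d \<le> 1" using ab md by linarith+
  then have z: "0 \<le> z" "z \<le> pi" using mult_left_mono[of "2 * d" 1 pi] by (simp_all add: z_def)
  have y0: "0 \<le> y" by (simp add: y_def)
  show ?thesis
  proof (cases "a < t \<and> t < b")
    case True
    then have "\<bar>t - m\<bar> < d" using md by linarith
    then have "y < z" unfolding y_def z_def by (intro mult_strict_left_mono) auto
    then have "cos z < cos y" using y0 z by (intro cos_monotone_0_pi)
    then show ?thesis using True by (simp add: cy cz)
  next
    case False
    then have "d \<le> \<bar>t - m\<bar>" using md by linarith
    then have yz: "z \<le> y" unfolding y_def z_def by (intro mult_left_mono) auto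
    \<comment> \<open>Both \<open>t\<close> and the interval lie between 0 and 1; this keeps the
      reflected angle at least \<open>z\<close>.\<close>
    have "\<bar>t - m\<bar> \<le> 1 - d" using ab t md by linarith
    then have "y \<le> 2 * pi * (1 - d)" unfolding y_def by (intro mult_left_mono) auto
    then have y2: "z \<le> 2 * pi - y" by (simp add: z_def algebra_simps)
    have "cos y \<le> cos z"
    proof (cases "y \<le> pi")
      case True
      then show ?thesis using yz z by (intro cos_monotone_0_pi_le)
    next
      case False
      have "cos y = cos (2 * pi - y)" by simp
      also have "\<dots> \<le> cos z" using y2 z False by (intro cos_monotone_0_pi_le) auto
      finally show ?thesis .
    qed
    then show ?thesis using False by (auto simp: cy cz)
  qed
qed

lemma null_multiplier_interval:
  fixes i :: "'n::finite"
  shows "\<exists>w\<in>null_multiplier. \<forall>x\<in>unit_cell. w (x::real^'n) = indicator {a<..<b} (x $ i)"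
proof (cases "max a 0 < min b 1")
  case True
  \<comment> \<open>On the cell the coordinate lies between 0 and 1, so clipping leaves the
    indicator unchanged and makes \<open>arc_interval\<close> applicable.\<close>
  define a' where "a' = max a 0"
  define b' where "b' = min b 1"
  define c where "c = (1 + cos (pi * (b' - a'))) / 2"
  have "indicator {c<..} (cosbump i ((a' + b') / 2) x) = (indicator {a<..<b} (x $ i) :: real)" if "x \<in> unit_cell" for x :: "real^'n"
  proof -
    have t: "0 < x $ i" "x $ i < 1" using that by (auto simp: unit_cell_def)
    have "c < cosbump i ((a' + b') / 2) x \<longleftrightarrow> cos (pi * (b' - a')) < cos (2 * pi * (x $ i - (a' + b') / 2))"
      by (simp add: c_def cosbump_def)
    also have "\<dots> \<longleftrightarrow> a' < x $ i \<and> x $ i < b'"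
      by (rule arc_interval) (use True t in \<open>auto simp: a'_def b'_def\<close>)
    also have "\<dots> \<longleftrightarrow> a < x $ i \<and> x $ i < b" using t by (auto simp: a'_def b'_def)
    finally show ?thesis by (simp add: indicator_def)
  qed
  then show ?thesis
    by (intro bexI[of _ "\<lambda>x. indicator {c<..} (cosbump i ((a' + b') / 2) x)"] ballI null_multiplier_arc_indicator)
next
  case False
  have "indicator {a<..<b} (x $ i) = (0::real)" if "x \<in> unit_cell" for x :: "real^'n"
    using False that[unfolded unit_cell_def, simplified, rule_format, of i] by (auto simp: indicator_def)
  then show ?thesis using null_multiplier_const[of 0] by (intro bexI[of _ "\<lambda>x. 0"]) auto
qed

text \<open>The product of \<open>f\<close> with the indicator of a box again has vanishing
  coefficients, and its cosine coefficient at frequency 0 is the integral of \<open>f\<close> over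
  the box.\<close>

lemma fourier_complete:
  fixes f :: "real^'n \<Rightarrow> real"
  assumes f: "sq_integrable cell f" and z: "\<And>k. fcos f k = 0" "\<And>k. fsin f k = 0"
  shows "AE x in cell. f x = 0"
proof -
  have fi: "integrable cell f" by (rule cell.sq_integrable_integrable[OF f])
  have "AE x in lebesgue. indicator unit_cell x * f x = 0"
  proof (rule AE_zero_if_box_integrals_zero)
    show "integrable lebesgue (\<lambda>x. indicator unit_cell x * f x)"
      using fi by (simp add: integrable_restrict_space)
    fix a b :: "real^'n"
    have "\<forall>i. \<exists>w\<in>null_multiplier. \<forall>x\<in>unit_cell. w (x::real^'n) = indicator {a $ i<..<b $ i} (x $ i)"
      using null_multiplier_interval by blast
    then obtain w where w: "\<And>i. w i \<in> null_multiplier"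
      "\<And>i x. x \<in> unit_cell \<Longrightarrow> w i x = indicator {a $ i<..<b $ i} (x $ i)" by metis
    define W where "W x = (\<Prod>i\<in>UNIV. w i x)" for x
    have "W \<in> null_multiplier" unfolding W_def[abs_def] by (intro null_multiplier_prod w)
    then have "(\<lambda>x. W x * f x) \<in> fourier_null" using f z by (auto simp: null_multiplier_def fourier_null_def)
    then have "fcos (\<lambda>x. W x * f x) 0 = 0" by (simp add: fourier_null_def)
    then have "(LINT x|cell. W x * f x * tcos 0 x) = 0" by (simp only: fcos_def)
    moreover have "(LINT x|cell. W x * f x * tcos 0 x) = (LINT x|cell. indicator (box a b) x * f x)"
    proof (rule Bochner_Integration.integral_cong[OF refl])
      fix x :: "real^'n" assume "x \<in> space cell"
      then have "W x = (\<Prod>i\<in>UNIV. indicator {a $ i<..<b $ i} (x $ i))"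
        unfolding W_def by (intro prod.cong refl w) (simp add: space_cell)
      also have "\<dots> = indicator (box a b) x"
        by (cases "x \<in> box a b") (auto simp: mem_box_cart prod_zero_iff indicator_def)
      finally show "W x * f x * tcos 0 x = indicator (box a b) x * f x" by simp
    qed
    ultimately have "(LINT x|cell. indicator (box a b) x * f x) = 0" by simp
    then show "(LINT x|lebesgue. indicator (box a b) x * (indicator unit_cell x * f x)) = 0"
      by (simp add: integral_restrict_space mult.left_commute)
  qed
  then show ?thesis by (auto simp: AE_cell_iff indicator_def elim!: eventually_mono)
qed

text \<open>The energies increase and are bounded by Bessel's identity, so the partial sums are
  Cauchy. Their limit has the coefficients of \<open>f\<close> and equals \<open>f\<close> by
  \<open>fourier_complete\<close>. Convergence along growing boxes takes the place of summability
  over all frequencies.\<close>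

theorem Parseval:
  fixes f g :: "real^'n \<Rightarrow> real"
  assumes f: "sq_integrable cell f" and g: "sq_integrable cell g"
  shows "(\<lambda>N. \<Sum>k\<in>freq_box N. fcos f k * fcos g k + fsin f k * fsin g k) \<longlonglongrightarrow> (LINT x|cell. f x * g x)"
proof -
  have bound: "energy N f \<le> (LINT x|cell. (f x)\<^sup>2)" for N
  proof -
    have "0 \<le> (LINT x|cell. (fsum N f x - f x)\<^sup>2)" by simp
    then show ?thesis unfolding Bessel_identity[OF f] by simp
  qed
  have "incseq (\<lambda>N. energy N f)" by (auto simp: incseq_def energy_mono)
  then obtain L where "(\<lambda>N. energy N f) \<longlonglongrightarrow> L"
    by (rule incseq_convergent[where B = "LINT x|cell. (f x)\<^sup>2"]) (use bound in auto)
  then have C: "Cauchy (\<lambda>N. energy N f)" by (rule LIMSEQ_imp_Cauchy)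
  have Cf: "\<exists>N. \<forall>m\<ge>N. \<forall>n\<ge>N. (LINT x|cell. (fsum m f x - fsum n f x)\<^sup>2) < e" if "e > 0" for e
  proof -
    obtain N where N: "\<And>m n. m \<ge> N \<Longrightarrow> n \<ge> N \<Longrightarrow> \<bar>energy m f - energy n f\<bar> < e"
      using CauchyD[OF C \<open>e > 0\<close>] by auto
    have "(LINT x|cell. (fsum m f x - fsum n f x)\<^sup>2) < e" if "m \<ge> N" "n \<ge> N" for m n
    proof (cases "m \<le> n")
      case True
      then show ?thesis using N[OF that] by (simp add: integral_fsum_diff)
    next
      case False
      then have "(LINT x|cell. (fsum n f x - fsum m f x)\<^sup>2) = energy m f - energy n f"
        by (intro integral_fsum_diff) simp
      then show ?thesis using N[OF that] by (simp add: power2_commute)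
    qed
    then show ?thesis by blast
  qed
  obtain r h where "strict_mono r" and h: "sq_integrable cell h" "AE x in cell. (\<lambda>k. fsum (r k) f x) \<longlonglongrightarrow> h x"
    "(\<lambda>N. LINT x|cell. (fsum N f x - h x)\<^sup>2) \<longlonglongrightarrow> 0"
    by (rule cell.L2_complete[of "\<lambda>N. fsum N f", OF sq_integrable_fsum Cf])
  \<comment> \<open>A fixed frequency eventually lies in the box, from where on the coefficients of
    the partial sums are those of \<open>f\<close>.\<close>
  have coeff: "fcos h k = fcos f k \<and> fsin h k = fsin f k" for k
  proof -
    obtain K where K: "k \<in> freq_box K" using freq_box_exhaust by blast
    have ev: "\<forall>\<^sub>F N in sequentially. k \<in> freq_box N"
      using K freq_box_mono unfolding eventually_sequentially by blast
    have "(\<lambda>N. fcos (fsum N f) k) \<longlonglongrightarrow> fcos h k" "(\<lambda>N. fsin (fsum N f) k) \<longlonglongrightarrow> fsin h k"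
      unfolding fcos_def fsin_def
      by (intro L2_tendsto_integral_mult sq_integrable_fsum h sq_integrable_tcos sq_integrable_tsin)+
    moreover have "(\<lambda>N. fcos (fsum N f) k) \<longlonglongrightarrow> fcos f k" "(\<lambda>N. fsin (fsum N f) k) \<longlonglongrightarrow> fsin f k"
      by (rule tendsto_eventually, use ev in eventually_elim, simp add: fourier_fsum)+
    ultimately show ?thesis using LIMSEQ_unique by blast
  qed
  have "AE x in cell. h x - f x = 0"
    by (rule fourier_complete) (use h(1) f coeff in \<open>auto intro: sq_integrable_diff simp: fcos_diff fsin_diff\<close>)
  then have "AE x in cell. h x * g x = f x * g x" by eventually_elim simp
  then have e: "(LINT x|cell. h x * g x) = (LINT x|cell. f x * g x)"
    by (rule integral_cong_AE[rotated -1])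
      (use sq_integrable_measurable f g h in \<open>auto intro!: borel_measurable_times\<close>)
  show ?thesis
    using L2_tendsto_integral_mult[OF sq_integrable_fsum h(1) g h(3)]
    unfolding e integral_fsum_mult[OF g] .
qed

section \<open>Periodic Sobolev functions\<close>

lemma L2_perD:
  assumes "f \<in> L2_per"
  shows "f \<in> borel_measurable lebesgue" "periodic f" "sq_integrable cell f" "f \<in> L1_loc"
proof -
  show "f \<in> borel_measurable lebesgue" "periodic f" "sq_integrable cell f"
    using assms by (simp_all add: L2_per_iff)
  show "f \<in> L1_loc" using assms L2_loc_subset_L1_loc unfolding L2_per_def by blast
qed

lemma L2_per_cong_AE:
  assumes "g \<in> L2_per" "AE x in lebesgue. f x = g x" "f \<in> borel_measurable lebesgue"
  shows "f \<in> L2_per"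
proof -
  note g = L2_perD[OF assms(1)]
  have "periodic f" unfolding periodic_def
  proof
    fix i
    have "AE x in lebesgue. f (x + axis i 1) = g (x + axis i 1)" by (rule AE_translation[OF assms(2)])
    moreover have "AE x in lebesgue. g (x + axis i 1) = g x" using g(2) by (simp add: periodic_def)
    ultimately show "AE x in lebesgue. f (x + axis i 1) = f x"
      using assms(2) by eventually_elim simp
  qed
  moreover have "sq_integrable cell f"
    by (rule sq_integrable_cong_AE[OF AE_cellI[OF assms(2)] measurable_cell[OF assms(3)] g(3)])
  ultimately show ?thesis using assms(3) by (simp add: L2_per_iff)
qed

lemma L2_per_add: "f \<in> L2_per \<Longrightarrow> g \<in> L2_per \<Longrightarrow> (\<lambda>x. f x + g x) \<in> L2_per"
  using periodic_compose2[of f g "(+)"] by (auto simp: L2_per_iff sq_integrable_add intro: borel_measurable_add)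

lemma L2_per_cmult: "f \<in> L2_per \<Longrightarrow> (\<lambda>x. c * f x) \<in> L2_per"
  using periodic_compose[of f "\<lambda>y. c * y"] by (auto simp: L2_per_iff sq_integrable_cmult intro: borel_measurable_times)

lemma has_weak_partial_measurable: "has_weak_partial i f g \<Longrightarrow> g \<in> borel_measurable lebesgue"
  by (auto simp: has_weak_partial_def intro: L1_loc_measurable)

lemma weak_partial_L2_per:
  assumes "has_weak_partial i f g" "g \<in> L2_per"
  shows "weak_partial i f \<in> L2_per"
  by (rule L2_per_cong_AE[OF assms(2) weak_partial_AE[OF assms(1)]])
    (rule has_weak_partial_measurable[OF has_weak_partial_weak_partial[OF assms(1)]])

text \<open>\<open>H_per\<close> asks derivatives to lie in \<open>L2_loc\<close>;
  \<open>has_weak_partial_periodic\<close> upgrades them to \<open>L2_per\<close>.\<close>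

lemma H_per1_iff:
  "f \<in> H_per 1 \<longleftrightarrow> f \<in> L2_per \<and> (\<forall>i. \<exists>g\<in>L2_per. has_weak_partial i f g)"
proof safe
  assume f: "f \<in> H_per 1"
  then show "f \<in> L2_per" by (simp add: H_per_def L2_per_def)
  fix i
  obtain g where g: "g \<in> L2_loc" "has_weak_partial i f g" using f by (auto simp: H_per_def)
  have "periodic g" by (rule has_weak_partial_periodic[OF g(2)]) (use f in \<open>simp add: H_per_def\<close>)
  with g show "\<exists>g\<in>L2_per. has_weak_partial i f g" by (auto simp: L2_per_def)
next
  assume "f \<in> L2_per" "\<forall>i. \<exists>g\<in>L2_per. has_weak_partial i f g"
  then show "f \<in> H_per 1" by (fastforce simp: H_per_def L2_per_def)
qed

lemma H_per1D:
  assumes "f \<in> H_per 1"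
  shows "f \<in> L2_per" "has_weak_partial i f (weak_partial i f)" "weak_partial i f \<in> L2_per"
proof -
  show "f \<in> L2_per" using assms unfolding H_per1_iff by blast
  obtain g where g: "g \<in> L2_per" "has_weak_partial i f g" using assms unfolding H_per1_iff by blast
  show "has_weak_partial i f (weak_partial i f)" "weak_partial i f \<in> L2_per"
    using has_weak_partial_weak_partial[OF g(2)] weak_partial_L2_per[OF g(2,1)] by auto
qed

lemma H_per1_cong_AE:
  assumes "g \<in> H_per 1" "AE x in lebesgue. f x = g x" "f \<in> borel_measurable lebesgue"
  shows "f \<in> H_per 1"
proof -
  have f: "f \<in> L2_per" by (rule L2_per_cong_AE[OF H_per1D(1)[OF assms(1)] assms(2,3)])
  have "has_weak_partial i f (weak_partial i g)" for i
    by (rule has_weak_partial_cong_AE[OF H_per1D(2)[OF assms(1)] assms(2) L2_perD(4)[OF f]])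
  then show ?thesis using f H_per1D(3)[OF assms(1)] unfolding H_per1_iff by blast
qed

lemma H_per2_iff: "f \<in> H_per 2 \<longleftrightarrow> f \<in> L2_per \<and> (\<forall>i. \<exists>g\<in>H_per 1. has_weak_partial i f g)"
proof safe
  assume f: "f \<in> H_per 2"
  then show "f \<in> L2_per" by (simp add: H_per_def L2_per_def numeral_2_eq_2)
  fix i
  have "f \<in> H_loc (Suc 1)" using f by (simp add: H_per_def numeral_2_eq_2)
  then obtain g where g: "g \<in> H_loc 1" "has_weak_partial i f g" unfolding H_loc.simps by blast
  have "periodic g" by (rule has_weak_partial_periodic[OF g(2)]) (use f in \<open>simp add: H_per_def\<close>)
  with g show "\<exists>g\<in>H_per 1. has_weak_partial i f g" by (auto simp: H_per_def simp del: One_nat_def)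
next
  assume f: "f \<in> L2_per" "\<forall>i. \<exists>g\<in>H_per 1. has_weak_partial i f g"
  then have "\<forall>i. \<exists>g\<in>H_loc 1. has_weak_partial i f g" by (auto simp: H_per_def simp del: One_nat_def H_loc.simps)
  then have "f \<in> H_loc (Suc 1)" using f(1) unfolding H_loc.simps L2_per_def by blast
  then show "f \<in> H_per 2" using f(1) by (simp add: H_per_def L2_per_def numeral_2_eq_2)
qed

lemma H_per2D:
  assumes "f \<in> H_per 2"
  shows "f \<in> H_per 1" "weak_partial i f \<in> H_per 1"
proof -
  have g: "\<forall>i. \<exists>g\<in>H_per 1. has_weak_partial i f g" "f \<in> L2_per" using assms by (auto simp: H_per2_iff)
  then show "f \<in> H_per 1" using H_per1D(1) unfolding H_per1_iff[of f] by blast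
  obtain g where g: "g \<in> H_per 1" "has_weak_partial i f g" using g by blast
  show "weak_partial i f \<in> H_per 1"
    by (rule H_per1_cong_AE[OF g(1) weak_partial_AE[OF g(2)]])
      (rule has_weak_partial_measurable[OF has_weak_partial_weak_partial[OF g(2)]])
qed

section \<open>Identities and inequalities by comparison of Fourier coefficients\<close>

lemma fourier_weak_partial':
  assumes "f \<in> H_per 1"
  shows "fcos (weak_partial i f) k = 2 * pi * of_int (k $ i) * fsin f k"
    "fsin (weak_partial i f) k = - (2 * pi * of_int (k $ i)) * fcos f k"
  using fourier_weak_partial[OF H_per1D(2)[OF assms] H_per1D(1)[OF assms] H_per1D(3)[OF assms]] by auto

text \<open>On the Fourier side both integrals carry the product of the entries \<open>i\<close> and
  \<open>j\<close> of the frequency. Moving derivatives by parts would instead need second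
  derivatives, which these functions may lack.\<close>

lemma integral_partial_swap:
  assumes "f \<in> H_per 1" "g \<in> H_per 1"
  shows "(LINT x|cell. weak_partial i f x * weak_partial j g x) = (LINT x|cell. weak_partial j f x * weak_partial i g x)"
proof -
  have s: "sq_integrable cell (weak_partial i f)" "sq_integrable cell (weak_partial i g)" for i
    using assms H_per1D(3) L2_perD(3) by blast+
  have "(\<lambda>N. \<Sum>k\<in>freq_box N. fcos (weak_partial i f) k * fcos (weak_partial j g) k + fsin (weak_partial i f) k * fsin (weak_partial j g) k)
      = (\<lambda>N. \<Sum>k\<in>freq_box N. fcos (weak_partial j f) k * fcos (weak_partial i g) k + fsin (weak_partial j f) k * fsin (weak_partial i g) k)"
    by (intro ext sum.cong refl) (simp add: fourier_weak_partial'[OF assms(1)] fourier_weak_partial'[OF assms(2)])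
  note eq = this
  show ?thesis
    by (rule LIMSEQ_unique[OF Parseval[OF s(1)[of i] s(2)[of j], unfolded eq] Parseval[OF s(1)[of j] s(2)[of i]]])
qed

text \<open>Mean zero removes frequency 0, and a nonzero integer vector has squared length at least
  1. The factor 4 pi^2 is the square of the 2 pi in the trigonometric functions.\<close>

lemma Poincare:
  fixes f :: "real^'n \<Rightarrow> real"
  assumes "f \<in> H_per0 1"
  shows "(LINT x|cell. (f x)\<^sup>2) \<le> 1 / (4 * pi\<^sup>2) * (\<Sum>i\<in>UNIV. LINT x|cell. (weak_partial i f x)\<^sup>2)"
proof -
  have f: "f \<in> H_per 1" and zero: "(LINT x|cell. f x) = 0"
    using assms by (auto simp: H_per0_def int_cell_eq simp del: One_nat_def)
  have z: "fcos f 0 = 0" using zero by (simp add: fcos_def)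
  have s: "sq_integrable cell f" "sq_integrable cell (weak_partial i f)" for i
    using f H_per1D L2_perD(3) by blast+
  have l: "(\<lambda>N. energy N f) \<longlonglongrightarrow> (LINT x|cell. (f x)\<^sup>2)"
    using Parseval[OF s(1) s(1)] by (simp add: energy_def power2_eq_square)
  have r: "(\<lambda>N. 1 / (4 * pi\<^sup>2) * (\<Sum>i\<in>UNIV. energy N (weak_partial i f)))
      \<longlonglongrightarrow> 1 / (4 * pi\<^sup>2) * (\<Sum>i\<in>UNIV. LINT x|cell. (weak_partial i f x)\<^sup>2)"
    using Parseval[OF s(2) s(2)] by (intro tendsto_mult tendsto_const tendsto_sum) (simp add: energy_def power2_eq_square)
  have "energy N f \<le> 1 / (4 * pi\<^sup>2) * (\<Sum>i\<in>UNIV. energy N (weak_partial i f))" for N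
  proof -
    have tm: "(fcos f k)\<^sup>2 + (fsin f k)\<^sup>2
        \<le> 1 / (4 * pi\<^sup>2) * (\<Sum>i\<in>UNIV. (fcos (weak_partial i f) k)\<^sup>2 + (fsin (weak_partial i f) k)\<^sup>2)" for k
    proof (cases "k = 0")
      case False
      then obtain i where i: "k $ i \<noteq> 0" by (auto simp: vec_eq_iff)
      have "(1::int) \<le> (k $ i)\<^sup>2" using i by (simp add: int_one_le_iff_zero_less)
      also have "\<dots> \<le> (\<Sum>i\<in>UNIV. (k $ i)\<^sup>2)" by (rule member_le_sum) auto
      finally have "(1::real) \<le> of_int (\<Sum>i\<in>UNIV. (k $ i)\<^sup>2)" by (simp only: of_int_1_le_iff)
      then have k1: "(1::real) \<le> (\<Sum>i\<in>UNIV. (of_int (k $ i))\<^sup>2)" by simp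
      have "(\<Sum>i\<in>UNIV. (fcos (weak_partial i f) k)\<^sup>2 + (fsin (weak_partial i f) k)\<^sup>2)
          = (\<Sum>i\<in>UNIV. (4 * pi\<^sup>2 * ((fcos f k)\<^sup>2 + (fsin f k)\<^sup>2)) * (of_int (k $ i))\<^sup>2)"
        by (intro sum.cong refl) (simp add: fourier_weak_partial'[OF f] power_mult_distrib algebra_simps)
      also have "\<dots> = (4 * pi\<^sup>2 * ((fcos f k)\<^sup>2 + (fsin f k)\<^sup>2)) * (\<Sum>i\<in>UNIV. (of_int (k $ i))\<^sup>2)"
        by (rule sum_distrib_left[symmetric])
      finally have "1 / (4 * pi\<^sup>2) * (\<Sum>i\<in>UNIV. (fcos (weak_partial i f) k)\<^sup>2 + (fsin (weak_partial i f) k)\<^sup>2)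
          = ((fcos f k)\<^sup>2 + (fsin f k)\<^sup>2) * (\<Sum>i\<in>UNIV. (of_int (k $ i))\<^sup>2)" by simp
      moreover have "((fcos f k)\<^sup>2 + (fsin f k)\<^sup>2) * 1 \<le> ((fcos f k)\<^sup>2 + (fsin f k)\<^sup>2) * (\<Sum>i\<in>UNIV. (of_int (k $ i))\<^sup>2)"
        by (rule mult_left_mono[OF k1]) simp
      ultimately show ?thesis by simp
    qed (simp add: z sum_nonneg)
    have "energy N f \<le> (\<Sum>k\<in>freq_box N. 1 / (4 * pi\<^sup>2) * (\<Sum>i\<in>UNIV. (fcos (weak_partial i f) k)\<^sup>2 + (fsin (weak_partial i f) k)\<^sup>2))"
      unfolding energy_def by (rule sum_mono[OF tm])
    also have "\<dots> = 1 / (4 * pi\<^sup>2) * (\<Sum>i\<in>UNIV. energy N (weak_partial i f))"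
      unfolding energy_def sum_distrib_left[symmetric] by (subst sum.swap) simp
    finally show ?thesis .
  qed
  then show ?thesis using l r by (intro LIMSEQ_le) auto
qed

lemma fourier_unique:
  assumes "sq_integrable cell f" "sq_integrable cell g" "\<And>k. fcos f k = fcos g k" "\<And>k. fsin f k = fsin g k"
  shows "AE x in cell. f x = g x"
proof -
  have "AE x in cell. f x - g x = 0"
    by (rule fourier_complete) (simp_all add: assms sq_integrable_diff fcos_diff fsin_diff)
  then show ?thesis by eventually_elim simp
qed

text \<open>Both sides have the same Fourier coefficients, since the two frequency factors
  commute.\<close>

lemma weak_partial_commute:
  assumes "f \<in> H_per 2"
  shows "AE x in lebesgue. weak_partial i (weak_partial j f) x = weak_partial j (weak_partial i f) x"
proof -
  note f = H_per2D(1)[OF assms] and d = H_per2D(2)[OF assms]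
  note dd = H_per1D(3)[OF d]
  have "AE x in cell. weak_partial i (weak_partial j f) x = weak_partial j (weak_partial i f) x"
    by (rule fourier_unique) (simp_all add: L2_perD(3)[OF dd] fourier_weak_partial'[OF d] fourier_weak_partial'[OF f])
  then show ?thesis by (intro periodic_AE_eq L2_perD(2)[OF dd])
qed

text \<open>The differentiation rule at frequency 0; it places gradients in the mean-zero
  space.\<close>

lemma integral_weak_partial:
  assumes "f \<in> H_per 1"
  shows "(LINT x|cell. weak_partial i f x) = 0"
  using fourier_weak_partial'(1)[OF assms, of i 0] by (simp add: fcos_def)

lemma weak_partial_H_per0: "f \<in> H_per 2 \<Longrightarrow> weak_partial i f \<in> H_per0 1"
  using H_per2D[of f] integral_weak_partial[of f i] by (simp add: H_per0_def int_cell_eq del: One_nat_def)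

lemma grad_H1_per0_vec: "f \<in> H_per 2 \<Longrightarrow> grad f \<in> H1_per0_vec"
  by (simp add: H1_per0_vec_def grad_def weak_partial_H_per0 del: One_nat_def)

section \<open>Smooth periodic functions and the range of the Laplacian\<close>

lemma weak_partial_smooth: "smooth e \<Longrightarrow> AE x in lebesgue. weak_partial i e x = partial_deriv i e x"
  by (rule weak_partial_AE[OF has_weak_partial_smooth])

lemma smooth_periodic_L2_per:
  assumes "smooth e" "\<And>j x. e (x + axis j 1) = e x"
  shows "e \<in> L2_per"
proof -
  have "continuous_on UNIV (\<lambda>x. (e x)\<^sup>2)" by (intro continuous_intros smooth_continuous assms)
  then have "\<forall>K. compact K \<longrightarrow> set_integrable lebesgue K (\<lambda>x. (e x)\<^sup>2)"
    using continuous_L1_loc by (auto simp: L1_loc_def)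
  then show ?thesis
    using assms by (auto simp: L2_per_def L2_loc_def periodic_def intro: continuous_measurable_lebesgue smooth_continuous)
qed

lemma smooth_periodic_H_per1:
  assumes "smooth e" "\<And>j x. e (x + axis j 1) = e x"
  shows "e \<in> H_per 1"
  unfolding H_per1_iff
proof (intro conjI allI bexI)
  show "e \<in> L2_per" by (rule smooth_periodic_L2_per[OF assms])
  show "has_weak_partial i e (partial_deriv i e)" for i by (rule has_weak_partial_smooth[OF assms(1)])
  show "partial_deriv i e \<in> L2_per" for i
    by (rule smooth_periodic_L2_per[OF smooth_partial_deriv[OF assms(1)] smooth_periodic_partial_deriv[OF assms]])
qed

lemma smooth_periodic_H_per2:
  assumes "smooth e" "\<And>j x. e (x + axis j 1) = e x"
  shows "e \<in> H_per 2"
  unfolding H_per2_iff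
proof (intro conjI allI bexI)
  show "e \<in> L2_per" by (rule smooth_periodic_L2_per[OF assms])
  show "has_weak_partial i e (partial_deriv i e)" for i by (rule has_weak_partial_smooth[OF assms(1)])
  show "partial_deriv i e \<in> H_per 1" for i
    by (rule smooth_periodic_H_per1[OF smooth_partial_deriv[OF assms(1)] smooth_periodic_partial_deriv[OF assms]])
qed

lemma weak_partial2_smooth:
  assumes "smooth e" "\<And>j x. e (x + axis j 1) = e x"
  shows "AE x in lebesgue. weak_partial i (weak_partial i e) x = partial_deriv i (partial_deriv i e) x"
proof (rule weak_partial_AE)
  have "weak_partial i e \<in> L2_per" by (rule H_per1D(3)[OF smooth_periodic_H_per1[OF assms]])
  then show "has_weak_partial i (weak_partial i e) (partial_deriv i (partial_deriv i e))"
    by (intro has_weak_partial_cong_AE[OF has_weak_partial_smooth[OF smooth_partial_deriv[OF assms(1)]] weak_partial_smooth[OF assms(1)]] L2_perD)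
qed

lemma laplacian_trig:
  "AE x in lebesgue. laplacian (tcos k) x = - (4 * pi\<^sup>2 * (\<Sum>i\<in>UNIV. (of_int (k $ i))\<^sup>2)) * tcos k x"
  "AE x in lebesgue. laplacian (tsin k) x = - (4 * pi\<^sup>2 * (\<Sum>i\<in>UNIV. (of_int (k $ i))\<^sup>2)) * tsin k x"
proof -
  have pc: "partial_deriv i (partial_deriv i (tcos k)) x = - (4 * pi\<^sup>2 * (of_int (k $ i))\<^sup>2) * tcos k x"
    and ps: "partial_deriv i (partial_deriv i (tsin k)) x = - (4 * pi\<^sup>2 * (of_int (k $ i))\<^sup>2) * tsin k x" for i x
  proof -
    have m: "partial_deriv i (\<lambda>x. c * e x) x = c * partial_deriv i e x" if "smooth e" for c and e :: "real^'a \<Rightarrow> real"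
    proof -
      have "partial_deriv i (\<lambda>x. c) x = 0" by (subst partial_deriv_eq[OF has_derivative_const]) simp
      then show ?thesis
        using partial_deriv_mult[OF smooth_differentiable[OF smooth_const[of c]] smooth_differentiable[OF that], where x = x and i = i] by simp
    qed
    have "partial_deriv i (tcos k) = (\<lambda>x. - (2 * pi * of_int (k $ i)) * tsin k x)"
      "partial_deriv i (tsin k) = (\<lambda>x. (2 * pi * of_int (k $ i)) * tcos k x)"
      by (rule ext, rule partial_deriv_tcos partial_deriv_tsin)+
    then show "partial_deriv i (partial_deriv i (tcos k)) x = - (4 * pi\<^sup>2 * (of_int (k $ i))\<^sup>2) * tcos k x"
      "partial_deriv i (partial_deriv i (tsin k)) x = - (4 * pi\<^sup>2 * (of_int (k $ i))\<^sup>2) * tsin k x"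
      by (simp_all only: m[OF smooth_tcos] m[OF smooth_tsin] partial_deriv_tcos partial_deriv_tsin) (simp_all add: power2_eq_square)
  qed
  have "AE x in lebesgue. \<forall>i. weak_partial i (weak_partial i (tcos k)) x = - (4 * pi\<^sup>2 * (of_int (k $ i))\<^sup>2) * tcos k x"
    using weak_partial2_smooth[OF smooth_tcos tcos_periodic, of _ k] by (simp add: AE_all_countable pc)
  then show "AE x in lebesgue. laplacian (tcos k) x = - (4 * pi\<^sup>2 * (\<Sum>i\<in>UNIV. (of_int (k $ i))\<^sup>2)) * tcos k x"
    by eventually_elim (simp add: laplacian_def sum_negf sum_distrib_left sum_distrib_right)
  have "AE x in lebesgue. \<forall>i. weak_partial i (weak_partial i (tsin k)) x = - (4 * pi\<^sup>2 * (of_int (k $ i))\<^sup>2) * tsin k x"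
    using weak_partial2_smooth[OF smooth_tsin tsin_periodic, of _ k] by (simp add: AE_all_countable ps)
  then show "AE x in lebesgue. laplacian (tsin k) x = - (4 * pi\<^sup>2 * (\<Sum>i\<in>UNIV. (of_int (k $ i))\<^sup>2)) * tsin k x"
    by eventually_elim (simp add: laplacian_def sum_negf sum_distrib_left sum_distrib_right)
qed

lemma sq_integrable_laplacian: "\<phi> \<in> H_per 2 \<Longrightarrow> sq_integrable cell (laplacian \<phi>)"
  unfolding laplacian_def[abs_def]
  by (intro sq_integrable_sum L2_perD(3) H_per1D(3) H_per2D(2))

text \<open>For \<open>k \<noteq> 0\<close> the functions \<open>tcos k\<close> and
  \<open>tsin k\<close> are mean-zero eigenfunctions of the Laplacian with a nonzero eigenvalue.
  They are thus Laplacians up to scaling, and all coefficients of \<open>g\<close> at nonzero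
  frequencies vanish.\<close>

lemma orthogonal_laplacians_imp_constant:
  fixes g :: "real^'n \<Rightarrow> real"
  assumes g: "sq_integrable cell g"
    and orth: "\<And>\<phi>. \<phi> \<in> H_per0 2 \<Longrightarrow> (LINT x|cell. laplacian \<phi> x * g x) = 0"
  shows "\<exists>c. AE x in cell. g x = c"
proof -
  have z: "fcos g k = 0 \<and> fsin g k = 0" if k: "k \<noteq> 0" for k
  proof -
    define s where "s = - (4 * pi\<^sup>2 * (\<Sum>i\<in>UNIV. (real_of_int (k $ i))\<^sup>2))"
    have "(\<Sum>i\<in>UNIV. (real_of_int (k $ i))\<^sup>2) \<noteq> 0"
      using k by (simp add: sum_nonneg_eq_0_iff vec_eq_iff)
    then have s: "s \<noteq> 0" by (simp add: s_def)
    have key: "(LINT x|cell. g x * e x) = 0"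
      if e: "smooth e" "\<And>j x. e (x + axis j 1) = e x" "(LINT x|cell. e x) = 0"
        "AE x in lebesgue. laplacian e x = s * e x" for e
    proof -
      have "e \<in> H_per0 2"
        using smooth_periodic_H_per2[OF e(1,2)] e(3) by (simp add: H_per0_def int_cell_eq)
      then have "0 = (LINT x|cell. laplacian e x * g x)" using orth by simp
      also have "\<dots> = (LINT x|cell. s * (g x * e x))"
      proof (rule integral_cong_AE)
        show "AE x in cell. laplacian e x * g x = s * (g x * e x)"
          using AE_cellI[OF e(4)] by eventually_elim simp
        have "laplacian e \<in> borel_measurable cell"
          by (intro sq_integrable_measurable sq_integrable_laplacian smooth_periodic_H_per2 e)
        moreover have "e \<in> borel_measurable cell"
          by (intro measurable_cell continuous_measurable_lebesgue smooth_continuous e)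
        ultimately show "(\<lambda>x. laplacian e x * g x) \<in> borel_measurable cell" "(\<lambda>x. s * (g x * e x)) \<in> borel_measurable cell"
          using sq_integrable_measurable[OF g] by auto
      qed
      also have "\<dots> = s * (LINT x|cell. g x * e x)" by simp
      finally show ?thesis using s by simp
    qed
    have "(LINT x|cell. g x * tcos k x) = 0"
      by (rule key[OF smooth_tcos tcos_periodic]) (use k laplacian_trig[of k] in \<open>simp_all add: integral_tcos s_def\<close>)
    moreover have "(LINT x|cell. g x * tsin k x) = 0"
      by (rule key[OF smooth_tsin tsin_periodic]) (use k laplacian_trig[of k] in \<open>simp_all add: integral_tsin s_def\<close>)
    ultimately show ?thesis by (simp add: fcos_def fsin_def)
  qed
  have const: "fcos (\<lambda>x. c) k = (if k = 0 then c else 0)" "fsin (\<lambda>x. c) k = 0" for c and k :: "int^'n"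
    unfolding fcos_def fsin_def integral_mult_right_zero integral_tcos integral_tsin by simp_all
  have "AE x in cell. g x = fcos g 0"
  proof (rule fourier_unique[OF g cell.sq_integrable_const])
    show "fcos g k = fcos (\<lambda>x. fcos g 0) k" for k
      unfolding const using z[of k] by simp
    show "fsin g k = fsin (\<lambda>x. fcos g 0) k" for k
      unfolding const using z[of k] by (cases "k = 0") simp_all
  qed
  then show ?thesis by blast
qed

section \<open>The space of periodic mean-zero vector fields\<close>

lemma has_weak_partial_diff:
  assumes "has_weak_partial i f g" "has_weak_partial i f' g'"
  shows "has_weak_partial i (\<lambda>x. f x - f' x) (\<lambda>x. g x - g' x)"
  using has_weak_partial_add[OF assms(1) has_weak_partial_cmult[OF assms(2), of "-1"]] by simp

lemma H_per0_1_add: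
  assumes "f \<in> H_per0 1" "g \<in> H_per0 1"
  shows "(\<lambda>x. f x + g x) \<in> H_per0 1"
proof -
  have f: "f \<in> H_per 1" "int_cell f = 0" and g: "g \<in> H_per 1" "int_cell g = 0"
    using assms by (simp_all add: H_per0_def del: One_nat_def)
  have "(\<lambda>x. f x + g x) \<in> H_per 1"
    unfolding H_per1_iff using H_per1D[OF f(1)] H_per1D[OF g(1)] has_weak_partial_add L2_per_add by blast
  moreover have "integrable cell f" "integrable cell g"
    using H_per1D(1)[OF f(1)] H_per1D(1)[OF g(1)] by (auto intro: cell.sq_integrable_integrable L2_perD(3))
  ultimately show ?thesis using f g by (simp add: H_per0_def int_cell_eq del: One_nat_def)
qed

lemma H_per0_1_cmult:
  assumes "f \<in> H_per0 1"
  shows "(\<lambda>x. c * f x) \<in> H_per0 1"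
proof -
  have f: "f \<in> H_per 1" "int_cell f = 0" using assms by (simp_all add: H_per0_def del: One_nat_def)
  have "(\<lambda>x. c * f x) \<in> H_per 1"
    unfolding H_per1_iff using H_per1D[OF f(1)] has_weak_partial_cmult L2_per_cmult by blast
  then show ?thesis using f by (simp add: H_per0_def int_cell_eq del: One_nat_def)
qed

lemma H1v_D:
  assumes "w \<in> H1_per0_vec"
  shows "(\<lambda>x. w x $ i) \<in> H_per0 1" "(\<lambda>x. w x $ i) \<in> H_per 1" "(LINT x|cell. w x $ i) = 0"
    "(\<lambda>x. w x $ i) \<in> L2_per" "sq_integrable cell (\<lambda>x. w x $ i)"
    "has_weak_partial j (\<lambda>x. w x $ i) (weak_partial j (\<lambda>x. w x $ i))"
    "weak_partial j (\<lambda>x. w x $ i) \<in> L2_per"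
    "sq_integrable cell (weak_partial j (\<lambda>x. w x $ i))"
proof -
  show a: "(\<lambda>x. w x $ i) \<in> H_per0 1" using assms by (simp add: H1_per0_vec_def del: One_nat_def)
  then show b: "(\<lambda>x. w x $ i) \<in> H_per 1" and "(LINT x|cell. w x $ i) = 0"
    by (simp_all add: H_per0_def int_cell_eq del: One_nat_def)
  show c: "(\<lambda>x. w x $ i) \<in> L2_per" "weak_partial j (\<lambda>x. w x $ i) \<in> L2_per"
    "has_weak_partial j (\<lambda>x. w x $ i) (weak_partial j (\<lambda>x. w x $ i))"
    using H_per1D[OF b] by auto
  show "sq_integrable cell (\<lambda>x. w x $ i)" "sq_integrable cell (weak_partial j (\<lambda>x. w x $ i))"
    using c by (auto intro: L2_perD(3))
qed

lemma H1v_zero: "(\<lambda>x. 0) \<in> H1_per0_vec"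
proof -
  have "(\<lambda>x::real^'a. 0::real) \<in> H_per 1" by (rule smooth_periodic_H_per1[OF smooth_const]) simp
  then show ?thesis by (simp add: H1_per0_vec_def H_per0_def int_cell_eq del: One_nat_def)
qed

lemma H1v_add: "u \<in> H1_per0_vec \<Longrightarrow> v \<in> H1_per0_vec \<Longrightarrow> (\<lambda>x. u x + v x) \<in> H1_per0_vec"
  by (simp add: H1_per0_vec_def H_per0_1_add del: One_nat_def)

lemma H1v_scale: "u \<in> H1_per0_vec \<Longrightarrow> (\<lambda>x. c *\<^sub>R u x) \<in> H1_per0_vec"
  by (simp add: H1_per0_vec_def H_per0_1_cmult del: One_nat_def)

lemma H1v_diff: "u \<in> H1_per0_vec \<Longrightarrow> v \<in> H1_per0_vec \<Longrightarrow> (\<lambda>x. u x - v x) \<in> H1_per0_vec"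
  using H1v_add[of u "\<lambda>x. (-1) *\<^sub>R v x"] H1v_scale[of v "-1"] by simp

lemma weak_jacobian_add:
  assumes "u \<in> H1_per0_vec" "v \<in> H1_per0_vec"
  shows "AE x in lebesgue. weak_jacobian (\<lambda>x. u x + v x) x = weak_jacobian u x + weak_jacobian v x"
proof -
  have "AE x in lebesgue. weak_partial j (\<lambda>y. (u y + v y) $ i) x
      = weak_partial j (\<lambda>y. u y $ i) x + weak_partial j (\<lambda>y. v y $ i) x" for i j
    using weak_partial_AE[OF has_weak_partial_add[OF H1v_D(6)[OF assms(1), where i = i and j = j] H1v_D(6)[OF assms(2), where i = i]]]
    by simp
  then have "AE x in lebesgue. \<forall>i j. weak_partial j (\<lambda>y. (u y + v y) $ i) x
      = weak_partial j (\<lambda>y. u y $ i) x + weak_partial j (\<lambda>y. v y $ i) x"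
    by (simp only: AE_all_countable) simp
  then show ?thesis by eventually_elim (simp add: weak_jacobian_def vec_eq_iff)
qed

lemma weak_jacobian_scale:
  assumes "u \<in> H1_per0_vec"
  shows "AE x in lebesgue. weak_jacobian (\<lambda>x. c *\<^sub>R u x) x = c *\<^sub>R weak_jacobian u x"
proof -
  have "AE x in lebesgue. weak_partial j (\<lambda>y. (c *\<^sub>R u y) $ i) x = c * weak_partial j (\<lambda>y. u y $ i) x" for i j
    using weak_partial_AE[OF has_weak_partial_cmult[OF H1v_D(6)[OF assms, where i = i and j = j], of c]] by simp
  then have "AE x in lebesgue. \<forall>i j. weak_partial j (\<lambda>y. (c *\<^sub>R u y) $ i) x = c * weak_partial j (\<lambda>y. u y $ i) x"
    by (simp only: AE_all_countable) simp
  then show ?thesis by eventually_elim (simp add: weak_jacobian_def vec_eq_iff)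
qed

lemma weak_jacobian_diff:
  assumes "u \<in> H1_per0_vec" "v \<in> H1_per0_vec"
  shows "AE x in lebesgue. weak_jacobian (\<lambda>x. u x - v x) x = weak_jacobian u x - weak_jacobian v x"
  using weak_jacobian_add[OF assms(1) H1v_scale[OF assms(2), of "-1"]] weak_jacobian_scale[OF assms(2), of "-1"]
  by eventually_elim simp

definition sq_integrable_matrix :: "(real^'n \<Rightarrow> real^'n^'n) \<Rightarrow> bool" where
  "sq_integrable_matrix M \<longleftrightarrow> (\<forall>i j. sq_integrable cell (\<lambda>x. M x $ i $ j))"

lemma sq_integrable_weak_jacobian: "w \<in> H1_per0_vec \<Longrightarrow> sq_integrable_matrix (weak_jacobian w)"
  by (simp add: sq_integrable_matrix_def weak_jacobian_def H1v_D(8))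

lemma inner_matrix: "(M :: real^'n^'n) \<bullet> N = (\<Sum>i\<in>UNIV. \<Sum>j\<in>UNIV. M $ i $ j * N $ i $ j)"
  by (simp add: inner_vec_def)

lemma integral_inner_matrix:
  assumes "sq_integrable_matrix M" "sq_integrable_matrix N"
  shows "integrable cell (\<lambda>x. M x \<bullet> N x)"
    "(LINT x|cell. M x \<bullet> N x) = (\<Sum>i\<in>UNIV. \<Sum>j\<in>UNIV. LINT x|cell. M x $ i $ j * N x $ i $ j)"
proof -
  have "integrable cell (\<lambda>x. M x $ i $ j * N x $ i $ j)" for i j
    using assms by (intro sq_integrable_mult) (auto simp: sq_integrable_matrix_def)
  then show "integrable cell (\<lambda>x. M x \<bullet> N x)"
    "(LINT x|cell. M x \<bullet> N x) = (\<Sum>i\<in>UNIV. \<Sum>j\<in>UNIV. LINT x|cell. M x $ i $ j * N x $ i $ j)"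
    by (simp_all add: inner_matrix Bochner_Integration.integral_sum)
qed

lemma sq_integrable_matrix_transpose: "sq_integrable_matrix M \<Longrightarrow> sq_integrable_matrix (\<lambda>x. transpose (M x))"
  by (simp add: sq_integrable_matrix_def transpose_def)

section \<open>The Dirichlet inner product\<close>

definition jac_inner :: "(real^'n \<Rightarrow> real^'n) \<Rightarrow> (real^'n \<Rightarrow> real^'n) \<Rightarrow> real" where
  "jac_inner v w = (LINT x|cell. weak_jacobian v x \<bullet> weak_jacobian w x)"

lemma jac_inner_sum:
  assumes "v \<in> H1_per0_vec" "w \<in> H1_per0_vec"
  shows "jac_inner v w = (\<Sum>i\<in>UNIV. \<Sum>j\<in>UNIV. LINT x|cell. weak_partial j (\<lambda>y. v y $ i) x * weak_partial j (\<lambda>y. w y $ i) x)"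
  unfolding jac_inner_def
  using integral_inner_matrix(2)[OF sq_integrable_weak_jacobian sq_integrable_weak_jacobian, OF assms]
  by (simp add: weak_jacobian_def)

lemma jac_inner_nonneg: "0 \<le> jac_inner v v"
  by (simp add: jac_inner_def)

lemma jac_inner_sym: "jac_inner v w = jac_inner w v"
  by (simp add: jac_inner_def inner_commute)

lemma jac_inner_integrable:
  "v \<in> H1_per0_vec \<Longrightarrow> w \<in> H1_per0_vec \<Longrightarrow> integrable cell (\<lambda>x. weak_jacobian v x \<bullet> weak_jacobian w x)"
  by (intro integral_inner_matrix(1) sq_integrable_weak_jacobian)

lemma jac_inner_add_left:
  assumes "u \<in> H1_per0_vec" "v \<in> H1_per0_vec" "w \<in> H1_per0_vec"
  shows "jac_inner (\<lambda>x. u x + v x) w = jac_inner u w + jac_inner v w"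
proof -
  have "jac_inner (\<lambda>x. u x + v x) w = (LINT x|cell. weak_jacobian u x \<bullet> weak_jacobian w x + weak_jacobian v x \<bullet> weak_jacobian w x)"
    unfolding jac_inner_def
  proof (rule integral_cong_AE)
    show "AE x in cell. weak_jacobian (\<lambda>x. u x + v x) x \<bullet> weak_jacobian w x
        = weak_jacobian u x \<bullet> weak_jacobian w x + weak_jacobian v x \<bullet> weak_jacobian w x"
      using AE_cellI[OF weak_jacobian_add[OF assms(1,2)]] by eventually_elim (simp add: inner_add_left)
  qed (intro borel_measurable_integrable Bochner_Integration.integrable_add jac_inner_integrable H1v_add assms)+
  then show ?thesis using assms by (simp add: jac_inner_def jac_inner_integrable)
qed

lemma jac_inner_scale_left:
  assumes "u \<in> H1_per0_vec" "w \<in> H1_per0_vec"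
  shows "jac_inner (\<lambda>x. c *\<^sub>R u x) w = c * jac_inner u w"
proof -
  have "jac_inner (\<lambda>x. c *\<^sub>R u x) w = (LINT x|cell. c * (weak_jacobian u x \<bullet> weak_jacobian w x))"
    unfolding jac_inner_def
  proof (rule integral_cong_AE)
    show "AE x in cell. weak_jacobian (\<lambda>x. c *\<^sub>R u x) x \<bullet> weak_jacobian w x = c * (weak_jacobian u x \<bullet> weak_jacobian w x)"
      using AE_cellI[OF weak_jacobian_scale[OF assms(1), of c]] by eventually_elim simp
  qed (intro borel_measurable_integrable integrable_mult_right jac_inner_integrable H1v_scale assms)+
  then show ?thesis by (simp add: jac_inner_def)
qed

lemma norm_vec_square: "(norm (v :: real^'n))\<^sup>2 = (\<Sum>i\<in>UNIV. (v $ i)\<^sup>2)"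
  by (simp only: power2_norm_eq_inner inner_vec_def) (simp add: power2_eq_square)

lemma integrable_norm_square:
  assumes "w \<in> H1_per0_vec"
  shows "integrable cell (\<lambda>x. (norm (w x))\<^sup>2)"
    "(LINT x|cell. (norm (w x))\<^sup>2) = (\<Sum>i\<in>UNIV. LINT x|cell. (w x $ i)\<^sup>2)"
  using H1v_D(5)[OF assms, THEN sq_integrable_square]
  by (simp_all add: norm_vec_square Bochner_Integration.integral_sum)

lemma Poincare_vec:
  assumes "w \<in> H1_per0_vec"
  shows "(LINT x|cell. (norm (w x))\<^sup>2) \<le> 1 / (4 * pi\<^sup>2) * jac_inner w w"
proof -
  have "(LINT x|cell. (norm (w x))\<^sup>2) \<le> (\<Sum>i\<in>UNIV. 1 / (4 * pi\<^sup>2) * (\<Sum>j\<in>UNIV. LINT x|cell. (weak_partial j (\<lambda>y. w y $ i) x)\<^sup>2))"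
    unfolding integrable_norm_square(2)[OF assms] by (intro sum_mono Poincare H1v_D(1) assms)
  then show ?thesis
    by (simp only: jac_inner_sum[OF assms assms] sum_distrib_left power2_eq_square)
qed

lemma H1_norm_cell_square:
  assumes "w \<in> H1_per0_vec"
  shows "(H1_norm_cell w)\<^sup>2 = (LINT x|cell. (norm (w x))\<^sup>2) + jac_inner w w"
  by (simp add: H1_norm_cell_def L2_norm_cell_def int_cell_eq jac_inner_def power2_norm_eq_inner)

text \<open>This reconciles the full norm on the left of the final estimate with the derivative norm
  on its right; the factor enters the constant there.\<close>

lemma H1_norm_cell_le:
  assumes "w \<in> H1_per0_vec"
  shows "H1_norm_cell w \<le> sqrt (1 + 1 / (4 * pi\<^sup>2)) * sqrt (jac_inner w w)"
proof (rule power2_le_imp_le)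
  have "(LINT x|cell. (norm (w x))\<^sup>2) + jac_inner w w \<le> (1 + 1 / (4 * pi\<^sup>2)) * jac_inner w w"
    using Poincare_vec[OF assms] by (simp add: distrib_right)
  then show "(H1_norm_cell w)\<^sup>2 \<le> (sqrt (1 + 1 / (4 * pi\<^sup>2)) * sqrt (jac_inner w w))\<^sup>2"
    by (simp add: H1_norm_cell_square[OF assms] power_mult_distrib jac_inner_nonneg)
  show "0 \<le> sqrt (1 + 1 / (4 * pi\<^sup>2)) * sqrt (jac_inner w w)" by (simp add: jac_inner_nonneg)
qed

lemma jac_inner_component_le:
  assumes "w \<in> H1_per0_vec"
  shows "(LINT x|cell. (weak_partial j (\<lambda>y. w y $ i) x)\<^sup>2) \<le> jac_inner w w"
    "(LINT x|cell. (w x $ i)\<^sup>2) \<le> jac_inner w w"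
proof -
  define T where "T i j = (LINT x|cell. (weak_partial j (\<lambda>y. w y $ i) x)\<^sup>2)" for i j
  have T: "T i j \<ge> 0" for i j by (simp add: T_def)
  have e: "jac_inner w w = (\<Sum>i\<in>UNIV. \<Sum>j\<in>UNIV. T i j)"
    by (simp add: jac_inner_sum[OF assms assms] T_def power2_eq_square)
  have "T i j \<le> (\<Sum>j\<in>UNIV. T i j)" by (rule member_le_sum) (auto simp: T)
  also have "\<dots> \<le> (\<Sum>i\<in>UNIV. \<Sum>j\<in>UNIV. T i j)"
    by (rule member_le_sum[where f = "\<lambda>i. \<Sum>j\<in>UNIV. T i j"]) (auto intro!: sum_nonneg T)
  finally show "(LINT x|cell. (weak_partial j (\<lambda>y. w y $ i) x)\<^sup>2) \<le> jac_inner w w" by (simp add: e T_def)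
  have "(LINT x|cell. (w x $ i)\<^sup>2) \<le> (\<Sum>i\<in>UNIV. LINT x|cell. (w x $ i)\<^sup>2)"
    by (rule member_le_sum[where f = "\<lambda>i. LINT x|cell. (w x $ i)\<^sup>2"]) auto
  also have "\<dots> \<le> 1 / (4 * pi\<^sup>2) * jac_inner w w"
    using Poincare_vec[OF assms] by (simp add: integrable_norm_square(2)[OF assms])
  also have "\<dots> \<le> 1 * jac_inner w w"
  proof (rule mult_right_mono[OF _ jac_inner_nonneg])
    have "1 \<le> pi\<^sup>2" using pi_ge_two by (simp add: one_le_power)
    then show "1 / (4 * pi\<^sup>2) \<le> 1" by simp
  qed
  finally show "(LINT x|cell. (w x $ i)\<^sup>2) \<le> jac_inner w w" by simp
qed

lemma jac_inner_zero_imp_AE: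
  assumes "w \<in> H1_per0_vec" "jac_inner w w = 0"
  shows "AE x in lebesgue. w x = 0"
proof -
  have "AE x in lebesgue. w x $ i = 0" for i
  proof -
    have "(LINT x|cell. (w x $ i)\<^sup>2) = 0"
      using jac_inner_component_le(2)[OF assms(1), of i] assms(2) by (simp add: antisym)
    then have "AE x in cell. (w x $ i)\<^sup>2 = 0"
      using integral_nonneg_eq_0_iff_AE[OF sq_integrable_square[OF H1v_D(5)[OF assms(1)]], of i] by simp
    then have "AE x in cell. w x $ i = 0" by simp
    moreover have "periodic (\<lambda>x::real^'a. 0::real)" by (simp add: periodic_def)
    ultimately show ?thesis by (intro periodic_AE_eq[OF L2_perD(2)[OF H1v_D(4)[OF assms(1)]]])
  qed
  then have "AE x in lebesgue. \<forall>i. w x $ i = 0" by (simp add: AE_all_countable)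
  then show ?thesis by eventually_elim (simp add: vec_eq_iff)
qed

text \<open>Components and entries of the Jacobian converge separately in L2, and
  \<open>has_weak_partial_limit\<close> matches them. Both convergences are stated: the first is
  what \<open>function_hilbert\<close> asks for, the second is what closedness of a subspace refers
  to.\<close>

lemma H1_per0_vec_complete:
  fixes u :: "nat \<Rightarrow> real^'n \<Rightarrow> real^'n"
  assumes u: "\<And>n. u n \<in> H1_per0_vec"
    and C: "\<And>e. e > 0 \<Longrightarrow> \<exists>N. \<forall>m\<ge>N. \<forall>n\<ge>N. jac_inner (\<lambda>x. u m x - u n x) (\<lambda>x. u m x - u n x) < e"
  shows "\<exists>v\<in>H1_per0_vec. (\<lambda>n. jac_inner (\<lambda>x. u n x - v x) (\<lambda>x. u n x - v x)) \<longlonglongrightarrow> 0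
    \<and> (\<lambda>n. H1_norm_cell (\<lambda>x. u n x - v x)) \<longlonglongrightarrow> 0"
proof -
  define D where "D n i j = weak_partial j (\<lambda>y. u n y $ i)" for n i j
  have jac: "AE x in cell. weak_partial j (\<lambda>y. (u m y - u n y) $ i) x = D m i j x - D n i j x" for m n i j
    using AE_cellI[OF weak_partial_AE[OF has_weak_partial_diff[OF H1v_D(6)[OF u[of m], where i = i and j = j]
          H1v_D(6)[OF u[of n], where i = i]]]]
    unfolding D_def vector_minus_component .
  have "\<exists>f\<in>L2_per. (\<lambda>n. LINT x|cell. (u n x $ i - f x)\<^sup>2) \<longlonglongrightarrow> 0" for i
  proof -
    have C': "\<exists>N. \<forall>m\<ge>N. \<forall>n\<ge>N. (LINT x|cell. (u m x $ i - u n x $ i)\<^sup>2) < e" if "e > 0" for e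
    proof -
      obtain N where N: "\<And>m n. m \<ge> N \<Longrightarrow> n \<ge> N \<Longrightarrow> jac_inner (\<lambda>x. u m x - u n x) (\<lambda>x. u m x - u n x) < e"
        using C[OF \<open>e > 0\<close>] by blast
      have "(LINT x|cell. (u m x $ i - u n x $ i)\<^sup>2) < e" if "m \<ge> N" "n \<ge> N" for m n
        using N[OF that] jac_inner_component_le(2)[OF H1v_diff[OF u[of m] u[of n]], of i] by simp
      then show ?thesis by blast
    qed
    obtain f where "f \<in> L2_per" "(\<lambda>n. LINT x|cell. (u n x $ i - f x)\<^sup>2) \<longlonglongrightarrow> 0"
      by (rule L2_per_complete[of "\<lambda>n x. u n x $ i", OF H1v_D(4)[OF u] C'])
    then show ?thesis by blast
  qed
  then have "\<forall>i. \<exists>f. f \<in> L2_per \<and> (\<lambda>n. LINT x|cell. (u n x $ i - f x)\<^sup>2) \<longlonglongrightarrow> 0" by blast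
  from choice[OF this] obtain f
    where f': "\<forall>i. f i \<in> L2_per \<and> (\<lambda>n. LINT x|cell. (u n x $ i - f i x)\<^sup>2) \<longlonglongrightarrow> 0" ..
  have f: "f i \<in> L2_per" "(\<lambda>n. LINT x|cell. (u n x $ i - f i x)\<^sup>2) \<longlonglongrightarrow> 0" for i
    using spec[OF f', of i] by auto
  have "\<exists>g\<in>L2_per. (\<lambda>n. LINT x|cell. (D n i j x - g x)\<^sup>2) \<longlonglongrightarrow> 0" for i j
  proof -
    have C': "\<exists>N. \<forall>m\<ge>N. \<forall>n\<ge>N. (LINT x|cell. (D m i j x - D n i j x)\<^sup>2) < e" if "e > 0" for e
    proof -
      obtain N where N: "\<And>m n. m \<ge> N \<Longrightarrow> n \<ge> N \<Longrightarrow> jac_inner (\<lambda>x. u m x - u n x) (\<lambda>x. u m x - u n x) < e"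
        using C[OF \<open>e > 0\<close>] by blast
      have "(LINT x|cell. (D m i j x - D n i j x)\<^sup>2) < e" if "m \<ge> N" "n \<ge> N" for m n
      proof -
        have "(LINT x|cell. (D m i j x - D n i j x)\<^sup>2) = (LINT x|cell. (weak_partial j (\<lambda>y. (u m y - u n y) $ i) x)\<^sup>2)"
        proof (rule integral_cong_AE)
          show "AE x in cell. (D m i j x - D n i j x)\<^sup>2 = (weak_partial j (\<lambda>y. (u m y - u n y) $ i) x)\<^sup>2"
            using jac[of j m n i] by eventually_elim simp
          show "(\<lambda>x. (D m i j x - D n i j x)\<^sup>2) \<in> borel_measurable cell"
            unfolding D_def by (intro borel_measurable_integrable sq_integrable_square sq_integrable_diff H1v_D(8) u)
          show "(\<lambda>x. (weak_partial j (\<lambda>y. (u m y - u n y) $ i) x)\<^sup>2) \<in> borel_measurable cell"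
            by (intro borel_measurable_integrable sq_integrable_square H1v_D(8) H1v_diff u)
        qed
        also have "\<dots> \<le> jac_inner (\<lambda>x. u m x - u n x) (\<lambda>x. u m x - u n x)"
          by (rule jac_inner_component_le(1)[OF H1v_diff[OF u u]])
        finally show ?thesis using N[OF that] by simp
      qed
      then show ?thesis by blast
    qed
    obtain g where "g \<in> L2_per" "(\<lambda>n. LINT x|cell. (D n i j x - g x)\<^sup>2) \<longlonglongrightarrow> 0"
      by (rule L2_per_complete[of "\<lambda>n. D n i j", OF _ C']) (auto simp: D_def intro: H1v_D(7) u)
    then show ?thesis by blast
  qed
  \<comment> \<open>Indexing by pairs lets a single application of choice produce the whole matrix
    of limits.\<close>
  then have "\<forall>p. \<exists>g. g \<in> L2_per \<and> (\<lambda>n. LINT x|cell. (D n (fst p) (snd p) x - g x)\<^sup>2) \<longlonglongrightarrow> 0" by blast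
  from choice[OF this] obtain G
    where G: "\<forall>p. G p \<in> L2_per \<and> (\<lambda>n. LINT x|cell. (D n (fst p) (snd p) x - G p x)\<^sup>2) \<longlonglongrightarrow> 0" ..
  define g where "g i j = G (i, j)" for i j
  have g: "g i j \<in> L2_per" "(\<lambda>n. LINT x|cell. (D n i j x - g i j x)\<^sup>2) \<longlonglongrightarrow> 0" for i j
    using spec[OF G, of "(i, j)"] by (auto simp: g_def)
  have w: "has_weak_partial j (f i) (g i j)" for i j
    by (rule has_weak_partial_limit[OF _ _ _ f(1) g(1) f(2) g(2)]) (auto simp: D_def intro: H1v_D u)
  define v where "v x = (\<chi> i. f i x)" for x
  have v: "v \<in> H1_per0_vec"
  proof -
    have "f i \<in> H_per 1" for i using f(1) g(1) w unfolding H_per1_iff by blast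
    moreover have "(LINT x|cell. f i x) = 0" for i
    proof -
      have "(\<lambda>n. LINT x|cell. u n x $ i * 1) \<longlonglongrightarrow> (LINT x|cell. f i x * 1)"
        by (intro L2_tendsto_integral_mult H1v_D(5) u L2_perD(3) f cell.sq_integrable_const)
      then show ?thesis using LIMSEQ_unique[OF _ tendsto_const] by (simp add: H1v_D(3)[OF u])
    qed
    ultimately show ?thesis by (simp add: H1_per0_vec_def H_per0_def v_def int_cell_eq del: One_nat_def)
  qed
  define d where "d n x = u n x - v x" for n x
  have d: "d n \<in> H1_per0_vec" for n unfolding d_def by (rule H1v_diff[OF u v])
  have dj: "(LINT x|cell. (weak_partial j (\<lambda>y. d n y $ i) x)\<^sup>2) = (LINT x|cell. (D n i j x - g i j x)\<^sup>2)" for n i j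
  proof (rule integral_cong_AE)
    have "AE x in cell. weak_partial j (\<lambda>y. u n y $ i - f i y) x = D n i j x - g i j x"
      unfolding D_def by (rule AE_cellI[OF weak_partial_AE[OF has_weak_partial_diff[OF H1v_D(6)[OF u] w]]])
    then show "AE x in cell. (weak_partial j (\<lambda>y. d n y $ i) x)\<^sup>2 = (D n i j x - g i j x)\<^sup>2"
      by eventually_elim (simp add: d_def v_def)
    show "(\<lambda>x. (weak_partial j (\<lambda>y. d n y $ i) x)\<^sup>2) \<in> borel_measurable cell"
      by (intro borel_measurable_integrable sq_integrable_square H1v_D(8) d)
    show "(\<lambda>x. (D n i j x - g i j x)\<^sup>2) \<in> borel_measurable cell"
      unfolding D_def by (intro borel_measurable_integrable sq_integrable_square sq_integrable_diff H1v_D(8) u L2_perD(3) g)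
  qed
  have "(\<lambda>n. jac_inner (d n) (d n)) = (\<lambda>n. \<Sum>i\<in>UNIV. \<Sum>j\<in>UNIV. LINT x|cell. (D n i j x - g i j x)\<^sup>2)"
    by (simp add: jac_inner_sum[OF d d] dj power2_eq_square[symmetric])
  moreover have "(\<lambda>n. \<Sum>i\<in>UNIV. \<Sum>j\<in>UNIV. LINT x|cell. (D n i j x - g i j x)\<^sup>2) \<longlonglongrightarrow> (\<Sum>i\<in>(UNIV::'n set). \<Sum>j\<in>(UNIV::'n set). 0)"
    by (intro tendsto_sum g)
  ultimately have lim: "(\<lambda>n. jac_inner (d n) (d n)) \<longlonglongrightarrow> 0" by simp
  have "(\<lambda>n. sqrt (1 + 1 / (4 * pi\<^sup>2)) * sqrt (jac_inner (d n) (d n))) \<longlonglongrightarrow> 0"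
    using tendsto_mult_right_zero[OF tendsto_real_sqrt[OF lim, simplified]] .
  then have "(\<lambda>n. H1_norm_cell (d n)) \<longlonglongrightarrow> 0"
    by (rule Lim_null_comparison[OF always_eventually, rotated])
      (use H1_norm_cell_le[OF d] in \<open>simp add: H1_norm_cell_def\<close>)
  with lim v show ?thesis unfolding d_def by blast
qed

lemma closed_subspace_function_hilbert:
  assumes P: "closed_subspace_H1_per0 P"
  shows "function_hilbert P jac_inner"
proof
  have sub: "P \<subseteq> H1_per0_vec" using P by (simp add: closed_subspace_H1_per0_def)
  show "(\<lambda>x. 0) \<in> P" using P by (simp add: closed_subspace_H1_per0_def)
  show "(\<lambda>x. u x + v x) \<in> P" if "u \<in> P" "v \<in> P" for u v using P that by (simp add: closed_subspace_H1_per0_def)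
  show "(\<lambda>x. c *\<^sub>R u x) \<in> P" if "u \<in> P" for u c using P that by (simp add: closed_subspace_H1_per0_def)
  show "jac_inner u v = jac_inner v u" for u v by (rule jac_inner_sym)
  show "jac_inner (\<lambda>x. u x + v x) w = jac_inner u w + jac_inner v w" if "u \<in> P" "v \<in> P" "w \<in> P" for u v w
    using that sub by (intro jac_inner_add_left) auto
  show "jac_inner (\<lambda>x. c *\<^sub>R u x) w = c * jac_inner u w" if "u \<in> P" "w \<in> P" for u w c
    using that sub by (intro jac_inner_scale_left) auto
  show "0 \<le> jac_inner u u" for u by (rule jac_inner_nonneg)
  fix s :: "nat \<Rightarrow> real^'a \<Rightarrow> real^'a"
  assume s: "\<And>n. s n \<in> P"
    and C: "\<And>e. e > 0 \<Longrightarrow> \<exists>N. \<forall>m\<ge>N. \<forall>n\<ge>N. jac_inner (\<lambda>x. s m x - s n x) (\<lambda>x. s m x - s n x) < e"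
  have sH: "s n \<in> H1_per0_vec" for n using s sub by blast
  obtain v where v: "v \<in> H1_per0_vec" "(\<lambda>n. jac_inner (\<lambda>x. s n x - v x) (\<lambda>x. s n x - v x)) \<longlonglongrightarrow> 0"
    "(\<lambda>n. H1_norm_cell (\<lambda>x. s n x - v x)) \<longlonglongrightarrow> 0"
    using H1_per0_vec_complete[of s, OF sH C] by blast
  have "v \<in> P" using P s v unfolding closed_subspace_H1_per0_def by blast
  with v show "\<exists>v\<in>P. (\<lambda>n. jac_inner (\<lambda>x. s n x - v x) (\<lambda>x. s n x - v x)) \<longlonglongrightarrow> 0" by blast
qed

section \<open>The Cordes condition and the bilinear form\<close>

lemma trace_eq_inner: "trace M = (mat 1 :: real^'n^'n) \<bullet> M"
  by (simp add: trace_def inner_matrix mat_def if_distrib[of "\<lambda>t. t * _"] cong: if_cong)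

lemma inner_mat_mat: "(mat 1 :: real^'n^'n) \<bullet> mat 1 = real CARD('n)"
proof -
  have "trace (mat 1 :: real^'n^'n) = real CARD('n)" by (simp add: trace_def mat_def)
  then show ?thesis by (simp only: trace_eq_inner)
qed

text \<open>Expanding the squared distance of the pair (g A, g b) from (I, 0) gives g^2 S - 2 g tr A
  + n with S = |A|^2 + |b|^2, and \<open>g\<close> is its minimizer. The minimum n - (tr A)^2 / S is
  at most 1 - \<delta> by the Cordes condition. The bound on \<open>1 / g\<close> later makes the
  weighted density square integrable.\<close>

lemma Cordes_pointwise:
  fixes A :: "real^'n^'n" and b :: "real^'n"
  assumes tr: "trace A > 0"
    and cordes: "((norm A)\<^sup>2 + (norm b)\<^sup>2) / (trace A)\<^sup>2 \<le> 1 / (real CARD('n) - 1 + \<delta>)"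
    and \<delta>: "0 < \<delta>"
  defines "g \<equiv> trace A / ((norm A)\<^sup>2 + (norm b)\<^sup>2)"
  shows "0 < g" "(norm (g *\<^sub>R A - mat 1))\<^sup>2 + (norm (g *\<^sub>R b))\<^sup>2 \<le> 1 - \<delta>"
    "1 / g \<le> trace A / (real CARD('n) - 1 + \<delta>)"
proof -
  define S where "S = (norm A)\<^sup>2 + (norm b)\<^sup>2"
  define k where "k = real CARD('n) - 1 + \<delta>"
  have "1 \<le> real CARD('n)" by (simp add: Suc_leI)
  then have k: "k > 0" using \<delta> unfolding k_def by linarith
  have "A \<noteq> 0" using tr by (auto simp: trace_def)
  then have S: "S > 0" by (simp add: S_def add_pos_nonneg)
  have g: "g = trace A / S" by (simp add: g_def S_def)
  show "0 < g" using tr S by (simp add: g)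
  have "S / (trace A)\<^sup>2 \<le> 1 / k" using cordes by (simp add: S_def k_def)
  then have Sk: "S * k \<le> (trace A)\<^sup>2" using tr k by (simp add: field_simps)
  have "(norm (g *\<^sub>R A - mat 1))\<^sup>2 = g\<^sup>2 * (norm A)\<^sup>2 - 2 * g * trace A + real CARD('n)"
    by (simp only: power2_norm_eq_inner inner_diff_left inner_diff_right inner_scaleR_left inner_scaleR_right
        inner_mat_mat trace_eq_inner inner_commute[of A "mat 1"])
      (simp add: power2_eq_square algebra_simps)
  then have "(norm (g *\<^sub>R A - mat 1))\<^sup>2 + (norm (g *\<^sub>R b))\<^sup>2 = g\<^sup>2 * S - 2 * g * trace A + real CARD('n)"
    by (simp add: S_def power_mult_distrib distrib_left)
  also have "\<dots> = real CARD('n) - (trace A)\<^sup>2 / S"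
    using S by (simp add: g field_simps power2_eq_square)
  also have "\<dots> \<le> real CARD('n) - k"
    using Sk S by (simp add: field_simps)
  finally show "(norm (g *\<^sub>R A - mat 1))\<^sup>2 + (norm (g *\<^sub>R b))\<^sup>2 \<le> 1 - \<delta>" by (simp add: k_def)
  have "S / trace A \<le> trace A / k" using Sk tr k by (simp add: field_simps power2_eq_square)
  then show "1 / g \<le> trace A / (real CARD('n) - 1 + \<delta>)" by (simp add: g k_def)
qed

lemma Cauchy_Schwarz_pair:
  fixes X M :: "'a::real_inner" and y p :: "'b::real_inner"
  shows "(X \<bullet> M + y \<bullet> p)\<^sup>2 \<le> ((norm X)\<^sup>2 + (norm y)\<^sup>2) * ((norm M)\<^sup>2 + (norm p)\<^sup>2)"
proof -
  have "(X \<bullet> M + y \<bullet> p)\<^sup>2 = ((X, y) \<bullet> (M, p))\<^sup>2" by simp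
  also have "\<dots> \<le> ((X, y) \<bullet> (X, y)) * ((M, p) \<bullet> (M, p))" by (rule Cauchy_Schwarz_ineq)
  also have "\<dots> = ((norm X)\<^sup>2 + (norm y)\<^sup>2) * ((norm M)\<^sup>2 + (norm p)\<^sup>2)"
    by (simp add: power2_norm_eq_inner)
  finally show ?thesis .
qed

text \<open>Testing ellipticity with the unit vectors bounds the diagonal entries.\<close>

lemma trace_bounds:
  fixes A :: "real^'n^'n"
  assumes "\<forall>v. lam * (v \<bullet> v) \<le> v \<bullet> (A *v v) \<and> v \<bullet> (A *v v) \<le> Lam * (v \<bullet> v)"
  shows "real CARD('n) * lam \<le> trace A" "trace A \<le> real CARD('n) * Lam"
proof -
  have "lam \<le> A $ i $ i \<and> A $ i $ i \<le> Lam" for i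
    using assms[rule_format, of "axis i 1"]
    by (simp add: inner_axis_axis inner_axis' matrix_vector_mult_basis column_def)
  then show "real CARD('n) * lam \<le> trace A" "trace A \<le> real CARD('n) * Lam"
    using sum_bounded_below[of UNIV lam "\<lambda>i. A $ i $ i"] sum_bounded_above[of UNIV "\<lambda>i. A $ i $ i" Lam]
    by (auto simp: trace_def)
qed

lemma setting_B_D:
  fixes A :: "real^'n \<Rightarrow> real^'n^'n"
  assumes "setting_B lam Lam \<delta> A b"
  shows "A \<in> borel_measurable lebesgue" "b \<in> borel_measurable lebesgue" "0 < \<delta>" "\<delta> \<le> 1"
    "real CARD('n) / (real CARD('n) + pi\<^sup>2) < \<delta>"
    "AE x in lebesgue. 0 < gam A b x \<and> 1 / gam A b x \<le> real CARD('n) * Lam / (real CARD('n) - 1 + \<delta>) \<and>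
       (norm (A_tilde A b x - mat 1))\<^sup>2 + (norm (b_tilde A b x))\<^sup>2 \<le> 1 - \<delta>"
proof -
  show "A \<in> borel_measurable lebesgue" "b \<in> borel_measurable lebesgue" "\<delta> \<le> 1"
    and d: "real CARD('n) / (real CARD('n) + pi\<^sup>2) < \<delta>"
    using assms by (auto simp: setting_B_def Linf_per_def)
  have "0 \<le> real CARD('n) / (real CARD('n) + pi\<^sup>2)" by simp
  with d show \<delta>: "0 < \<delta>" by linarith
  have lam: "0 < lam" using assms by (simp add: setting_B_def)
  have "AE x in lebesgue. \<forall>v. lam * (v \<bullet> v) \<le> v \<bullet> (A x *v v) \<and> v \<bullet> (A x *v v) \<le> Lam * (v \<bullet> v)"
    "AE x in lebesgue. ((norm (A x))\<^sup>2 + (norm (b x))\<^sup>2) / (trace (A x))\<^sup>2 \<le> 1 / (real CARD('n) - 1 + \<delta>)"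
    using assms by (auto simp: setting_B_def)
  then show "AE x in lebesgue. 0 < gam A b x \<and> 1 / gam A b x \<le> real CARD('n) * Lam / (real CARD('n) - 1 + \<delta>) \<and>
       (norm (A_tilde A b x - mat 1))\<^sup>2 + (norm (b_tilde A b x))\<^sup>2 \<le> 1 - \<delta>"
  proof eventually_elim
    case (elim x)
    have tr: "real CARD('n) * lam \<le> trace (A x)" "trace (A x) \<le> real CARD('n) * Lam"
      using trace_bounds[OF elim(1)] by auto
    have "0 < real CARD('n) * lam" using lam by simp
    with tr have pos: "0 < trace (A x)" by linarith
    have "1 \<le> real CARD('n)" by (simp add: Suc_leI)
    then have "trace (A x) / (real CARD('n) - 1 + \<delta>) \<le> real CARD('n) * Lam / (real CARD('n) - 1 + \<delta>)"
      using tr(2) \<delta> by (intro divide_right_mono) auto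
    then show ?case
      using Cordes_pointwise[OF pos elim(2) \<delta>] by (auto simp: gam_def A_tilde_def b_tilde_def)
  qed
qed

text \<open>Stated for vector fields, so that it serves \<open>B2\<close> directly and
  \<open>B1\<close> through gradients.\<close>

definition nondiv_op :: "(real^'n \<Rightarrow> real^'n^'n) \<Rightarrow> (real^'n \<Rightarrow> real^'n) \<Rightarrow> (real^'n \<Rightarrow> real^'n) \<Rightarrow> real^'n \<Rightarrow> real" where
  "nondiv_op A b w x = A_tilde A b x \<bullet> weak_jacobian w x + b_tilde A b x \<bullet> w x"

text \<open>The error made in replacing \<open>A_tilde\<close> by the identity and
  \<open>b_tilde\<close> by 0.\<close>

definition residual :: "(real^'n \<Rightarrow> real^'n^'n) \<Rightarrow> (real^'n \<Rightarrow> real^'n) \<Rightarrow> (real^'n \<Rightarrow> real^'n) \<Rightarrow> real^'n \<Rightarrow> real" where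
  "residual A b w x = nondiv_op A b w x - divergence w x"

lemma divergence_trace: "divergence w x = trace (weak_jacobian w x)"
  by (simp add: divergence_def trace_def weak_jacobian_def)

lemma sq_integrable_divergence: "w \<in> H1_per0_vec \<Longrightarrow> sq_integrable cell (divergence w)"
  unfolding divergence_def[abs_def] by (intro sq_integrable_sum H1v_D(8))

lemma measurable_component:
  fixes b :: "real^'n \<Rightarrow> real^'n"
  assumes "b \<in> borel_measurable M"
  shows "(\<lambda>x. b x $ i) \<in> borel_measurable M"
proof -
  have "(\<lambda>x. b x \<bullet> axis i 1) \<in> borel_measurable M" using assms by simp
  then show ?thesis by (simp add: inner_axis)
qed

lemma measurable_entry:
  fixes A :: "real^'n \<Rightarrow> real^'n^'n"
  assumes "A \<in> borel_measurable M"
  shows "(\<lambda>x. A x $ i $ j) \<in> borel_measurable M"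
proof -
  have "(\<lambda>x. A x \<bullet> axis i (axis j 1)) \<in> borel_measurable M" using assms by simp
  then show ?thesis by (simp add: inner_axis)
qed

lemma measurable_gam:
  assumes "A \<in> borel_measurable M" "b \<in> borel_measurable M"
  shows "gam A b \<in> borel_measurable M"
  unfolding gam_def[abs_def] trace_def using assms measurable_entry[OF assms(1)] by simp

lemma residual_square_le:
  assumes B: "setting_B lam Lam \<delta> A b"
  shows "AE x in lebesgue. (residual A b w x)\<^sup>2 \<le> (1 - \<delta>) * (weak_jacobian w x \<bullet> weak_jacobian w x + (norm (w x))\<^sup>2)"
  using setting_B_D(6)[OF B]
proof eventually_elim
  case (elim x)
  let ?M = "weak_jacobian w x"
  have "residual A b w x = (A_tilde A b x - mat 1) \<bullet> ?M + b_tilde A b x \<bullet> w x"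
    by (simp add: residual_def nondiv_op_def divergence_trace trace_eq_inner inner_diff_left)
  then have "(residual A b w x)\<^sup>2 \<le> ((norm (A_tilde A b x - mat 1))\<^sup>2 + (norm (b_tilde A b x))\<^sup>2) * ((norm ?M)\<^sup>2 + (norm (w x))\<^sup>2)"
    by (simp only: Cauchy_Schwarz_pair)
  also have "\<dots> \<le> (1 - \<delta>) * ((norm ?M)\<^sup>2 + (norm (w x))\<^sup>2)"
    using elim by (intro mult_right_mono) auto
  finally show ?case by (simp add: power2_norm_eq_inner)
qed

lemma measurable_nondiv_op:
  assumes B: "setting_B lam Lam \<delta> A b" and w: "w \<in> H1_per0_vec"
  shows "nondiv_op A b w \<in> borel_measurable cell"
proof -
  have A: "A \<in> borel_measurable cell" "b \<in> borel_measurable cell"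
    using setting_B_D(1,2)[OF B] by (auto intro: measurable_restrict_space1)
  have "nondiv_op A b w = (\<lambda>x. (\<Sum>i\<in>UNIV. \<Sum>j\<in>UNIV. gam A b x * A x $ i $ j * weak_partial j (\<lambda>y. w y $ i) x)
      + (\<Sum>i\<in>UNIV. gam A b x * b x $ i * w x $ i))"
    by (auto simp: nondiv_op_def A_tilde_def b_tilde_def inner_vec_def weak_jacobian_def sum_distrib_left mult.assoc)
  also have "\<dots> \<in> borel_measurable cell"
    by (intro borel_measurable_add borel_measurable_sum borel_measurable_times measurable_gam measurable_entry
        measurable_component A sq_integrable_measurable H1v_D(8) H1v_D(5) w)
  finally show ?thesis .
qed

text \<open>The pointwise Cordes bound leaves a term without derivatives, which
  \<open>Poincare_vec\<close> absorbs.\<close>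

lemma residual_bound:
  assumes B: "setting_B lam Lam \<delta> A b" and w: "w \<in> H1_per0_vec"
  shows "sq_integrable cell (residual A b w)"
    "(LINT x|cell. (residual A b w x)\<^sup>2) \<le> (1 - \<delta>) * (1 + 1 / (4 * pi\<^sup>2)) * jac_inner w w"
proof -
  have \<delta>: "0 \<le> 1 - \<delta>" using setting_B_D(4)[OF B] by simp
  have m: "residual A b w \<in> borel_measurable cell"
    unfolding residual_def[abs_def]
    by (intro borel_measurable_diff measurable_nondiv_op[OF B w] sq_integrable_measurable sq_integrable_divergence w)
  have i: "integrable cell (\<lambda>x. (1 - \<delta>) * (weak_jacobian w x \<bullet> weak_jacobian w x + (norm (w x))\<^sup>2))"
    by (intro integrable_mult_right Bochner_Integration.integrable_add jac_inner_integrable integrable_norm_square(1) w)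
  have ae: "AE x in cell. (residual A b w x)\<^sup>2 \<le> (1 - \<delta>) * (weak_jacobian w x \<bullet> weak_jacobian w x + (norm (w x))\<^sup>2)"
    by (rule AE_cellI[OF residual_square_le[OF B]])
  have i2: "integrable cell (\<lambda>x. (residual A b w x)\<^sup>2)"
  proof (rule Bochner_Integration.integrable_bound[OF i])
    show "(\<lambda>x. (residual A b w x)\<^sup>2) \<in> borel_measurable cell" using m by simp
    show "AE x in cell. norm ((residual A b w x)\<^sup>2) \<le> norm ((1 - \<delta>) * (weak_jacobian w x \<bullet> weak_jacobian w x + (norm (w x))\<^sup>2))"
      using ae
    proof eventually_elim
      case (elim x)
      have "norm ((residual A b w x)\<^sup>2) = (residual A b w x)\<^sup>2" by simp
      also note elim
      also have "(1 - \<delta>) * (weak_jacobian w x \<bullet> weak_jacobian w x + (norm (w x))\<^sup>2)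
          \<le> norm ((1 - \<delta>) * (weak_jacobian w x \<bullet> weak_jacobian w x + (norm (w x))\<^sup>2))"
        by (simp only: real_norm_def abs_ge_self)
      finally show ?case .
    qed
  qed
  then show "sq_integrable cell (residual A b w)" using m by (simp add: sq_integrable_def)
  have "(LINT x|cell. (residual A b w x)\<^sup>2) \<le> (LINT x|cell. (1 - \<delta>) * (weak_jacobian w x \<bullet> weak_jacobian w x + (norm (w x))\<^sup>2))"
    by (rule integral_mono_AE[OF i2 i ae])
  also have "\<dots> = (1 - \<delta>) * (jac_inner w w + (LINT x|cell. (norm (w x))\<^sup>2))"
    using jac_inner_integrable[OF w w] integrable_norm_square(1)[OF w] by (simp add: jac_inner_def)
  also have "\<dots> \<le> (1 - \<delta>) * (jac_inner w w + 1 / (4 * pi\<^sup>2) * jac_inner w w)"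
    by (intro mult_left_mono add_left_mono Poincare_vec w \<delta>)
  also have "\<dots> = (1 - \<delta>) * (1 + 1 / (4 * pi\<^sup>2)) * jac_inner w w" by (simp add: algebra_simps)
  finally show "(LINT x|cell. (residual A b w x)\<^sup>2) \<le> (1 - \<delta>) * (1 + 1 / (4 * pi\<^sup>2)) * jac_inner w w" .
qed

lemma sq_integrable_nondiv_op:
  assumes B: "setting_B lam Lam \<delta> A b" and w: "w \<in> H1_per0_vec"
  shows "sq_integrable cell (nondiv_op A b w)"
  using sq_integrable_add[OF residual_bound(1)[OF assms] sq_integrable_divergence[OF w]]
  by (simp add: residual_def)

section \<open>The div-curl identity and closeness of \<open>B2\<close> to the Dirichlet inner
  product\<close>

definition curl :: "(real^'n \<Rightarrow> real^'n) \<Rightarrow> real^'n \<Rightarrow> real^'n^'n" where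
  "curl w x = weak_jacobian w x - transpose (weak_jacobian w x)"

lemma curl_inner: "(M - transpose M) \<bullet> (N - transpose N) = 2 * (M \<bullet> N) - 2 * (M \<bullet> transpose N)"
  for M N :: "real^'n^'n"
proof -
  have t: "transpose M \<bullet> transpose N = M \<bullet> N" for M N :: "real^'n^'n"
    unfolding inner_matrix transpose_def by (subst sum.swap) simp
  have "transpose M \<bullet> N = M \<bullet> transpose N" using t[of M "transpose N"] by simp
  then show ?thesis by (simp add: inner_diff_left inner_diff_right t)
qed

text \<open>Expanding the curl product leaves the integral of Dv against the transpose of Dw. On the
  torus the two derivatives can be interchanged, which turns it into the integral of the product of
  the divergences.\<close>

lemma jac_inner_div_curl:
  assumes "v \<in> H1_per0_vec" "w \<in> H1_per0_vec"
  shows "jac_inner v w = (LINT x|cell. divergence v x * divergence w x) + 1/2 * (LINT x|cell. curl v x \<bullet> curl w x)"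
proof -
  note J = sq_integrable_weak_jacobian[OF assms(1)] sq_integrable_weak_jacobian[OF assms(2)]
  note JT = sq_integrable_matrix_transpose[OF J(2)]
  have "(LINT x|cell. weak_jacobian v x \<bullet> transpose (weak_jacobian w x))
      = (\<Sum>i\<in>UNIV. \<Sum>j\<in>UNIV. LINT x|cell. weak_partial j (\<lambda>y. v y $ i) x * weak_partial i (\<lambda>y. w y $ j) x)"
    unfolding integral_inner_matrix(2)[OF J(1) JT] by (simp add: weak_jacobian_def transpose_def)
  also have "\<dots> = (\<Sum>i\<in>UNIV. \<Sum>j\<in>UNIV. LINT x|cell. weak_partial i (\<lambda>y. v y $ i) x * weak_partial j (\<lambda>y. w y $ j) x)"
    by (intro sum.cong refl integral_partial_swap H1v_D(2) assms)
  also have "\<dots> = (LINT x|cell. divergence v x * divergence w x)"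
  proof -
    have "integrable cell (\<lambda>x. weak_partial i (\<lambda>y. v y $ i) x * weak_partial j (\<lambda>y. w y $ j) x)" for i j
      by (intro sq_integrable_mult H1v_D(8) assms)
    then show ?thesis
      by (simp add: divergence_def sum_product Bochner_Integration.integral_sum)
  qed
  finally have T: "(LINT x|cell. weak_jacobian v x \<bullet> transpose (weak_jacobian w x)) = (LINT x|cell. divergence v x * divergence w x)" .
  have "(LINT x|cell. curl v x \<bullet> curl w x) = 2 * jac_inner v w - 2 * (LINT x|cell. weak_jacobian v x \<bullet> transpose (weak_jacobian w x))"
    unfolding curl_def curl_inner jac_inner_def
    using integral_inner_matrix(1)[OF J] integral_inner_matrix(1)[OF J(1) JT] by simp
  then show ?thesis unfolding T by (simp add: diff_divide_distrib)
qed

text \<open>The curl part of \<open>jac_inner_div_curl\<close> is nonnegative. The pointwise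
  estimate of a trace would cost a factor n; constant 1 keeps the Cordes factor free of the
  dimension.\<close>

lemma divergence_le:
  assumes "v \<in> H1_per0_vec"
  shows "(LINT x|cell. (divergence v x)\<^sup>2) \<le> jac_inner v v"
  unfolding jac_inner_div_curl[OF assms assms] by (simp add: power2_eq_square)

lemma B2_eq:
  assumes B: "setting_B lam Lam \<delta> A b" and v: "v \<in> H1_per0_vec" and w: "w \<in> H1_per0_vec"
  shows "B2 A b v w = jac_inner v w + (LINT x|cell. divergence v x * residual A b w x)"
proof -
  have "(LINT x|cell. divergence v x * nondiv_op A b w x)
      = (LINT x|cell. divergence v x * divergence w x + divergence v x * residual A b w x)"
    by (simp add: residual_def algebra_simps)
  also have "\<dots> = (LINT x|cell. divergence v x * divergence w x) + (LINT x|cell. divergence v x * residual A b w x)"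
    by (intro Bochner_Integration.integral_add sq_integrable_mult sq_integrable_divergence residual_bound(1)[OF B] v w)
  finally show ?thesis
    unfolding B2_def int_cell_eq jac_inner_div_curl[OF v w] nondiv_op_def curl_def by simp
qed

definition Cordes_factor :: "real \<Rightarrow> real" where
  "Cordes_factor \<delta> = sqrt ((1 - \<delta>) * (1 + 1 / (4 * pi\<^sup>2)))"

lemma Cordes_factor_bounds:
  assumes "real CARD('n::finite) / (real CARD('n) + pi\<^sup>2) < \<delta>" "\<delta> \<le> 1"
  shows "0 \<le> Cordes_factor \<delta>" "Cordes_factor \<delta> < 1"
proof -
  show "0 \<le> Cordes_factor \<delta>" using assms by (simp add: Cordes_factor_def)
  have n: "1 \<le> real CARD('n)" by (simp add: Suc_leI)
  define p where "p = pi\<^sup>2"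
  have p: "p > 0" by (simp add: p_def)
  \<comment> \<open>n / (n + p) grows with n, so n = 1 gives a lower bound.\<close>
  have "1 / (1 + p) \<le> real CARD('n) / (real CARD('n) + p)"
    using n p by (simp add: field_simps)
  then have "1 / (1 + p) < \<delta>" using assms(1) by (simp add: p_def)
  then have "1 - \<delta> < p / (1 + p)" using p by (simp add: field_simps)
  \<comment> \<open>Against p / (1 + p) a Poincare constant 1 / p would give exactly 1; with 1 / (4
    p) the product stays below 1.\<close>
  then have "(1 - \<delta>) * (1 + 1 / (4 * p)) < p / (1 + p) * (1 + 1 / (4 * p))"
    using p by (intro mult_strict_right_mono) (auto simp: add_pos_pos)
  also have "p / (1 + p) * (1 + 1 / (4 * p)) = (4 * p + 1) / (4 * (1 + p))"
    using p by (simp add: divide_simps)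
  also have "\<dots> < 1" using p by (simp add: divide_less_eq)
  finally show "Cordes_factor \<delta> < 1" by (simp add: Cordes_factor_def p_def real_sqrt_lt_1_iff)
qed

lemma B2_near:
  assumes B: "setting_B lam Lam \<delta> A b" and v: "v \<in> H1_per0_vec" and w: "w \<in> H1_per0_vec"
  shows "\<bar>B2 A b v w - jac_inner v w\<bar> \<le> Cordes_factor \<delta> * sqrt (jac_inner v v) * sqrt (jac_inner w w)"
proof -
  have "\<bar>B2 A b v w - jac_inner v w\<bar> = \<bar>LINT x|cell. divergence v x * residual A b w x\<bar>"
    by (simp add: B2_eq[OF assms])
  also have "\<dots> \<le> sqrt (LINT x|cell. (divergence v x)\<^sup>2) * sqrt (LINT x|cell. (residual A b w x)\<^sup>2)"
    by (intro integral_Cauchy_Schwarz_sqrt sq_integrable_divergence residual_bound(1)[OF B] v w)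
  also have "\<dots> \<le> sqrt (jac_inner v v) * sqrt ((1 - \<delta>) * (1 + 1 / (4 * pi\<^sup>2)) * jac_inner w w)"
    using divergence_le[OF v] residual_bound(2)[OF B w] by (intro mult_mono) (auto simp: jac_inner_nonneg)
  also have "\<dots> = Cordes_factor \<delta> * sqrt (jac_inner v v) * sqrt (jac_inner w w)"
    by (simp add: Cordes_factor_def real_sqrt_mult)
  finally show ?thesis .
qed

section \<open>Bilinearity of \<open>B2\<close>\<close>

lemma divergence_add:
  assumes "u \<in> H1_per0_vec" "v \<in> H1_per0_vec"
  shows "AE x in lebesgue. divergence (\<lambda>x. u x + v x) x = divergence u x + divergence v x"
  using weak_jacobian_add[OF assms] by eventually_elim (simp add: divergence_trace trace_eq_inner inner_add_right)

lemma divergence_scale: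
  assumes "u \<in> H1_per0_vec"
  shows "AE x in lebesgue. divergence (\<lambda>x. c *\<^sub>R u x) x = c * divergence u x"
  using weak_jacobian_scale[OF assms, of c] by eventually_elim (simp add: divergence_trace trace_eq_inner)

lemma integral_divergence_add:
  assumes "u \<in> H1_per0_vec" "v \<in> H1_per0_vec" "sq_integrable cell f"
  shows "(LINT x|cell. divergence (\<lambda>x. u x + v x) x * f x) = (LINT x|cell. divergence u x * f x) + (LINT x|cell. divergence v x * f x)"
proof -
  have i: "integrable cell (\<lambda>x. divergence w x * f x)" if "w \<in> H1_per0_vec" for w
    by (intro sq_integrable_mult sq_integrable_divergence that assms(3))
  have "(LINT x|cell. divergence (\<lambda>x. u x + v x) x * f x) = (LINT x|cell. divergence u x * f x + divergence v x * f x)"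
  proof (rule integral_cong_AE)
    show "AE x in cell. divergence (\<lambda>x. u x + v x) x * f x = divergence u x * f x + divergence v x * f x"
      using AE_cellI[OF divergence_add[OF assms(1,2)]] by eventually_elim (simp add: distrib_right)
  qed (intro borel_measurable_integrable Bochner_Integration.integrable_add i H1v_add assms(1,2))+
  then show ?thesis using i assms by simp
qed

lemma integral_divergence_scale:
  assumes "u \<in> H1_per0_vec" "sq_integrable cell f"
  shows "(LINT x|cell. divergence (\<lambda>x. c *\<^sub>R u x) x * f x) = c * (LINT x|cell. divergence u x * f x)"
proof -
  have i: "integrable cell (\<lambda>x. divergence w x * f x)" if "w \<in> H1_per0_vec" for w
    by (intro sq_integrable_mult sq_integrable_divergence that assms(2))
  have "(LINT x|cell. divergence (\<lambda>x. c *\<^sub>R u x) x * f x) = (LINT x|cell. c * (divergence u x * f x))"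
  proof (rule integral_cong_AE)
    show "AE x in cell. divergence (\<lambda>x. c *\<^sub>R u x) x * f x = c * (divergence u x * f x)"
      using AE_cellI[OF divergence_scale[OF assms(1), of c]] by eventually_elim simp
  qed (intro borel_measurable_integrable integrable_mult_right i H1v_scale assms(1))+
  then show ?thesis by simp
qed

lemma residual_diff:
  assumes "u \<in> H1_per0_vec" "v \<in> H1_per0_vec"
  shows "AE x in lebesgue. residual A b (\<lambda>x. u x - v x) x = residual A b u x - residual A b v x"
  using weak_jacobian_diff[OF assms]
  by eventually_elim (simp add: residual_def nondiv_op_def divergence_trace trace_eq_inner inner_diff_right)

lemma B2_add_left:
  assumes B: "setting_B lam Lam \<delta> A b" and "u \<in> H1_per0_vec" "v \<in> H1_per0_vec" "w \<in> H1_per0_vec"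
  shows "B2 A b (\<lambda>x. u x + v x) w = B2 A b u w + B2 A b v w"
  using assms by (simp add: B2_eq[OF B] H1v_add jac_inner_add_left integral_divergence_add residual_bound(1)[OF B])

lemma B2_scale_left:
  assumes B: "setting_B lam Lam \<delta> A b" and "u \<in> H1_per0_vec" "w \<in> H1_per0_vec"
  shows "B2 A b (\<lambda>x. c *\<^sub>R u x) w = c * B2 A b u w"
  using assms by (simp add: B2_eq[OF B] H1v_scale jac_inner_scale_left integral_divergence_scale residual_bound(1)[OF B] distrib_left)

lemma jac_inner_diff_right:
  assumes "u \<in> H1_per0_vec" "v \<in> H1_per0_vec" "w \<in> H1_per0_vec"
  shows "jac_inner w (\<lambda>x. u x - v x) = jac_inner w u - jac_inner w v"
  using jac_inner_add_left[OF assms(1) H1v_scale[OF assms(2), of "-1"] assms(3)]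
    jac_inner_scale_left[OF assms(2,3), of "-1"] by (simp add: jac_inner_sym[of w])

lemma B2_diff_right:
  assumes B: "setting_B lam Lam \<delta> A b" and u: "u \<in> H1_per0_vec" and v: "v \<in> H1_per0_vec" and w: "w \<in> H1_per0_vec"
  shows "B2 A b w (\<lambda>x. u x - v x) = B2 A b w u - B2 A b w v"
proof -
  have i: "integrable cell (\<lambda>x. divergence w x * residual A b z x)" if "z \<in> H1_per0_vec" for z
    by (intro sq_integrable_mult sq_integrable_divergence residual_bound(1)[OF B] w that)
  have "(LINT x|cell. divergence w x * residual A b (\<lambda>x. u x - v x) x)
      = (LINT x|cell. divergence w x * residual A b u x - divergence w x * residual A b v x)"
  proof (rule integral_cong_AE)
    show "AE x in cell. divergence w x * residual A b (\<lambda>x. u x - v x) x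
        = divergence w x * residual A b u x - divergence w x * residual A b v x"
      using AE_cellI[OF residual_diff[OF u v, of A b]] by eventually_elim (simp add: right_diff_distrib)
  qed (intro borel_measurable_integrable Bochner_Integration.integrable_diff i H1v_diff u v)+
  then show ?thesis using i u v w by (simp add: B2_eq[OF B] H1v_diff jac_inner_diff_right)
qed

section \<open>Coercivity, Galerkin problems and quasi-optimality\<close>

lemma B2_coercive:
  assumes B: "setting_B lam Lam \<delta> A b" and v: "v \<in> H1_per0_vec"
  shows "(1 - Cordes_factor \<delta>) * jac_inner v v \<le> B2 A b v v"
proof -
  have "sqrt (jac_inner v v) * sqrt (jac_inner v v) = jac_inner v v" by (simp add: jac_inner_nonneg)
  then have "\<bar>B2 A b v v - jac_inner v v\<bar> \<le> Cordes_factor \<delta> * jac_inner v v"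
    using B2_near[OF B v v] by (simp add: mult.assoc)
  then show ?thesis by (simp add: left_diff_distrib abs_le_iff)
qed

lemma jac_inner_Cauchy_Schwarz:
  assumes "v \<in> H1_per0_vec" "w \<in> H1_per0_vec"
  shows "\<bar>jac_inner v w\<bar> \<le> sqrt (jac_inner v v) * sqrt (jac_inner w w)"
proof -
  have "closed_subspace_H1_per0 (H1_per0_vec :: (real^'a \<Rightarrow> real^'a) set)"
    by (simp add: closed_subspace_H1_per0_def H1v_zero H1v_add H1v_scale)
  then interpret function_hilbert "H1_per0_vec :: (real^'a \<Rightarrow> real^'a) set" jac_inner
    by (rule closed_subspace_function_hilbert)
  show ?thesis using ip_Cauchy_Schwarz[OF assms] by (simp add: nrm_def)
qed

text \<open>Used twice: on the gradient fields, where it produces the corrector, and on the given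
  subspace of the discrete problem.\<close>

lemma Galerkin_exists:
  assumes B: "setting_B lam Lam \<delta> A b" and P: "closed_subspace_H1_per0 P" and f: "sq_integrable cell f"
  shows "\<exists>u\<in>P. \<forall>w\<in>P. B2 A b w u = (LINT x|cell. divergence w x * f x)"
proof -
  interpret function_hilbert P jac_inner by (rule closed_subspace_function_hilbert[OF P])
  have sub: "u \<in> H1_per0_vec" if "u \<in> P" for u using P that by (auto simp: closed_subspace_H1_per0_def)
  show ?thesis
  proof (rule Lax_Milgram_near_inner_product[where q = "Cordes_factor \<delta>" and K = "sqrt (LINT x|cell. (f x)\<^sup>2)"])
    show "0 \<le> Cordes_factor \<delta>" "Cordes_factor \<delta> < 1"
      using Cordes_factor_bounds[OF setting_B_D(5)[OF B] setting_B_D(4)[OF B]] by auto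
    show "\<bar>B2 A b v u - jac_inner v u\<bar> \<le> Cordes_factor \<delta> * nrm v * nrm u" if "u \<in> P" "v \<in> P" for u v
      using B2_near[OF B sub[OF that(2)] sub[OF that(1)]] by (simp add: nrm_def)
    show "\<bar>LINT x|cell. divergence u x * f x\<bar> \<le> sqrt (LINT x|cell. (f x)\<^sup>2) * nrm u" if "u \<in> P" for u
    proof -
      have "\<bar>LINT x|cell. divergence u x * f x\<bar> \<le> sqrt (LINT x|cell. (divergence u x)\<^sup>2) * sqrt (LINT x|cell. (f x)\<^sup>2)"
        by (intro integral_Cauchy_Schwarz_sqrt sq_integrable_divergence f sub that)
      also have "\<dots> \<le> nrm u * sqrt (LINT x|cell. (f x)\<^sup>2)"
        unfolding nrm_def using divergence_le[OF sub[OF that]] by (intro mult_right_mono) auto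
      finally show ?thesis by (simp add: mult.commute)
    qed
  qed (simp_all add: sub B2_add_left[OF B] B2_scale_left[OF B] B2_diff_right[OF B] integral_divergence_add
      integral_divergence_scale f)
qed

lemma B2_zero_imp_AE:
  assumes B: "setting_B lam Lam \<delta> A b" and e: "e \<in> H1_per0_vec" and "B2 A b e e = 0"
  shows "AE x in lebesgue. e x = 0"
proof -
  have "(1 - Cordes_factor \<delta>) * jac_inner e e \<le> 0" using B2_coercive[OF B e] assms(3) by simp
  moreover have "0 < 1 - Cordes_factor \<delta>"
    using Cordes_factor_bounds[OF setting_B_D(5)[OF B] setting_B_D(4)[OF B]] by simp
  ultimately have "jac_inner e e = 0" using jac_inner_nonneg[of e] by (simp add: mult_le_0_iff)
  then show ?thesis by (rule jac_inner_zero_imp_AE[OF e])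
qed

lemma Galerkin_unique:
  assumes B: "setting_B lam Lam \<delta> A b" and P: "closed_subspace_H1_per0 P"
    and u: "u \<in> P" and v: "v \<in> P" and eq: "\<And>w. w \<in> P \<Longrightarrow> B2 A b w u = B2 A b w v"
  shows "AE x in lebesgue. u x = v x"
proof -
  interpret function_hilbert P jac_inner by (rule closed_subspace_function_hilbert[OF P])
  have sub: "u \<in> H1_per0_vec" if "u \<in> P" for u using P that by (auto simp: closed_subspace_H1_per0_def)
  define e where "e = (\<lambda>x. u x - v x)"
  have e: "e \<in> P" unfolding e_def by (rule diff_mem[OF u v])
  have "B2 A b e e = B2 A b e u - B2 A b e v"
    using B2_diff_right[OF B sub[OF u] sub[OF v] sub[OF e]] by (simp add: e_def)
  then have "B2 A b e e = 0" using eq[OF e] by simp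
  from B2_zero_imp_AE[OF B sub[OF e] this] show ?thesis by eventually_elim (simp add: e_def)
qed

text \<open>The error splits into \<open>z\<close>, from the approximation by \<open>w\<close>, and
  \<open>d\<close> in \<open>P\<close>; Galerkin orthogonality removes \<open>d\<close>. Coercivity
  with 1 - q and boundedness with 1 + q, both consequences of \<open>B2_near\<close>, give the
  quotient.\<close>

lemma Cea:
  assumes B: "setting_B lam Lam \<delta> A b" and P: "closed_subspace_H1_per0 P"
    and xi: "xi \<in> H1_per0_vec" and xh: "xh \<in> P" and w: "w \<in> P"
    and eq: "\<And>w. w \<in> P \<Longrightarrow> B2 A b w xi = B2 A b w xh"
  shows "sqrt (jac_inner (\<lambda>x. xi x - xh x) (\<lambda>x. xi x - xh x))
    \<le> (1 + Cordes_factor \<delta>) / (1 - Cordes_factor \<delta>) * sqrt (jac_inner (\<lambda>x. xi x - w x) (\<lambda>x. xi x - w x))"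
proof -
  interpret function_hilbert P jac_inner by (rule closed_subspace_function_hilbert[OF P])
  have sub: "u \<in> H1_per0_vec" if "u \<in> P" for u using P that by (auto simp: closed_subspace_H1_per0_def)
  define q where "q = Cordes_factor \<delta>"
  have q: "0 \<le> q" "q < 1"
    using Cordes_factor_bounds[OF setting_B_D(5)[OF B] setting_B_D(4)[OF B]] by (auto simp: q_def)
  define e where "e = (\<lambda>x. xi x - xh x)"
  define z where "z = (\<lambda>x. xi x - w x)"
  define d where "d = (\<lambda>x. w x - xh x)"
  have e: "e \<in> H1_per0_vec" and z: "z \<in> H1_per0_vec"
    unfolding e_def z_def by (intro H1v_diff xi sub xh w)+
  have d: "d \<in> P" unfolding d_def by (rule diff_mem[OF w xh])
  have "B2 A b d e = 0"
    using B2_diff_right[OF B xi sub[OF xh] sub[OF d]] eq[OF d] by (simp add: e_def)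
  moreover have "e = (\<lambda>x. z x + d x)" by (simp add: e_def z_def d_def)
  then have "B2 A b e e = B2 A b z e + B2 A b d e"
    using B2_add_left[OF B z sub[OF d] e] by simp
  ultimately have "(1 - q) * jac_inner e e \<le> B2 A b z e" using B2_coercive[OF B e] by (simp add: q_def)
  also have "\<dots> \<le> (1 + q) * sqrt (jac_inner z z) * sqrt (jac_inner e e)"
    using B2_near[OF B z e] jac_inner_Cauchy_Schwarz[OF z e] by (simp add: q_def algebra_simps)
  finally have le: "(1 - q) * jac_inner e e \<le> (1 + q) * sqrt (jac_inner z z) * sqrt (jac_inner e e)" .
  define s where "s = sqrt (jac_inner e e)"
  have s: "jac_inner e e = s * s" by (simp add: s_def jac_inner_nonneg)
  have "(1 - q) * s \<le> (1 + q) * sqrt (jac_inner z z)"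
  proof (cases "s = 0")
    case True
    then show ?thesis using q by (simp add: jac_inner_nonneg)
  next
    case False
    then have "s > 0" by (simp add: s_def jac_inner_nonneg less_le)
    then show ?thesis using le unfolding s_def[symmetric] s by (simp add: mult.assoc[symmetric])
  qed
  then have "s \<le> (1 + q) / (1 - q) * sqrt (jac_inner z z)" using q by (simp add: field_simps)
  then show ?thesis unfolding s_def e_def z_def q_def .
qed

section \<open>Gradient fields and the non-divergence form equation\<close>

lemma H_per0_2_subset: "f \<in> H_per0 2 \<Longrightarrow> f \<in> H_per0 1"
  using H_per2D(1) by (auto simp: H_per0_def simp del: One_nat_def)

lemma H_per0_2D: "f \<in> H_per0 2 \<Longrightarrow> f \<in> H_per 2"
  by (simp add: H_per0_def)

lemma weak_partial_add:
  assumes "f \<in> H_per 1" "g \<in> H_per 1"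
  shows "AE x in lebesgue. weak_partial i (\<lambda>x. f x + g x) x = weak_partial i f x + weak_partial i g x"
  by (rule weak_partial_AE[OF has_weak_partial_add[OF H_per1D(2)[OF assms(1)] H_per1D(2)[OF assms(2)]]])

lemma weak_partial_cmult:
  assumes "f \<in> H_per 1"
  shows "AE x in lebesgue. weak_partial i (\<lambda>x. c * f x) x = c * weak_partial i f x"
  by (rule weak_partial_AE[OF has_weak_partial_cmult[OF H_per1D(2)[OF assms]]])

lemma H_per1_add:
  assumes "f \<in> H_per 1" "g \<in> H_per 1"
  shows "(\<lambda>x. f x + g x) \<in> H_per 1"
  unfolding H_per1_iff using H_per1D[OF assms(1)] H_per1D[OF assms(2)] has_weak_partial_add L2_per_add by blast

lemma H_per1_cmult:
  assumes "f \<in> H_per 1"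
  shows "(\<lambda>x. c * f x) \<in> H_per 1"
  unfolding H_per1_iff using H_per1D[OF assms] has_weak_partial_cmult L2_per_cmult by blast

lemma H_per0_2_add:
  assumes "f \<in> H_per0 2" "g \<in> H_per0 2"
  shows "(\<lambda>x. f x + g x) \<in> H_per0 2"
proof -
  have f: "f \<in> H_per 2" "f \<in> H_per 1" and g: "g \<in> H_per 2" "g \<in> H_per 1"
    using assms H_per2D(1) by (auto simp: H_per0_def simp del: One_nat_def)
  have "\<exists>h\<in>H_per 1. has_weak_partial i (\<lambda>x. f x + g x) h" for i
    by (rule bexI[where x = "\<lambda>x. weak_partial i f x + weak_partial i g x"])
      (intro has_weak_partial_add H_per1D(2) H_per1_add H_per2D(2) f g)+
  then have "(\<lambda>x. f x + g x) \<in> H_per 2"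
    unfolding H_per2_iff using L2_per_add[OF H_per1D(1)[OF f(2)] H_per1D(1)[OF g(2)]] by blast
  then show ?thesis
    using H_per0_1_add[OF H_per0_2_subset[OF assms(1)] H_per0_2_subset[OF assms(2)]] by (simp add: H_per0_def)
qed

lemma H_per0_2_cmult:
  assumes "f \<in> H_per0 2"
  shows "(\<lambda>x. c * f x) \<in> H_per0 2"
proof -
  have f: "f \<in> H_per 2" "f \<in> H_per 1"
    using assms H_per2D(1) by (auto simp: H_per0_def simp del: One_nat_def)
  have "\<exists>h\<in>H_per 1. has_weak_partial i (\<lambda>x. c * f x) h" for i
    by (rule bexI[where x = "\<lambda>x. c * weak_partial i f x"])
      (intro has_weak_partial_cmult H_per1D(2) H_per1_cmult H_per2D(2) f)+
  then have "(\<lambda>x. c * f x) \<in> H_per 2"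
    unfolding H_per2_iff using L2_per_cmult[OF H_per1D(1)[OF f(2)]] by blast
  then show ?thesis
    using H_per0_1_cmult[OF H_per0_2_subset[OF assms]] by (simp add: H_per0_def)
qed

lemma H_per0_2_zero: "(\<lambda>x. 0) \<in> H_per0 2"
proof -
  have "(\<lambda>x::real^'a. 0::real) \<in> H_per 2" by (rule smooth_periodic_H_per2[OF smooth_const]) simp
  then show ?thesis by (simp add: H_per0_def int_cell_eq)
qed

lemma grad_add:
  assumes "f \<in> H_per 1" "g \<in> H_per 1"
  shows "AE x in lebesgue. grad (\<lambda>x. f x + g x) x = grad f x + grad g x"
proof -
  have "AE x in lebesgue. \<forall>i. weak_partial i (\<lambda>x. f x + g x) x = weak_partial i f x + weak_partial i g x"
    using weak_partial_add[OF assms] by (simp only: AE_all_countable) simp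
  then show ?thesis by eventually_elim (simp add: grad_def vec_eq_iff)
qed

lemma grad_cmult:
  assumes "f \<in> H_per 1"
  shows "AE x in lebesgue. grad (\<lambda>x. c * f x) x = c *\<^sub>R grad f x"
proof -
  have "AE x in lebesgue. \<forall>i. weak_partial i (\<lambda>x. c * f x) x = c * weak_partial i f x"
    using weak_partial_cmult[OF assms] by (simp only: AE_all_countable) simp
  then show ?thesis by eventually_elim (simp add: grad_def vec_eq_iff)
qed

lemma grad_diff:
  assumes "f \<in> H_per 1" "g \<in> H_per 1"
  shows "AE x in lebesgue. grad (\<lambda>x. f x - g x) x = grad f x - grad g x"
proof -
  have "AE x in lebesgue. grad (\<lambda>x. f x + (-1) * g x) x = grad f x - grad g x"
    using grad_add[OF assms(1) H_per1_cmult[OF assms(2), of "-1"]] grad_cmult[OF assms(2), of "-1"]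
    by eventually_elim simp
  then show ?thesis by simp
qed

lemma H_per0_2_diff: "f \<in> H_per0 2 \<Longrightarrow> g \<in> H_per0 2 \<Longrightarrow> (\<lambda>x. f x - g x) \<in> H_per0 2"
  using H_per0_2_add[of f "\<lambda>x. (-1) * g x"] H_per0_2_cmult[of g "-1"] by simp

lemma Poincare_grad:
  assumes "f \<in> H_per0 2"
  shows "(LINT x|cell. (f x)\<^sup>2) \<le> (LINT x|cell. (norm (grad f x))\<^sup>2)"
proof -
  have g: "grad f \<in> H1_per0_vec" by (rule grad_H1_per0_vec[OF H_per0_2D[OF assms]])
  have "(LINT x|cell. (f x)\<^sup>2) \<le> 1 / (4 * pi\<^sup>2) * (LINT x|cell. (norm (grad f x))\<^sup>2)"
    using Poincare[OF H_per0_2_subset[OF assms]] unfolding integrable_norm_square(2)[OF g] by (simp add: grad_def)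
  also have "\<dots> \<le> 1 * (LINT x|cell. (norm (grad f x))\<^sup>2)"
  proof (rule mult_right_mono)
    have "1 \<le> pi\<^sup>2" using pi_ge_two by (simp add: one_le_power)
    then show "1 / (4 * pi\<^sup>2) \<le> 1" by simp
  qed simp
  finally show ?thesis by simp
qed

text \<open>By Poincare a mean-zero function with vanishing gradient is zero.\<close>

lemma grad_eq_imp_eq:
  assumes f: "f \<in> H_per0 2" and g: "g \<in> H_per0 2" and eq: "AE x in lebesgue. grad f x = grad g x"
  shows "AE x in lebesgue. f x = g x"
proof -
  have f1: "f \<in> H_per 1" "g \<in> H_per 1" using f g H_per0_2D H_per2D(1) by blast+
  define d where "d = (\<lambda>x. f x - g x)"
  have d: "d \<in> H_per0 2" unfolding d_def by (rule H_per0_2_diff[OF f g])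
  have "AE x in lebesgue. grad d x = 0"
    using grad_diff[OF f1] eq unfolding d_def by eventually_elim simp
  then have "AE x in cell. (norm (grad d x))\<^sup>2 = 0" by (intro AE_cellI) (auto elim: eventually_mono)
  then have "(LINT x|cell. (norm (grad d x))\<^sup>2) = 0"
    using integral_nonneg_eq_0_iff_AE[OF integrable_norm_square(1)[OF grad_H1_per0_vec[OF H_per0_2D[OF d]]]] by simp
  then have z: "(LINT x|cell. (d x)\<^sup>2) = 0" using Poincare_grad[OF d] by (simp add: antisym)
  have d2: "d \<in> L2_per" using d H_per0_2D H_per2D(1) H_per1D(1) by blast
  have "AE x in cell. (d x)\<^sup>2 = 0"
    using integral_nonneg_eq_0_iff_AE[OF sq_integrable_square[OF L2_perD(3)[OF d2]]] z by simp
  then have "AE x in cell. d x = 0" by simp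
  then have "AE x in lebesgue. d x = 0"
    by (intro periodic_AE_eq[OF L2_perD(2)[OF d2]]) (simp_all add: periodic_def)
  then show ?thesis by eventually_elim (simp add: d_def)
qed

lemma weak_jacobian_cong_AE:
  assumes u: "u \<in> H1_per0_vec" and v: "v \<in> H1_per0_vec" and eq: "AE x in lebesgue. u x = v x"
  shows "AE x in lebesgue. weak_jacobian u x = weak_jacobian v x"
proof -
  have "AE x in lebesgue. weak_partial j (\<lambda>y. u y $ i) x = weak_partial j (\<lambda>y. v y $ i) x" for i j
  proof (rule weak_partial_AE, rule has_weak_partial_cong_AE[OF H1v_D(6)[OF v]])
    show "AE x in lebesgue. u x $ i = v x $ i" using eq by eventually_elim simp
    show "(\<lambda>x. u x $ i) \<in> L1_loc" by (rule L2_perD(4)[OF H1v_D(4)[OF u]])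
  qed
  then have "AE x in lebesgue. \<forall>i j. weak_partial j (\<lambda>y. u y $ i) x = weak_partial j (\<lambda>y. v y $ i) x"
    by (simp only: AE_all_countable) simp
  then show ?thesis by eventually_elim (simp add: weak_jacobian_def)
qed

text \<open>Elements of \<open>gradient_fields\<close> are gradients only almost everywhere, so
  \<open>B2\<close> must not distinguish such representatives.\<close>

lemma B2_cong_AE:
  assumes B: "setting_B lam Lam \<delta> A b" and u: "u \<in> H1_per0_vec" and v: "v \<in> H1_per0_vec"
    and eq: "AE x in lebesgue. u x = v x" and w: "w \<in> H1_per0_vec"
  shows "B2 A b w u = B2 A b w v"
proof -
  define d where "d = (\<lambda>x. u x - v x)"
  have d: "d \<in> H1_per0_vec" unfolding d_def by (rule H1v_diff[OF u v])
  have "AE x in lebesgue. weak_jacobian d x = 0"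
    using weak_jacobian_diff[OF u v] weak_jacobian_cong_AE[OF u v eq] unfolding d_def by eventually_elim simp
  then have "AE x in cell. weak_jacobian d x \<bullet> weak_jacobian d x = 0" by (intro AE_cellI) (auto elim: eventually_mono)
  then have "jac_inner d d = 0"
    unfolding jac_inner_def using integral_nonneg_eq_0_iff_AE[OF jac_inner_integrable[OF d d]] by simp
  then have "B2 A b w d = 0" using B2_near[OF B w d] jac_inner_Cauchy_Schwarz[OF w d] by simp
  then show ?thesis using B2_diff_right[OF B u v w] by (simp add: d_def)
qed

text \<open>Equality with a gradient is required only almost everywhere: sums and limits of
  gradients are gradients up to null sets, and \<open>closed_subspace_H1_per0\<close> demands every
  representative of a limit.\<close>

definition gradient_fields :: "(real^'n \<Rightarrow> real^'n) set" where
  "gradient_fields = {w \<in> H1_per0_vec. \<exists>\<phi>\<in>H_per0 2. AE x in lebesgue. w x = grad \<phi> x}"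

lemma grad_gradient_fields: "\<phi> \<in> H_per0 2 \<Longrightarrow> grad \<phi> \<in> gradient_fields"
  using grad_H1_per0_vec[OF H_per0_2D] by (auto simp: gradient_fields_def)

text \<open>The potentials are normalized to mean zero, so \<open>Poincare_grad\<close> turns
  convergence of the gradients into a Cauchy sequence of potentials. Its limit has weak gradient
  \<open>v\<close> by \<open>has_weak_partial_limit\<close>.\<close>

lemma gradient_fields_closed: "closed_subspace_H1_per0 (gradient_fields :: (real^'n \<Rightarrow> real^'n) set)"
  unfolding closed_subspace_H1_per0_def
proof (intro conjI ballI allI impI)
  show "gradient_fields \<subseteq> H1_per0_vec" by (auto simp: gradient_fields_def)
  show "(\<lambda>x. 0) \<in> (gradient_fields :: (real^'n \<Rightarrow> real^'n) set)"
  proof -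
    have "AE x in lebesgue. \<forall>i. weak_partial i (\<lambda>x::real^'n. 0) x = partial_deriv i (\<lambda>x. 0) x"
      unfolding AE_all_countable by (intro allI weak_partial_smooth smooth_const)
    moreover have "partial_deriv i (\<lambda>x. 0) x = 0" for i and x :: "real^'n"
      by (subst partial_deriv_eq[OF has_derivative_const]) simp
    ultimately have "AE x::real^'n in lebesgue. 0 = grad (\<lambda>x. 0) x"
      by (auto simp: grad_def vec_eq_iff)
    then show ?thesis using H1v_zero H_per0_2_zero unfolding gradient_fields_def by blast
  qed
next
  fix u v :: "real^'n \<Rightarrow> real^'n" assume "u \<in> gradient_fields" "v \<in> gradient_fields"
  then obtain f g where u: "u \<in> H1_per0_vec" "f \<in> H_per0 2" "AE x in lebesgue. u x = grad f x"
    and v: "v \<in> H1_per0_vec" "g \<in> H_per0 2" "AE x in lebesgue. v x = grad g x"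
    by (auto simp: gradient_fields_def)
  have "AE x in lebesgue. u x + v x = grad (\<lambda>x. f x + g x) x"
    using u(3) v(3) grad_add[OF H_per2D(1)[OF H_per0_2D[OF u(2)]] H_per2D(1)[OF H_per0_2D[OF v(2)]]]
    by eventually_elim simp
  then show "(\<lambda>x. u x + v x) \<in> gradient_fields"
    using H1v_add[OF u(1) v(1)] H_per0_2_add[OF u(2) v(2)] unfolding gradient_fields_def by blast
next
  fix c :: real and u :: "real^'n \<Rightarrow> real^'n" assume "u \<in> gradient_fields"
  then obtain f where u: "u \<in> H1_per0_vec" "f \<in> H_per0 2" "AE x in lebesgue. u x = grad f x"
    by (auto simp: gradient_fields_def)
  have "AE x in lebesgue. c *\<^sub>R u x = grad (\<lambda>x. c * f x) x"
    using u(3) grad_cmult[OF H_per2D(1)[OF H_per0_2D[OF u(2)]], of c] by eventually_elim simp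
  then show "(\<lambda>x. c *\<^sub>R u x) \<in> gradient_fields"
    using H1v_scale[OF u(1)] H_per0_2_cmult[OF u(2)] unfolding gradient_fields_def by blast
next
  fix u :: "nat \<Rightarrow> real^'n \<Rightarrow> real^'n" and v :: "real^'n \<Rightarrow> real^'n"
  assume u: "\<forall>k. u k \<in> gradient_fields" and v: "v \<in> H1_per0_vec"
    and lim: "(\<lambda>k. H1_norm_cell (\<lambda>x. u k x - v x)) \<longlonglongrightarrow> 0"
  have "\<forall>k. \<exists>f. f \<in> H_per0 2 \<and> (AE x in lebesgue. u k x = grad f x)"
    using u by (auto simp: gradient_fields_def)
  from choice[OF this] obtain f where f': "\<forall>k. f k \<in> H_per0 2 \<and> (AE x in lebesgue. u k x = grad (f k) x)" ..
  have f: "f k \<in> H_per0 2" and uf: "AE x in lebesgue. u k x = grad (f k) x" for k using spec[OF f', of k] by auto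
  have uH: "u k \<in> H1_per0_vec" for k using u by (auto simp: gradient_fields_def)
  have f1: "f k \<in> H_per 1" for k by (rule H_per2D(1)[OF H_per0_2D[OF f]])
  define N where "N k = (LINT x|cell. (norm (u k x - v x))\<^sup>2)" for k
  have Nc: "(LINT x|cell. (u k x $ i - v x $ i)\<^sup>2) \<le> N k" for k i
  proof -
    have "(LINT x|cell. (u k x $ i - v x $ i)\<^sup>2) \<le> (\<Sum>i\<in>UNIV. LINT x|cell. (u k x $ i - v x $ i)\<^sup>2)"
      by (rule member_le_sum[where f = "\<lambda>i. LINT x|cell. (u k x $ i - v x $ i)\<^sup>2"]) auto
    then show ?thesis
      using integrable_norm_square(2)[OF H1v_diff[OF uH[of k] v]] by (simp add: N_def)
  qed
  have N0: "N \<longlonglongrightarrow> 0"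
  proof (rule Lim_null_comparison[OF always_eventually])
    have "(\<lambda>k. (H1_norm_cell (\<lambda>x. u k x - v x))\<^sup>2) \<longlonglongrightarrow> 0" using tendsto_power[OF lim, of 2] by simp
    then show "(\<lambda>k. (H1_norm_cell (\<lambda>x. u k x - v x))\<^sup>2) \<longlonglongrightarrow> 0" .
    show "\<forall>k. norm (N k) \<le> (H1_norm_cell (\<lambda>x. u k x - v x))\<^sup>2"
      using H1_norm_cell_square[OF H1v_diff[OF uH v]] by (simp add: N_def jac_inner_nonneg)
  qed
  \<comment> \<open>Both gradients are compared with \<open>v\<close>; the factors 2 come from (a +
    c)^2 \<le> 2 a^2 + 2 c^2.\<close>
  have fd: "(LINT x|cell. (f m x - f n x)\<^sup>2) \<le> 2 * N m + 2 * N n" for m n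
  proof -
    have "(LINT x|cell. (f m x - f n x)\<^sup>2) \<le> (LINT x|cell. (norm (grad (\<lambda>x. f m x - f n x) x))\<^sup>2)"
      by (rule Poincare_grad[OF H_per0_2_diff[OF f f]])
    also have "\<dots> \<le> (LINT x|cell. 2 * (norm (u m x - v x))\<^sup>2 + 2 * (norm (u n x - v x))\<^sup>2)"
    proof (rule integral_mono_AE)
      show "integrable cell (\<lambda>x. (norm (grad (\<lambda>x. f m x - f n x) x))\<^sup>2)"
        by (intro integrable_norm_square(1) grad_H1_per0_vec H_per0_2D H_per0_2_diff f)
      show "integrable cell (\<lambda>x. 2 * (norm (u m x - v x))\<^sup>2 + 2 * (norm (u n x - v x))\<^sup>2)"
        by (intro Bochner_Integration.integrable_add integrable_mult_right integrable_norm_square(1) H1v_diff uH v)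
      show "AE x in cell. (norm (grad (\<lambda>x. f m x - f n x) x))\<^sup>2 \<le> 2 * (norm (u m x - v x))\<^sup>2 + 2 * (norm (u n x - v x))\<^sup>2"
        using AE_cellI[OF grad_diff[OF f1[of m] f1[of n]]] AE_cellI[OF uf[of m]] AE_cellI[OF uf[of n]]
      proof eventually_elim
        case (elim x)
        define a where "a = norm (u m x - v x)"
        define c where "c = norm (u n x - v x)"
        have "norm (grad (\<lambda>x. f m x - f n x) x) \<le> a + c"
          using norm_triangle_ineq4[of "u m x - v x" "u n x - v x"] elim by (simp add: a_def c_def)
        then have "(norm (grad (\<lambda>x. f m x - f n x) x))\<^sup>2 \<le> (a + c)\<^sup>2" by (intro power_mono) auto
        also have "\<dots> \<le> 2 * a\<^sup>2 + 2 * c\<^sup>2"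
          using sum_squares_bound[of a c] by (simp add: power2_sum)
        finally show ?case by (simp add: a_def c_def)
      qed
    qed
    also have "\<dots> = 2 * N m + 2 * N n"
      unfolding N_def using integrable_norm_square(1)[OF H1v_diff[OF uH v]] by simp
    finally show ?thesis .
  qed
  have C: "\<exists>K. \<forall>m\<ge>K. \<forall>n\<ge>K. (LINT x|cell. (f m x - f n x)\<^sup>2) < e" if "e > 0" for e
  proof -
    obtain K where K: "\<And>k. k \<ge> K \<Longrightarrow> \<bar>N k\<bar> < e / 4"
      using LIMSEQ_D[OF N0, of "e / 4"] \<open>e > 0\<close> by auto
    have "(LINT x|cell. (f m x - f n x)\<^sup>2) < e" if "m \<ge> K" "n \<ge> K" for m n
      using fd[of m n] K[OF that(1)] K[OF that(2)] by linarith
    then show ?thesis by blast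
  qed
  obtain \<phi> where \<phi>: "\<phi> \<in> L2_per" "(\<lambda>n. LINT x|cell. (f n x - \<phi> x)\<^sup>2) \<longlonglongrightarrow> 0"
    by (rule L2_per_complete[of f, OF H_per1D(1)[OF f1] C])
  have w: "has_weak_partial i \<phi> (\<lambda>x. v x $ i)" for i
  proof (rule has_weak_partial_limit[OF _ H_per1D(1)[OF f1] _ \<phi>(1) H1v_D(4)[OF v] \<phi>(2)])
    show "has_weak_partial i (f n) (weak_partial i (f n))" "weak_partial i (f n) \<in> L2_per" for n
      by (rule H_per1D[OF f1])+
    have "(LINT x|cell. (weak_partial i (f n) x - v x $ i)\<^sup>2) = (LINT x|cell. (u n x $ i - v x $ i)\<^sup>2)" for n
    proof (rule integral_cong_AE)
      show "AE x in cell. (weak_partial i (f n) x - v x $ i)\<^sup>2 = (u n x $ i - v x $ i)\<^sup>2"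
        using AE_cellI[OF uf[of n]] by eventually_elim (simp add: grad_def)
    qed (intro borel_measurable_integrable sq_integrable_square sq_integrable_diff L2_perD(3) H1v_D(4) uH v H_per1D(3) f1)+
    then have "norm (LINT x|cell. (weak_partial i (f n) x - v x $ i)\<^sup>2) \<le> N n" for n using Nc[of n i] by simp
    then show "(\<lambda>n. LINT x|cell. (weak_partial i (f n) x - v x $ i)\<^sup>2) \<longlonglongrightarrow> 0"
      by (intro Lim_null_comparison[OF always_eventually N0]) blast
  qed
  have "(LINT x|cell. \<phi> x) = 0"
  proof -
    have "(\<lambda>n. LINT x|cell. f n x * 1) \<longlonglongrightarrow> (LINT x|cell. \<phi> x * 1)"
      by (intro L2_tendsto_integral_mult L2_perD(3) H_per1D(1) f1 \<phi> cell.sq_integrable_const)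
    moreover have "(LINT x|cell. f n x) = 0" for n using f[of n] by (simp add: H_per0_def int_cell_eq)
    ultimately show ?thesis using LIMSEQ_unique[OF _ tendsto_const] by simp
  qed
  moreover have "\<phi> \<in> H_per 2" unfolding H_per2_iff using \<phi>(1) w H1v_D(2)[OF v] by blast
  ultimately have "\<phi> \<in> H_per0 2" by (simp add: H_per0_def int_cell_eq)
  moreover have "AE x in lebesgue. v x = grad \<phi> x"
  proof -
    have "AE x in lebesgue. \<forall>i. weak_partial i \<phi> x = v x $ i"
      using weak_partial_AE[OF w] by (simp only: AE_all_countable) simp
    then show ?thesis by eventually_elim (simp add: grad_def vec_eq_iff)
  qed
  ultimately show "v \<in> gradient_fields" using v unfolding gradient_fields_def by blast
qed

section \<open>Potentials and the scalar equation\<close>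

lemma divergence_grad: "divergence (grad \<phi>) x = laplacian \<phi> x"
  by (simp add: divergence_def grad_def laplacian_def)

text \<open>\<open>weak_jacobian\<close> and \<open>hessian\<close> take the two derivatives in
  opposite order, so the literal identity carries a transpose. \<open>hessian_AE\<close> removes it
  almost everywhere.\<close>

lemma weak_jacobian_grad_transpose: "transpose (weak_jacobian (grad \<phi>) x) = hessian \<phi> x"
  by (simp add: weak_jacobian_def grad_def hessian_def transpose_def)

lemma hessian_AE:
  assumes "\<phi> \<in> H_per 2"
  shows "AE x in lebesgue. weak_jacobian (grad \<phi>) x = hessian \<phi> x"
proof -
  have "AE x in lebesgue. \<forall>i j. weak_partial i (weak_partial j \<phi>) x = weak_partial j (weak_partial i \<phi>) x"
    using weak_partial_commute[OF assms] by (simp only: AE_all_countable) simp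
  then show ?thesis by eventually_elim (simp add: weak_jacobian_def grad_def hessian_def vec_eq_iff)
qed

lemma curl_grad:
  assumes "\<phi> \<in> H_per 2"
  shows "AE x in lebesgue. curl (grad \<phi>) x = 0"
  using hessian_AE[OF assms] by eventually_elim (unfold curl_def weak_jacobian_grad_transpose, simp)

lemma nondiv_op_grad:
  assumes "\<phi> \<in> H_per 2"
  shows "AE x in lebesgue. nondiv_op A b (grad \<phi>) x = gam A b x * (A x \<bullet> hessian \<phi> x + b x \<bullet> grad \<phi> x)"
  using hessian_AE[OF assms]
  by eventually_elim (simp add: nondiv_op_def A_tilde_def b_tilde_def distrib_left)

text \<open>Curls of gradients vanish, so only the first integral survives.\<close>

lemma B2_grad:
  assumes "\<phi> \<in> H_per 2"
  shows "B2 A b w (grad \<phi>) = (LINT x|cell. divergence w x * nondiv_op A b (grad \<phi>) x)"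
proof -
  have "(LINT x|cell. curl w x \<bullet> curl (grad \<phi>) x) = 0"
    by (rule integral_eq_zero_AE) (use AE_cellI[OF curl_grad[OF assms]] in \<open>eventually_elim, simp\<close>)
  then show ?thesis by (simp add: B2_def int_cell_eq nondiv_op_def curl_def)
qed

lemma B1_eq_B2:
  assumes B: "setting_B lam Lam \<delta> A b" and "\<phi> \<in> H_per 2" "\<psi> \<in> H_per 2"
  shows "B1 A b \<psi> \<phi> = B2 A b (grad \<psi>) (grad \<phi>)"
proof -
  have "(LINT x|cell. laplacian \<psi> x * (A_tilde A b x \<bullet> hessian \<phi> x + b_tilde A b x \<bullet> grad \<phi> x))
      = (LINT x|cell. laplacian \<psi> x * nondiv_op A b (grad \<phi>) x)"
  proof (rule integral_cong_AE)
    show ae: "AE x in cell. laplacian \<psi> x * (A_tilde A b x \<bullet> hessian \<phi> x + b_tilde A b x \<bullet> grad \<phi> x)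
        = laplacian \<psi> x * nondiv_op A b (grad \<phi>) x"
      using AE_cellI[OF hessian_AE[OF assms(2)]] by eventually_elim (simp add: nondiv_op_def)
    show m: "(\<lambda>x. laplacian \<psi> x * nondiv_op A b (grad \<phi>) x) \<in> borel_measurable cell"
      by (intro borel_measurable_times sq_integrable_measurable sq_integrable_laplacian assms
          sq_integrable_nondiv_op[OF B] grad_H1_per0_vec)
    have A: "A \<in> borel_measurable cell" "b \<in> borel_measurable cell"
      using setting_B_D(1,2)[OF B] by (auto intro: measurable_restrict_space1)
    have "(\<lambda>x. A_tilde A b x \<bullet> hessian \<phi> x + b_tilde A b x \<bullet> grad \<phi> x)
        = (\<lambda>x. (\<Sum>i\<in>UNIV. \<Sum>j\<in>UNIV. gam A b x * A x $ i $ j * weak_partial i (weak_partial j \<phi>) x)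
            + (\<Sum>i\<in>UNIV. gam A b x * b x $ i * weak_partial i \<phi> x))"
      by (auto simp: A_tilde_def b_tilde_def inner_vec_def hessian_def grad_def sum_distrib_left mult.assoc)
    also have "\<dots> \<in> borel_measurable cell"
      by (intro borel_measurable_add borel_measurable_sum borel_measurable_times measurable_gam measurable_entry
          measurable_component A sq_integrable_measurable L2_perD(3) H_per1D(3) H_per2D assms)
    finally show "(\<lambda>x. laplacian \<psi> x * (A_tilde A b x \<bullet> hessian \<phi> x + b_tilde A b x \<bullet> grad \<phi> x)) \<in> borel_measurable cell"
      by (rule borel_measurable_times[OF sq_integrable_measurable[OF sq_integrable_laplacian[OF assms(3)]]])
  qed
  then show ?thesis by (simp add: B1_def int_cell_eq B2_grad[OF assms(2)] divergence_grad)
qed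

text \<open>The equation \<open>L \<phi> = f\<close> is solvable up to a constant, since the range of the Laplacian is the
  orthogonal complement of the constants.\<close>

lemma nondiv_solve:
  fixes A :: "real^'n \<Rightarrow> real^'n^'n"
  assumes B: "setting_B lam Lam \<delta> A b" and f: "sq_integrable cell f"
  obtains \<phi> c where "\<phi> \<in> H_per0 2" "AE x in cell. nondiv_op A b (grad \<phi>) x = f x + c"
proof -
  obtain u where u: "u \<in> gradient_fields" "\<And>w. w \<in> gradient_fields \<Longrightarrow> B2 A b w u = (LINT x|cell. divergence w x * f x)"
    using Galerkin_exists[OF B gradient_fields_closed f] by blast
  obtain \<phi> where \<phi>: "\<phi> \<in> H_per0 2" "AE x in lebesgue. u x = grad \<phi> x" and uH: "u \<in> H1_per0_vec"
    using u(1) by (auto simp: gradient_fields_def)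
  note \<phi>2 = H_per0_2D[OF \<phi>(1)]
  note gH = grad_H1_per0_vec[OF \<phi>2]
  have s: "sq_integrable cell (\<lambda>x. nondiv_op A b (grad \<phi>) x - f x)"
    by (intro sq_integrable_diff sq_integrable_nondiv_op[OF B] gH f)
  have "\<exists>c. AE x in cell. nondiv_op A b (grad \<phi>) x - f x = c"
  proof (rule orthogonal_laplacians_imp_constant[OF s])
    fix \<psi> :: "real^'n \<Rightarrow> real" assume \<psi>: "\<psi> \<in> H_per0 2"
    note \<psi>H = grad_H1_per0_vec[OF H_per0_2D[OF \<psi>]]
    have "(LINT x|cell. laplacian \<psi> x * nondiv_op A b (grad \<phi>) x) = B2 A b (grad \<psi>) (grad \<phi>)"
      by (simp add: B2_grad[OF \<phi>2] divergence_grad)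
    also have "\<dots> = B2 A b (grad \<psi>) u"
      by (rule B2_cong_AE[OF B uH gH \<phi>(2) \<psi>H, symmetric])
    also have "\<dots> = (LINT x|cell. laplacian \<psi> x * f x)"
      by (simp add: u(2)[OF grad_gradient_fields[OF \<psi>]] divergence_grad)
    finally show "(LINT x|cell. laplacian \<psi> x * (nondiv_op A b (grad \<phi>) x - f x)) = 0"
      using sq_integrable_mult[OF sq_integrable_laplacian[OF H_per0_2D[OF \<psi>]] sq_integrable_nondiv_op[OF B gH]]
        sq_integrable_mult[OF sq_integrable_laplacian[OF H_per0_2D[OF \<psi>]] f]
      by (simp add: right_diff_distrib)
  qed
  then obtain c where "AE x in cell. nondiv_op A b (grad \<phi>) x - f x = c" by blast
  then have "AE x in cell. nondiv_op A b (grad \<phi>) x = f x + c" by eventually_elim simp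
  with \<phi>(1) show thesis by (rule that)
qed

lemma measurable_hessian_grad:
  assumes "A \<in> borel_measurable cell" "b \<in> borel_measurable cell" "\<phi> \<in> H_per 2"
  shows "(\<lambda>x. A x \<bullet> hessian \<phi> x + b x \<bullet> grad \<phi> x) \<in> borel_measurable cell"
proof -
  have "(\<lambda>x. A x \<bullet> hessian \<phi> x + b x \<bullet> grad \<phi> x)
      = (\<lambda>x. (\<Sum>i\<in>UNIV. \<Sum>j\<in>UNIV. A x $ i $ j * weak_partial i (weak_partial j \<phi>) x)
          + (\<Sum>i\<in>UNIV. b x $ i * weak_partial i \<phi> x))"
    by (auto simp: inner_vec_def hessian_def grad_def)
  also have "\<dots> \<in> borel_measurable cell"
    by (intro borel_measurable_add borel_measurable_sum borel_measurable_times measurable_entry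
        measurable_component assms sq_integrable_measurable L2_perD(3) H_per1D(3) H_per2D)
  finally show ?thesis .
qed

lemma sq_integrable_b_tilde:
  fixes A :: "real^'n \<Rightarrow> real^'n^'n"
  assumes B: "setting_B lam Lam \<delta> A b"
  shows "sq_integrable cell (\<lambda>x. b_tilde A b x $ j)"
proof (rule cell.sq_integrable_bounded[where C = 1])
  have A: "A \<in> borel_measurable cell" "b \<in> borel_measurable cell"
    using setting_B_D(1,2)[OF B] by (auto intro: measurable_restrict_space1)
  have "(\<lambda>x. gam A b x * b x $ j) \<in> borel_measurable cell"
    by (intro borel_measurable_times measurable_gam measurable_component A)
  then show "(\<lambda>x. b_tilde A b x $ j) \<in> borel_measurable cell" by (simp add: b_tilde_def)
  show "AE x in cell. \<bar>b_tilde A b x $ j\<bar> \<le> 1"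
    using AE_cellI[OF setting_B_D(6)[OF B]]
  proof eventually_elim
    case (elim x)
    have "(norm (b_tilde A b x))\<^sup>2 \<le> 1 - \<delta> - (norm (A_tilde A b x - mat 1))\<^sup>2" using elim by simp
    also have "\<dots> \<le> 1\<^sup>2"
      using setting_B_D(3)[OF B] zero_le_power2[of "norm (A_tilde A b x - mat 1)"] unfolding one_power2 by linarith
    finally have "norm (b_tilde A b x) \<le> 1" by (rule power2_le_imp_le) simp
    then show ?case using component_le_norm_cart[of "b_tilde A b x" j] by linarith
  qed
qed

text \<open>The solution of \<open>L \<chi>j = - b\<^sub>j\<close> up to a constant is tested with \<open>r / gam\<close>. The integral of
  \<open>r / gam\<close> does not vanish: otherwise solving \<open>L \<phi> = r / gam + c\<close> and testing with \<open>r / gam\<close> gives \<open>r = 0\<close>.\<close>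

lemma corrector_exists:
  fixes A :: "real^'n \<Rightarrow> real^'n^'n" and b :: "real^'n \<Rightarrow> real^'n"
  assumes B: "setting_B lam Lam \<delta> A b" and inv: "invariant_density A b r"
    and cen: "int_cell (\<lambda>x. r x *\<^sub>R b x) = 0"
  obtains \<chi>j where "\<chi>j \<in> H_per0 2" "AE x in cell. nondiv_op A b (grad \<chi>j) x = - b_tilde A b x $ j"
proof -
  have A: "A \<in> borel_measurable cell" "b \<in> borel_measurable cell"
    using setting_B_D(1,2)[OF B] by (auto intro: measurable_restrict_space1)
  have r: "sq_integrable cell r" and r1: "(LINT x|cell. r x) = 1"
    and rinv: "\<And>\<phi>. \<phi> \<in> H_per 2 \<Longrightarrow> (LINT x|cell. r x * (A x \<bullet> hessian \<phi> x + b x \<bullet> grad \<phi> x)) = 0"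
    using inv by (auto simp: invariant_density_def int_cell_eq L2_per_iff)
  note rm = sq_integrable_measurable[OF r]
  have g: "AE x in cell. 0 < gam A b x \<and> 1 / gam A b x \<le> real CARD('n) * Lam / (real CARD('n) - 1 + \<delta>)"
    using AE_cellI[OF setting_B_D(6)[OF B]] by eventually_elim simp
  have gm: "gam A b \<in> borel_measurable cell" by (rule measurable_gam[OF A])
  \<comment> \<open>Dividing by \<open>gam\<close> undoes the renormalization: invariance of
    \<open>r\<close> under the original operator becomes orthogonality of \<open>\<rho>\<close> to
    \<open>nondiv_op\<close> of all gradients.\<close>
  define \<rho> where "\<rho> x = 1 / gam A b x * r x" for x
  have \<rho>: "sq_integrable cell \<rho>" unfolding \<rho>_def[abs_def]
  proof (rule sq_integrable_mult_bounded[OF r])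
    show "(\<lambda>x. 1 / gam A b x) \<in> borel_measurable cell" using gm by simp
    show "AE x in cell. \<bar>1 / gam A b x\<bar> \<le> real CARD('n) * Lam / (real CARD('n) - 1 + \<delta>)"
      using g by eventually_elim (simp add: abs_of_pos)
  qed
  have \<rho>L: "(LINT x|cell. \<rho> x * nondiv_op A b (grad \<phi>) x) = 0" if \<phi>: "\<phi> \<in> H_per 2" for \<phi>
  proof -
    have "(LINT x|cell. \<rho> x * nondiv_op A b (grad \<phi>) x) = (LINT x|cell. r x * (A x \<bullet> hessian \<phi> x + b x \<bullet> grad \<phi> x))"
    proof (rule integral_cong_AE)
      show "AE x in cell. \<rho> x * nondiv_op A b (grad \<phi>) x = r x * (A x \<bullet> hessian \<phi> x + b x \<bullet> grad \<phi> x)"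
        using g AE_cellI[OF nondiv_op_grad[OF \<phi>, of A b]] by eventually_elim (simp add: \<rho>_def)
      show "(\<lambda>x. \<rho> x * nondiv_op A b (grad \<phi>) x) \<in> borel_measurable cell"
        by (intro borel_measurable_times sq_integrable_measurable[OF \<rho>] measurable_nondiv_op[OF B] grad_H1_per0_vec \<phi>)
      show "(\<lambda>x. r x * (A x \<bullet> hessian \<phi> x + b x \<bullet> grad \<phi> x)) \<in> borel_measurable cell"
        by (rule borel_measurable_times[OF rm measurable_hessian_grad[OF A \<phi>]])
    qed
    then show ?thesis using rinv[OF \<phi>] by simp
  qed
  \<comment> \<open>This is the centering condition, since \<open>\<rho>\<close> times
    \<open>b_tilde\<close> is \<open>r\<close> times \<open>b\<close>. Taking component
    \<open>j\<close> of the vector-valued integral requires integrability, which comes from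
    boundedness of \<open>b\<close>.\<close>
  have \<rho>b: "(LINT x|cell. \<rho> x * b_tilde A b x $ j) = 0"
  proof -
    have bm: "(\<lambda>x. r x *\<^sub>R b x) \<in> borel_measurable cell" using rm A(2) by simp
    obtain C where C: "AE x in cell. norm (b x) \<le> C"
      using B by (auto simp: setting_B_def Linf_per_def intro: AE_cellI)
    have "integrable cell (\<lambda>x. r x *\<^sub>R b x)"
    proof (rule Bochner_Integration.integrable_bound[OF _ bm])
      show "integrable cell (\<lambda>x. C * r x)" using cell.sq_integrable_integrable[OF r] by simp
      show "AE x in cell. norm (r x *\<^sub>R b x) \<le> norm (C * r x)"
        using C
      proof eventually_elim
        case (elim x)
        then have "\<bar>r x\<bar> * norm (b x) \<le> \<bar>r x\<bar> * \<bar>C\<bar>" by (intro mult_left_mono) auto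
        then show ?case by (simp add: abs_mult mult.commute)
      qed
    qed
    then have "(LINT x|cell. (r x *\<^sub>R b x) \<bullet> axis j 1) = (LINT x|cell. r x *\<^sub>R b x) \<bullet> axis j 1"
      by (intro integral_inner_left) simp
    then have "(LINT x|cell. r x * b x $ j) = 0" using cen by (simp add: int_cell_eq inner_axis)
    moreover have "(LINT x|cell. \<rho> x * b_tilde A b x $ j) = (LINT x|cell. r x * b x $ j)"
    proof (rule integral_cong_AE)
      show "AE x in cell. \<rho> x * b_tilde A b x $ j = r x * b x $ j"
        using g by eventually_elim (simp add: \<rho>_def b_tilde_def)
    qed (intro borel_measurable_times sq_integrable_measurable \<rho> sq_integrable_b_tilde[OF B] r measurable_component A)+
    ultimately show ?thesis by simp
  qed
  have \<rho>i: "integrable cell \<rho>" by (rule cell.sq_integrable_integrable[OF \<rho>])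
  \<comment> \<open>Solvability relation: if the right-hand side \<open>f + c\<close> is attained,
    pairing with \<open>\<rho>\<close> determines \<open>c\<close> as soon as the integral of
    \<open>\<rho>\<close> is nonzero.\<close>
  have test: "(LINT x|cell. \<rho> x * f x) + c * (LINT x|cell. \<rho> x) = 0"
    if f: "sq_integrable cell f" and \<phi>: "\<phi> \<in> H_per0 2" "AE x in cell. nondiv_op A b (grad \<phi>) x = f x + c" for f \<phi> c
  proof -
    have fi: "integrable cell (\<lambda>x. \<rho> x * f x)" by (rule sq_integrable_mult[OF \<rho> f])
    have "0 = (LINT x|cell. \<rho> x * nondiv_op A b (grad \<phi>) x)" using \<rho>L[OF H_per0_2D[OF \<phi>(1)]] by simp
    also have "\<dots> = (LINT x|cell. \<rho> x * f x + c * \<rho> x)"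
    proof (rule integral_cong_AE)
      show "AE x in cell. \<rho> x * nondiv_op A b (grad \<phi>) x = \<rho> x * f x + c * \<rho> x"
        using \<phi>(2) by eventually_elim (simp add: algebra_simps)
      show "(\<lambda>x. \<rho> x * nondiv_op A b (grad \<phi>) x) \<in> borel_measurable cell"
        by (intro borel_measurable_times sq_integrable_measurable[OF \<rho>] measurable_nondiv_op[OF B] grad_H1_per0_vec H_per0_2D \<phi>)
      show "(\<lambda>x. \<rho> x * f x + c * \<rho> x) \<in> borel_measurable cell"
        by (intro borel_measurable_integrable Bochner_Integration.integrable_add integrable_mult_right fi \<rho>i)
    qed
    also have "\<dots> = (LINT x|cell. \<rho> x * f x) + c * (LINT x|cell. \<rho> x)" using fi \<rho>i by simp
    finally show ?thesis by simp
  qed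
  have \<rho>0: "(LINT x|cell. \<rho> x) \<noteq> 0"
  proof
    assume z: "(LINT x|cell. \<rho> x) = 0"
    obtain \<phi> c where \<phi>: "\<phi> \<in> H_per0 2" "AE x in cell. nondiv_op A b (grad \<phi>) x = \<rho> x + c"
      by (rule nondiv_solve[OF B \<rho>])
    \<comment> \<open>Here \<open>f\<close> is \<open>\<rho>\<close> itself, and the assumption
      \<open>z\<close> removes the term with the constant.\<close>
    have "(LINT x|cell. (\<rho> x)\<^sup>2) = 0" using test[OF \<rho> \<phi>] z by (simp add: power2_eq_square)
    then have "AE x in cell. (\<rho> x)\<^sup>2 = 0"
      using integral_nonneg_eq_0_iff_AE[OF sq_integrable_square[OF \<rho>]] by simp
    then have "AE x in cell. r x = 0" using g by eventually_elim (simp add: \<rho>_def)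
    then have "(LINT x|cell. r x) = 0" by (rule integral_eq_zero_AE)
    with r1 show False by simp
  qed
  have bs: "sq_integrable cell (\<lambda>x. - b_tilde A b x $ j)"
    by (rule sq_integrable_minus[OF sq_integrable_b_tilde[OF B]])
  obtain \<chi>j c where \<chi>j: "\<chi>j \<in> H_per0 2" "AE x in cell. nondiv_op A b (grad \<chi>j) x = - b_tilde A b x $ j + c"
    by (rule nondiv_solve[OF B bs])
  have "c = 0" using test[OF bs \<chi>j] \<rho>b \<rho>0 by simp
  then show thesis using \<chi>j by (intro that[of \<chi>j]) simp_all
qed

text \<open>\<open>gam\<close> is positive almost everywhere, so multiplying the equation by it
  loses nothing.\<close>

lemma equation_iff_nondiv_op:
  assumes B: "setting_B lam Lam \<delta> A b" and \<phi>: "\<phi> \<in> H_per 2"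
  shows "(AE x in lebesgue. x \<in> unit_cell \<longrightarrow> - (A x \<bullet> hessian \<phi> x) - b x \<bullet> grad \<phi> x = b x $ j)
    \<longleftrightarrow> (AE x in cell. nondiv_op A b (grad \<phi>) x = - b_tilde A b x $ j)"
proof -
  have *: "AE x in cell. - (A x \<bullet> hessian \<phi> x) - b x \<bullet> grad \<phi> x = b x $ j
      \<longleftrightarrow> nondiv_op A b (grad \<phi>) x = - b_tilde A b x $ j"
    using AE_cellI[OF setting_B_D(6)[OF B]] AE_cellI[OF nondiv_op_grad[OF \<phi>, of A b]]
  proof eventually_elim
    case (elim x)
    have "nondiv_op A b (grad \<phi>) x + b_tilde A b x $ j
        = gam A b x * (A x \<bullet> hessian \<phi> x + b x \<bullet> grad \<phi> x + b x $ j)"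
      using elim(2) by (simp add: b_tilde_def distrib_left)
    then have "nondiv_op A b (grad \<phi>) x = - b_tilde A b x $ j
        \<longleftrightarrow> A x \<bullet> hessian \<phi> x + b x \<bullet> grad \<phi> x + b x $ j = 0"
      using elim(1) by (smt (verit) mult_eq_0_iff)
    then show ?case by linarith
  qed
  show ?thesis unfolding AE_cell_iff[symmetric]
  proof
    assume "AE x in cell. - (A x \<bullet> hessian \<phi> x) - b x \<bullet> grad \<phi> x = b x $ j"
    with * show "AE x in cell. nondiv_op A b (grad \<phi>) x = - b_tilde A b x $ j" by eventually_elim blast
  next
    assume "AE x in cell. nondiv_op A b (grad \<phi>) x = - b_tilde A b x $ j"
    with * show "AE x in cell. - (A x \<bullet> hessian \<phi> x) - b x \<bullet> grad \<phi> x = b x $ j" by eventually_elim blast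
  qed
qed

theorem theorem4p2:
  fixes lam Lam \<delta> :: real
  shows "\<exists>C>0. \<forall>(A :: real^'n \<Rightarrow> real^'n^'n) (b :: real^'n \<Rightarrow> real^'n) (r :: real^'n \<Rightarrow> real) (j :: 'n).
    setting_B lam Lam \<delta> A b \<longrightarrow>
    invariant_density A b r \<longrightarrow>
    int_cell (\<lambda>x. r x *\<^sub>R b x) = 0 \<longrightarrow>
    (\<exists>\<chi>j.
      unique_ae (H_per0 2)
        (\<lambda>u. \<forall>\<phi> \<in> H_per0 2. B1 A b \<phi> u = - int_cell (\<lambda>x. b_tilde A b x $ j * laplacian \<phi> x)) \<chi>j \<and>
      unique_ae (H_per0 2)
        (\<lambda>u. AE x in lebesgue. x \<in> unit_cell \<longrightarrow>
               - (A x \<bullet> hessian u x) - b x \<bullet> grad u x = b x $ j) \<chi>j \<and>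
      unique_ae H1_per0_vec
        (\<lambda>v. \<forall>w \<in> H1_per0_vec. B2 A b w v = - int_cell (\<lambda>x. b_tilde A b x $ j * divergence w x))
        (grad \<chi>j) \<and>
      (\<forall>P. closed_subspace_H1_per0 P \<longrightarrow>
        (\<exists>\<xi>h.
          unique_ae P
            (\<lambda>v. \<forall>w \<in> P. B2 A b w v = - int_cell (\<lambda>x. b_tilde A b x $ j * divergence w x)) \<xi>h \<and>
          H1_norm_cell (\<lambda>x. grad \<chi>j x - \<xi>h x)
            \<le> C * (INF w\<in>P. L2_norm_cell (weak_jacobian (\<lambda>x. grad \<chi>j x - w x))))))"
proof -
  define q where "q = Cordes_factor \<delta>"
  \<comment> \<open>At this point \<open>\<delta>\<close> is an arbitrary real and \<open>q\<close>
    may lie outside the admissible range, hence the default 1. Under \<open>setting_B\<close> the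
    first branch applies; its two factors come from \<open>H1_norm_cell_le\<close> and
    \<open>Cea\<close>.\<close>
  define C where "C = (if 0 \<le> q \<and> q < 1 then sqrt (1 + 1 / (4 * pi\<^sup>2)) * ((1 + q) / (1 - q)) else 1)"
  have "0 < 1 + 1 / (4 * pi\<^sup>2)" by (simp add: add_pos_pos)
  then have C: "C > 0" by (auto simp: C_def)
  show ?thesis
  proof (intro exI[of _ C] conjI C allI impI)
    fix A :: "real^'n \<Rightarrow> real^'n^'n" and b :: "real^'n \<Rightarrow> real^'n" and r :: "real^'n \<Rightarrow> real" and j :: 'n
    assume B: "setting_B lam Lam \<delta> A b" and inv: "invariant_density A b r"
      and cen: "int_cell (\<lambda>x. r x *\<^sub>R b x) = 0"
    have q: "0 \<le> q" "q < 1"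
      using Cordes_factor_bounds[OF setting_B_D(5)[OF B] setting_B_D(4)[OF B]] by (auto simp: q_def)
    define f where "f x = - b_tilde A b x $ j" for x
    have f: "sq_integrable cell f"
      unfolding f_def[abs_def] by (rule sq_integrable_minus[OF sq_integrable_b_tilde[OF B]])
    have rhs: "- int_cell (\<lambda>x. b_tilde A b x $ j * h x) = (LINT x|cell. h x * f x)" for h
    proof -
      have "(\<lambda>x. h x * f x) = (\<lambda>x. - (b_tilde A b x $ j * h x))" by (simp add: f_def mult.commute)
      then show ?thesis by (simp add: int_cell_eq)
    qed
    obtain \<chi>j where \<chi>j: "\<chi>j \<in> H_per0 2" "AE x in cell. nondiv_op A b (grad \<chi>j) x = - b_tilde A b x $ j"
      by (rule corrector_exists[OF B inv cen])
    note \<chi>j2 = H_per0_2D[OF \<chi>j(1)]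
    note gH = grad_H1_per0_vec[OF \<chi>j2]
    \<comment> \<open>The equation holds pointwise, so the gradient satisfies the \<open>B2\<close>
      identity against all fields and not just against gradients. This makes it comparable with
      Galerkin solutions on any subspace.\<close>
    have B2_sol: "B2 A b w (grad \<phi>) = (LINT x|cell. divergence w x * f x)"
      if w: "w \<in> H1_per0_vec" and \<phi>: "\<phi> \<in> H_per0 2" "AE x in cell. nondiv_op A b (grad \<phi>) x = - b_tilde A b x $ j" for w \<phi>
      unfolding B2_grad[OF H_per0_2D[OF \<phi>(1)]]
    proof (rule integral_cong_AE)
      show "AE x in cell. divergence w x * nondiv_op A b (grad \<phi>) x = divergence w x * f x"
        using \<phi>(2) by eventually_elim (simp add: f_def)
    qed (intro borel_measurable_times sq_integrable_measurable sq_integrable_divergence w f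
        sq_integrable_nondiv_op[OF B] grad_H1_per0_vec H_per0_2D \<phi>(1))+
    have B1_sol: "B1 A b \<psi> \<phi> = (LINT x|cell. laplacian \<psi> x * f x)"
      if "\<phi> \<in> H_per0 2" "AE x in cell. nondiv_op A b (grad \<phi>) x = - b_tilde A b x $ j" "\<psi> \<in> H_per0 2" for \<phi> \<psi>
      using B2_sol[OF grad_H1_per0_vec[OF H_per0_2D[OF that(3)]] that(1,2)]
      by (simp add: B1_eq_B2[OF B H_per0_2D[OF that(1)] H_per0_2D[OF that(3)]] divergence_grad)
    \<comment> \<open>Uniqueness of the potential is inherited from coercivity of \<open>B2\<close>,
      applied to the gradient of the difference.\<close>
    have B1_unique: "AE x in lebesgue. v x = \<chi>j x"
      if v: "v \<in> H_per0 2" "\<And>\<psi>. \<psi> \<in> H_per0 2 \<Longrightarrow> B1 A b \<psi> v = (LINT x|cell. laplacian \<psi> x * f x)" for v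
    proof -
      define d where "d = (\<lambda>x. v x - \<chi>j x)"
      have d: "d \<in> H_per0 2" unfolding d_def by (rule H_per0_2_diff[OF v(1) \<chi>j(1)])
      note vH = grad_H1_per0_vec[OF H_per0_2D[OF v(1)]]
      note dH = grad_H1_per0_vec[OF H_per0_2D[OF d]]
      \<comment> \<open>The gradient of a difference is the difference of the gradients only almost
        everywhere, hence the detour through \<open>B2_cong_AE\<close>.\<close>
      have "AE x in lebesgue. grad d x = grad v x - grad \<chi>j x"
        unfolding d_def by (rule grad_diff[OF H_per2D(1)[OF H_per0_2D[OF v(1)]] H_per2D(1)[OF \<chi>j2]])
      from B2_cong_AE[OF B dH H1v_diff[OF vH gH] this dH]
      have "B2 A b (grad d) (grad d) = B2 A b (grad d) (grad v) - B2 A b (grad d) (grad \<chi>j)"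
        by (simp add: B2_diff_right[OF B vH gH dH])
      also have "\<dots> = 0"
        using v(2)[OF d] B1_sol[OF \<chi>j d]
        by (simp add: B1_eq_B2[OF B H_per0_2D[OF v(1)] H_per0_2D[OF d]] B1_eq_B2[OF B \<chi>j2 H_per0_2D[OF d]])
      finally have "AE x in lebesgue. grad d x = 0" by (rule B2_zero_imp_AE[OF B dH])
      then have "AE x in lebesgue. grad v x = grad \<chi>j x"
        using grad_diff[OF H_per2D(1)[OF H_per0_2D[OF v(1)]] H_per2D(1)[OF \<chi>j2]] unfolding d_def
        by eventually_elim simp
      then show ?thesis by (rule grad_eq_imp_eq[OF v(1) \<chi>j(1)])
    qed
    have full: "closed_subspace_H1_per0 (H1_per0_vec :: (real^'n \<Rightarrow> real^'n) set)"
      by (simp add: closed_subspace_H1_per0_def H1v_zero H1v_add H1v_scale)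
    show "\<exists>\<chi>j.
      unique_ae (H_per0 2)
        (\<lambda>u. \<forall>\<phi> \<in> H_per0 2. B1 A b \<phi> u = - int_cell (\<lambda>x. b_tilde A b x $ j * laplacian \<phi> x)) \<chi>j \<and>
      unique_ae (H_per0 2)
        (\<lambda>u. AE x in lebesgue. x \<in> unit_cell \<longrightarrow>
               - (A x \<bullet> hessian u x) - b x \<bullet> grad u x = b x $ j) \<chi>j \<and>
      unique_ae H1_per0_vec
        (\<lambda>v. \<forall>w \<in> H1_per0_vec. B2 A b w v = - int_cell (\<lambda>x. b_tilde A b x $ j * divergence w x))
        (grad \<chi>j) \<and>
      (\<forall>P. closed_subspace_H1_per0 P \<longrightarrow>
        (\<exists>\<xi>h.
          unique_ae P
            (\<lambda>v. \<forall>w \<in> P. B2 A b w v = - int_cell (\<lambda>x. b_tilde A b x $ j * divergence w x)) \<xi>h \<and>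
          H1_norm_cell (\<lambda>x. grad \<chi>j x - \<xi>h x)
            \<le> C * (INF w\<in>P. L2_norm_cell (weak_jacobian (\<lambda>x. grad \<chi>j x - w x)))))"
      unfolding rhs
    proof (intro exI[of _ \<chi>j] conjI allI impI)
      show "unique_ae (H_per0 2) (\<lambda>u. \<forall>\<phi>\<in>H_per0 2. B1 A b \<phi> u = (LINT x|cell. laplacian \<phi> x * f x)) \<chi>j"
        unfolding unique_ae_def using \<chi>j(1) B1_sol[OF \<chi>j] B1_unique by blast
      show "unique_ae (H_per0 2)
        (\<lambda>u. AE x in lebesgue. x \<in> unit_cell \<longrightarrow> - (A x \<bullet> hessian u x) - b x \<bullet> grad u x = b x $ j) \<chi>j"
        unfolding unique_ae_def
      proof (intro conjI ballI impI \<chi>j(1))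
        show "AE x in lebesgue. x \<in> unit_cell \<longrightarrow> - (A x \<bullet> hessian \<chi>j x) - b x \<bullet> grad \<chi>j x = b x $ j"
          unfolding equation_iff_nondiv_op[OF B \<chi>j2] by (rule \<chi>j(2))
        fix v assume v: "v \<in> H_per0 2"
          "AE x in lebesgue. x \<in> unit_cell \<longrightarrow> - (A x \<bullet> hessian v x) - b x \<bullet> grad v x = b x $ j"
        have "AE x in cell. nondiv_op A b (grad v) x = - b_tilde A b x $ j"
          using v(2) unfolding equation_iff_nondiv_op[OF B H_per0_2D[OF v(1)]] .
        then show "AE x in lebesgue. v x = \<chi>j x" by (intro B1_unique v(1) B1_sol)
      qed
      show "unique_ae H1_per0_vec (\<lambda>v. \<forall>w\<in>H1_per0_vec. B2 A b w v = (LINT x|cell. divergence w x * f x)) (grad \<chi>j)"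
        unfolding unique_ae_def
      proof (intro conjI ballI impI gH)
        show "B2 A b w (grad \<chi>j) = (LINT x|cell. divergence w x * f x)" if "w \<in> H1_per0_vec" for w
          by (rule B2_sol[OF that \<chi>j])
        show "AE x in lebesgue. v x = grad \<chi>j x"
          if "v \<in> H1_per0_vec" "\<forall>w\<in>H1_per0_vec. B2 A b w v = (LINT x|cell. divergence w x * f x)" for v
          by (rule Galerkin_unique[OF B full that(1) gH]) (use that(2) B2_sol[OF _ \<chi>j] in simp)
      qed
      fix P :: "(real^'n \<Rightarrow> real^'n) set" assume P: "closed_subspace_H1_per0 P"
      have sub: "w \<in> H1_per0_vec" if "w \<in> P" for w using P that by (auto simp: closed_subspace_H1_per0_def)
      obtain \<xi> where \<xi>: "\<xi> \<in> P" "\<And>w. w \<in> P \<Longrightarrow> B2 A b w \<xi> = (LINT x|cell. divergence w x * f x)"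
        using Galerkin_exists[OF B P f] by blast
      \<comment> \<open>Galerkin orthogonality in the form consumed by \<open>Cea\<close>.\<close>
      have eq: "B2 A b w (grad \<chi>j) = B2 A b w \<xi>" if "w \<in> P" for w
        by (simp add: \<xi>(2)[OF that] B2_sol[OF sub[OF that] \<chi>j])
      have norm_eq: "L2_norm_cell (weak_jacobian w) = sqrt (jac_inner w w)" for w :: "real^'n \<Rightarrow> real^'n"
        by (simp add: L2_norm_cell_def int_cell_eq jac_inner_def power2_norm_eq_inner)
      \<comment> \<open>Divided by \<open>C\<close>, the left side is a lower bound for every member
        of the infimum.\<close>
      have est: "H1_norm_cell (\<lambda>x. grad \<chi>j x - \<xi> x) / C \<le> L2_norm_cell (weak_jacobian (\<lambda>x. grad \<chi>j x - w x))"
        if w: "w \<in> P" for w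
      proof -
        define t where "t = sqrt (jac_inner (\<lambda>x. grad \<chi>j x - w x) (\<lambda>x. grad \<chi>j x - w x))"
        have "H1_norm_cell (\<lambda>x. grad \<chi>j x - \<xi> x)
            \<le> sqrt (1 + 1 / (4 * pi\<^sup>2)) * sqrt (jac_inner (\<lambda>x. grad \<chi>j x - \<xi> x) (\<lambda>x. grad \<chi>j x - \<xi> x))"
          by (rule H1_norm_cell_le[OF H1v_diff[OF gH sub[OF \<xi>(1)]]])
        also have "\<dots> \<le> sqrt (1 + 1 / (4 * pi\<^sup>2)) * ((1 + q) / (1 - q) * t)"
          unfolding q_def t_def by (intro mult_left_mono Cea[OF B P gH \<xi>(1) w eq]) auto
        also have "\<dots> = C * t" using q by (simp add: C_def)
        finally show ?thesis using C by (simp add: norm_eq t_def[symmetric] divide_le_eq mult.commute)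
      qed
      have "H1_norm_cell (\<lambda>x. grad \<chi>j x - \<xi> x) / C \<le> (INF w\<in>P. L2_norm_cell (weak_jacobian (\<lambda>x. grad \<chi>j x - w x)))"
        by (rule cINF_greatest) (use \<xi>(1) est in auto)
      then have "H1_norm_cell (\<lambda>x. grad \<chi>j x - \<xi> x) \<le> C * (INF w\<in>P. L2_norm_cell (weak_jacobian (\<lambda>x. grad \<chi>j x - w x)))"
        using C by (simp add: divide_le_eq mult.commute)
      moreover have "unique_ae P (\<lambda>v. \<forall>w\<in>P. B2 A b w v = (LINT x|cell. divergence w x * f x)) \<xi>"
        unfolding unique_ae_def
      proof (intro conjI ballI impI \<xi>)
        show "AE x in lebesgue. v x = \<xi> x"
          if "v \<in> P" "\<forall>w\<in>P. B2 A b w v = (LINT x|cell. divergence w x * f x)" for v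
          by (rule Galerkin_unique[OF B P that(1) \<xi>(1)]) (use that(2) \<xi>(2) in simp)
      qed
      ultimately show "\<exists>\<xi>h.
          unique_ae P (\<lambda>v. \<forall>w \<in> P. B2 A b w v = (LINT x|cell. divergence w x * f x)) \<xi>h \<and>
          H1_norm_cell (\<lambda>x. grad \<chi>j x - \<xi>h x)
            \<le> C * (INF w\<in>P. L2_norm_cell (weak_jacobian (\<lambda>x. grad \<chi>j x - w x)))" by blast
    qed
  qed
qed

end
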